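(* Let $E$ be an $\mathfrak{L}^\infty$-space, let $F$ be a Banach space, and let $p,q\in[1,\infty)$. Then a linear operator $T:E\to F$ is weakly compact if and only if $$\lim_{n\to\infty}\frac{\pi_{q,p}^{(n)}(T)}{n^{1/q}}=0 .$$
   Context: Banach spaces are over $\mathbb{C}$; $E'$ denotes the dual of $E$ and $E_{[1]}$ its closed unit ball. For $r\in[1,\infty]$, a Banach space $E$ is an $\mathfrak{L}^r$-space (in the sense of Lindenstrauss and Pełczyński) if there is $\lambda>1$ such that, for every finite-dimensional subspace $M$ of $E$, there are a finite-dimensional subspace $N$ of $E$ containing $M$ and an isomorphism $T:N\to\ell^r_{\dim N}$ with $\|T\|\,\|T^{-1}\|\le\lambda$. The operator $T:E\to F$ is only assumed linear (boundedness is not assumed). For $x_1,\ldots,x_n\in E$, the weak $p$-summing norm is $$\mu_{p,n}(x_1,\ldots,x_n):=\sup\Big\{\Big(\sum_{i=1}^n|\langle x_i,\lambda\rangle|^p\Big)^{1/p}:\lambda\in E'_{[1]}\Big\}.$$ The $(q,p)$-summing constants of $T$ are $$\pi_{q,p}^{(n)}(T):=\sup\Big\{\Big(\sum_{i=1}^n\|Tx_i\|^q\Big)^{1/q}:x_1,\ldots,x_n\in E,\ \mu_{p,n}(x_1,\ldots,x_n)\le1\Big\}\in[0,\infty].$$ *)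

theory Defs
  imports "HOL-Analysis.Analysis"
begin

text \<open>
  The distribution has type classes only for real normed spaces. A complex normed space is
  a real normed space with a complex scalar multiplication that extends the real one.
\<close>

class complex_normed_vector = real_normed_vector +
  fixes scaleC :: "complex \<Rightarrow> 'a \<Rightarrow> 'a"  (infixr \<open>*\<^sub>C\<close> 75)
  assumes scaleC_add_right: "a *\<^sub>C (x + y) = a *\<^sub>C x + a *\<^sub>C y"
    and scaleC_add_left: "(a + b) *\<^sub>C x = a *\<^sub>C x + b *\<^sub>C x"
    and scaleC_scaleC: "a *\<^sub>C (b *\<^sub>C x) = (a * b) *\<^sub>C x"
    and scaleC_one: "1 *\<^sub>C x = x"
    and scaleR_scaleC: "r *\<^sub>R x = complex_of_real r *\<^sub>C x"
    and norm_scaleC: "norm (a *\<^sub>C x) = cmod a * norm x"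

class complex_banach = complex_normed_vector + banach

instantiation complex :: complex_banach
begin

definition scaleC_complex :: "complex \<Rightarrow> complex \<Rightarrow> complex"
  where "scaleC_complex a x = a * x"

instance
  by standard (simp_all add: scaleC_complex_def algebra_simps scaleR_conv_of_real norm_mult)

end

global_interpretation complex_vector:
  vector_space "scaleC :: complex \<Rightarrow> 'a \<Rightarrow> 'a::complex_normed_vector"
  by standard (simp_all add: scaleC_add_right scaleC_add_left scaleC_scaleC scaleC_one)

abbreviation clinear :: "('a::complex_normed_vector \<Rightarrow> 'b::complex_normed_vector) \<Rightarrow> bool"
  where "clinear \<equiv> Vector_Spaces.linear scaleC scaleC"

definition fin_dim_subspace :: "'a::complex_normed_vector set \<Rightarrow> bool"
  where "fin_dim_subspace M \<longleftrightarrow>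
    complex_vector.subspace M \<and> (\<exists>B. finite B \<and> M = complex_vector.span B)"


text \<open>
  The space \<open>\<ell>\<^sup>r\<^sub>n\<close> is modelled by the sequences vanishing from index \<open>n\<close> on,
  since \<open>n\<close> has to range over all natural numbers inside a formula.
\<close>

definition lr_carrier :: "nat \<Rightarrow> (nat \<Rightarrow> complex) set"
  where "lr_carrier n = {v. \<forall>i\<ge>n. v i = 0}"

definition lr_norm :: "ennreal \<Rightarrow> nat \<Rightarrow> (nat \<Rightarrow> complex) \<Rightarrow> real"
  where "lr_norm r n v =
    (if r = \<infinity> then Max (insert 0 ((\<lambda>i. cmod (v i)) ` {..<n}))
     else (\<Sum>i<n. cmod (v i) powr enn2real r) powr (1 / enn2real r))"

text \<open>
  Operator norm of a map defined on the subset \<open>S\<close>, with respect to explicitly given norms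
  \<open>\<nu>\<close> on the domain and \<open>\<nu>'\<close> on the codomain.
\<close>

definition op_norm_on :: "'a set \<Rightarrow> ('a \<Rightarrow> real) \<Rightarrow> ('b \<Rightarrow> real) \<Rightarrow> ('a \<Rightarrow> 'b) \<Rightarrow> ennreal"
  where "op_norm_on S \<nu> \<nu>' f = (SUP x\<in>{x\<in>S. \<nu> x \<le> 1}. ennreal (\<nu>' (f x)))"

definition lr_isomorphism ::
    "'a::complex_normed_vector set \<Rightarrow> nat \<Rightarrow> ('a \<Rightarrow> nat \<Rightarrow> complex) \<Rightarrow> bool"
  where "lr_isomorphism N n T \<longleftrightarrow>
    bij_betw T N (lr_carrier n) \<and>
    (\<forall>x\<in>N. \<forall>y\<in>N. \<forall>i. T (x + y) i = T x i + T y i) \<and>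
    (\<forall>c. \<forall>x\<in>N. \<forall>i. T (c *\<^sub>C x) i = c * T x i)"

text \<open>\<open>\<LL>\<^sup>r\<close>-spaces of Lindenstrauss and Pelczynski; the Banach space is the whole type.\<close>

definition Lr_space :: "ennreal \<Rightarrow> 'a::complex_banach itself \<Rightarrow> bool"
  where "Lr_space r E \<longleftrightarrow> 1 \<le> r \<and>
    (\<exists>c>1::real. \<forall>M::'a set. fin_dim_subspace M \<longrightarrow>
      (\<exists>N T. fin_dim_subspace N \<and> M \<subseteq> N \<and>
        lr_isomorphism N (complex_vector.dim N) T \<and>
        op_norm_on N norm (lr_norm r (complex_vector.dim N)) T *
        op_norm_on (lr_carrier (complex_vector.dim N)) (lr_norm r (complex_vector.dim N)) norm
          (inv_into N T) \<le> ennreal c))"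


definition dual_space :: "('a::complex_normed_vector \<Rightarrow> complex) set"
  where "dual_space = {\<phi>. clinear \<phi> \<and> bounded_linear \<phi>}"

definition dual_unit_ball :: "('a::complex_normed_vector \<Rightarrow> complex) set"
  where "dual_unit_ball = {\<phi>\<in>dual_space. onorm \<phi> \<le> 1}"

definition weak_topology :: "'a::complex_normed_vector topology"
  where "weak_topology = topology_generated_by {\<phi> -` U |\<phi> U. \<phi> \<in> dual_space \<and> open U}"

text \<open>The image of the closed unit ball is relatively compact in the weak topology.\<close>

definition weakly_compact_operator ::
    "('a::complex_normed_vector \<Rightarrow> 'b::complex_normed_vector) \<Rightarrow> bool"
  where "weakly_compact_operator T \<longleftrightarrow>
    compactin weak_topology (weak_topology closure_of (T ` cball 0 1))"


text \<open>
  An \<open>n\<close>-tuple is the restriction of a sequence to the indices \<open>i < n\<close>. All suprema are taken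
  in the extended nonnegative reals, because \<open>T\<close> need not be bounded.
\<close>

definition weak_summing_norm :: "real \<Rightarrow> nat \<Rightarrow> (nat \<Rightarrow> 'a::complex_normed_vector) \<Rightarrow> ennreal"
  where "weak_summing_norm p n x =
    (SUP \<phi>\<in>dual_unit_ball. ennreal ((\<Sum>i<n. cmod (\<phi> (x i)) powr p) powr (1 / p)))"

definition summing_const ::
    "real \<Rightarrow> real \<Rightarrow> nat \<Rightarrow> ('a::complex_normed_vector \<Rightarrow> 'b::complex_normed_vector) \<Rightarrow> ennreal"
  where "summing_const q p n T =
    (SUP x\<in>{x. weak_summing_norm p n x \<le> 1}.
       ennreal ((\<Sum>i<n. norm (T (x i)) powr q) powr (1 / q)))"

end

theory Submission
  imports Defs
begin

text \<open>
  By the Lindenstrauss--Pelczynski property and an ultrafilter on the finite subsets of \<open>E\<close>,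
  the operator \<open>T\<close> is a weak limit of operators defined on the bounded functions on a set, into
  which \<open>E\<close> embeds; there pointwise multiplication, indicator functions and variations of
  functionals are available. The pivot is the estimate \<open>\<parallel>T x\<parallel> \<le> N * \<mu>(|x|) + e\<close> on the unit ball,
  where \<open>\<mu>\<close> is a finite sum of variations of functionals arising from \<open>T\<close> (``control''). If it fails
  for some \<open>e\<close>, there are functions \<open>x\<^sub>n\<close> and functionals \<open>\<phi>\<^sub>n\<close> with \<open>|\<phi>\<^sub>n(x\<^sub>n)| > e\<close> and
  \<open>|\<phi>\<^sub>j|(|x\<^sub>n|)\<close> as small as desired for \<open>j < n\<close>.

  If \<open>T\<close> is weakly compact, such a sequence would produce a bounded sequence whose images violate the
  double limit criterion, so control holds; it bounds \<open>\<Sum> \<parallel>T x\<^sub>i\<parallel>\<close> by \<open>n e + M\<close> because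
  \<open>|t| \<le> \<eta> + \<eta>\<^bsup>1-p\<^esup> |t|\<^bsup>p\<^esup>\<close>. Conversely, cutting the \<open>x\<^sub>n\<close> off makes any number of them disjoint, so if the
  summing constants are \<open>o(n\<^bsup>1/q\<^esup>)\<close> then control holds; replacing \<open>|x|\<close> by \<open>t + |x|\<^sup>2 / t\<close> bounds
  \<open>T\<close> by quadratic forms up to \<open>e\<close>, and the parallelogram law then represents every weak cluster
  point of \<open>T(ball)\<close> by a vector of \<open>F\<close>.
\<close>

subsection \<open>The Hahn--Banach theorem\<close>

text \<open>Multiplying or cutting off an element of \<open>E\<close> leads out of \<open>E\<close>,
  and coordinates belonging to different finite sets are unrelated. So \<open>J\<close> records the
  coordinates for all sets at once, and \<open>R X\<close> comes back to \<open>E\<close> through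
  the block of \<open>X\<close> alone, at the uniform cost \<open>c\<close>. The vectors
  \<open>T (R X f)\<close> need not converge in \<open>F\<close>; only their values under
  functionals do, and weak compactness is what turns such limits back into vectors. A sequence
  showing failure of control is useless until its functions are combined within a bounded set. Sums
  of the \<open>x\<^sub>n\<close> may be unbounded: in the first direction damped steps keep the
  combinations in the ball, in the second a cutoff in favour of later functions makes the supports
  disjoint. Both respect the one-sided smallness, which only concerns earlier functionals on later
  functions. Boundedness of \<open>T\<close> is derived separately on each side, by Baire's theorem
  or from one finite summing constant. The exponents matter little: boundedness reduces
  \<open>q\<close> to one, and disjoint functions are weakly summable for every
  \<open>p\<close>.\<close>

definition sublinear :: "('a::real_vector \<Rightarrow> real) \<Rightarrow> bool"
  where "sublinear q \<longleftrightarrow> (\<forall>x y. q (x + y) \<le> q x + q y) \<and> (\<forall>t\<ge>0. \<forall>x. q (t *\<^sub>R x) = t * q x)"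

lemma sublinear_add: "sublinear q \<Longrightarrow> q (x + y) \<le> q x + q y"
  and sublinear_scale: "sublinear q \<Longrightarrow> 0 \<le> t \<Longrightarrow> q (t *\<^sub>R x) = t * q x"
  by (auto simp: sublinear_def)

lemma sublinear_zero: "sublinear q \<Longrightarrow> q 0 = 0"
  using sublinear_scale[of q 0 0] by simp

lemma sublinear_minus: "sublinear q \<Longrightarrow> - q (- x) \<le> q x"
  using sublinear_add[of q x "-x"] sublinear_zero[of q] by simp

lemma sublinearI_scale_le:
  assumes "\<And>x y. q (x + y) \<le> q x + q y" and "\<And>t x. 0 < t \<Longrightarrow> q (t *\<^sub>R x) \<le> t * q x" and "q 0 = 0"
  shows "sublinear q"
  unfolding sublinear_def
proof (intro conjI allI impI)
  fix t :: real and x assume "0 \<le> t"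
  show "q (t *\<^sub>R x) = t * q x"
  proof (cases "t = 0")
    case True then show ?thesis using assms(3) by simp
  next
    case False
    then have t: "0 < t" using \<open>0 \<le> t\<close> by simp
    have "q (inverse t *\<^sub>R (t *\<^sub>R x)) \<le> inverse t * q (t *\<^sub>R x)" using t by (intro assms(2)) simp
    then have "t * q x \<le> q (t *\<^sub>R x)" using t by (simp add: field_simps)
    then show ?thesis using assms(2)[OF t, of x] by simp
  qed
qed (use assms in auto)

text \<open>Subtracting \<open>t q(y)\<close> along the ray through \<open>y\<close> makes a sublinear functional smaller and
  linear in the direction \<open>y\<close>; a minimal one is therefore linear.\<close>

lemma sublinear_directional:
  fixes q :: "'a::real_vector \<Rightarrow> real" and y :: 'a
  assumes q: "sublinear q"
  defines "r \<equiv> \<lambda>x. INF t\<in>{0..}. q (x + t *\<^sub>R y) - t * q y"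
  shows "sublinear r" and "r x \<le> q (x + y) - q y" and "r x \<le> q x"
proof -
  have r_eq: "r x = (INF t\<in>{0..}. q (x + t *\<^sub>R y) - t * q y)" for x by (simp add: r_def)
  have bd: "- q (- x) \<le> q (x + t *\<^sub>R y) - t * q y" if "0 \<le> t" for t x
  proof -
    have "t * q y \<le> q (x + t *\<^sub>R y) + q (- x)"
      using sublinear_add[OF q, of "x + t *\<^sub>R y" "- x"] sublinear_scale[OF q that, of y] by simp
    then show ?thesis by simp
  qed
  have bb: "bdd_below ((\<lambda>t. q (x + t *\<^sub>R y) - t * q y) ` {0..})" for x
    by (rule bdd_belowI[of _ "- q (- x)"]) (use bd in auto)
  have rle: "r x \<le> q (x + t *\<^sub>R y) - t * q y" if "0 \<le> t" for t x
    unfolding r_def by (rule cINF_lower[OF bb]) (use that in simp)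
  show "r x \<le> q (x + y) - q y" using rle[of 1 x] by simp
  show rq: "r x \<le> q x" for x using rle[of 0 x] by simp
  show "sublinear r"
  proof (rule sublinearI_scale_le)
    fix x x'
    \<comment> \<open>The parameters \<open>t\<close> at \<open>x\<close> and \<open>s\<close> at
      \<open>x'\<close> combine to \<open>t + s\<close> at the sum; the two infima are then taken
      one after the other.\<close>
    have "r (x + x') - (q (x' + s *\<^sub>R y) - s * q y) \<le> r x" if s: "0 \<le> s" for s
    proof -
      have "r (x + x') - (q (x' + s *\<^sub>R y) - s * q y) \<le> q (x + t *\<^sub>R y) - t * q y" if "0 \<le> t" for t
        using rle[of "t + s" "x + x'"] sublinear_add[OF q, of "x + t *\<^sub>R y" "x' + s *\<^sub>R y"] s that
        by (simp add: algebra_simps)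
      then show ?thesis unfolding r_eq[of x] by (intro cINF_greatest) auto
    qed
    then have "r (x + x') - r x \<le> q (x' + s *\<^sub>R y) - s * q y" if "0 \<le> s" for s
      using that by (smt (verit))
    then have "r (x + x') - r x \<le> r x'" unfolding r_eq[of x'] by (intro cINF_greatest) auto
    then show "r (x + x') \<le> r x + r x'" by simp
  next
    fix a :: real and x assume a: "0 < a"
    have "inverse a * r (a *\<^sub>R x) \<le> q (x + t *\<^sub>R y) - t * q y" if "0 \<le> t" for t
    proof -
      have "r (a *\<^sub>R x) \<le> q (a *\<^sub>R (x + t *\<^sub>R y)) - (a * t) * q y"
        using rle[of "a * t" "a *\<^sub>R x"] a that by (simp add: algebra_simps)
      also have "\<dots> = a * (q (x + t *\<^sub>R y) - t * q y)"
        using sublinear_scale[OF q, of a "x + t *\<^sub>R y"] a by (simp add: algebra_simps)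
      finally show ?thesis using a by (simp add: field_simps)
    qed
    then have "inverse a * r (a *\<^sub>R x) \<le> r x" unfolding r_eq[of x] by (intro cINF_greatest) auto
    then show "r (a *\<^sub>R x) \<le> a * r x" using a by (simp add: field_simps)
  next
    have "0 \<le> q (0 + t *\<^sub>R y) - t * q y" if "0 \<le> t" for t
      using sublinear_scale[OF q that, of y] by simp
    then have "0 \<le> r 0" unfolding r_def by (intro cINF_greatest) auto
    moreover have "r 0 \<le> 0" using rq[of 0] sublinear_zero[OF q] by simp
    ultimately show "r 0 = 0" by simp
  qed
qed

text \<open>Subadditivity survives because members used at \<open>x\<close> and at \<open>y\<close>
  can both be replaced by the smaller of the two. The estimate \<open>- p (- x)\<close> keeps the
  infimum finite, so that it can serve as the bound in Zorn's lemma.\<close>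

lemma sublinear_Inf_chain:
  fixes C :: "('a::real_vector \<Rightarrow> real) set"
  assumes C: "C \<noteq> {}" "\<And>q. q \<in> C \<Longrightarrow> sublinear q \<and> q \<le> p"
    and chain: "\<And>q r. q \<in> C \<Longrightarrow> r \<in> C \<Longrightarrow> q \<le> r \<or> r \<le> q"
  defines "u \<equiv> \<lambda>x. INF q\<in>C. q x"
  shows "sublinear u" and "\<And>q. q \<in> C \<Longrightarrow> u \<le> q"
proof -
  have u_eq: "u x = (INF q\<in>C. q x)" for x by (simp add: u_def)
  have "- p (- x) \<le> q x" if "q \<in> C" for q x
    using C(2)[OF that] sublinear_minus[of q x] by (metis le_fun_def neg_le_iff_le order_trans)
  then have bb: "bdd_below ((\<lambda>q. q x) ` C)" for x
    by (auto intro!: bdd_belowI[of _ "- p (- x)"])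
  have ule: "u x \<le> q x" if "q \<in> C" for q x
    unfolding u_def by (rule cINF_lower[OF bb that])
  then show "\<And>q. q \<in> C \<Longrightarrow> u \<le> q" by (auto simp: le_fun_def)
  show "sublinear u"
  proof (rule sublinearI_scale_le)
    fix x y
    have "u (x + y) \<le> q x + r y" if qr: "q \<in> C" "r \<in> C" for q r
    proof -
      obtain s where s: "s \<in> C" "s \<le> q" "s \<le> r" using chain[OF qr] qr by blast
      have "u (x + y) \<le> s x + s y"
        using ule[OF s(1), of "x + y"] sublinear_add[of s x y] C(2)[OF s(1)] by auto
      then show ?thesis using s(2,3) by (smt (verit) le_funD)
    qed
    then have "u (x + y) - q x \<le> r y" if "q \<in> C" "r \<in> C" for q r using that by (smt (verit))
    then have "u (x + y) - q x \<le> u y" if "q \<in> C" for q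
      unfolding u_eq[of y] using C(1) that by (intro cINF_greatest) auto
    then have "u (x + y) - u y \<le> q x" if "q \<in> C" for q using that by (smt (verit))
    then have "u (x + y) - u y \<le> u x" unfolding u_eq[of x] using C(1) by (intro cINF_greatest) auto
    then show "u (x + y) \<le> u x + u y" by simp
  next
    fix t :: real and x assume t: "0 < t"
    have "inverse t * u (t *\<^sub>R x) \<le> q x" if "q \<in> C" for q
      using ule[OF that, of "t *\<^sub>R x"] sublinear_scale[of q t x] C(2)[OF that] t by (simp add: field_simps)
    then have "inverse t * u (t *\<^sub>R x) \<le> u x" unfolding u_eq[of x] using C(1) by (intro cINF_greatest) auto
    then show "u (t *\<^sub>R x) \<le> t * u x" using t by (simp add: field_simps)
  next
    have "(\<lambda>q. q 0) ` C = {0}" using C sublinear_zero by fastforce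
    then show "u 0 = 0" by (simp add: u_def)
  qed
qed

lemma linear_below_sublinear:
  fixes p :: "'a::real_vector \<Rightarrow> real"
  assumes p: "sublinear p"
  obtains q where "linear q" "\<And>x. q x \<le> p x"
proof -
  define A where "A = {q. sublinear q \<and> q \<le> p}"
  have "\<exists>m\<in>A. \<forall>a\<in>A. a \<le> m \<longrightarrow> a = m"
  proof (rule predicate_Zorn[where P = "\<lambda>a b. b \<le> a"])
    show "partial_order_on A (relation_of (\<lambda>a b. b \<le> a) A)"
      by (rule partial_order_on_relation_ofI) auto
    fix C assume "C \<in> Chains (relation_of (\<lambda>a b. b \<le> a) A)"
    then have CA: "C \<subseteq> A" and ch: "\<And>q r. q \<in> C \<Longrightarrow> r \<in> C \<Longrightarrow> q \<le> r \<or> r \<le> q"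
      by (auto simp: Chains_def relation_of_def)
    show "\<exists>u\<in>A. \<forall>a\<in>C. u \<le> a"
    proof (cases "C = {}")
      case True then show ?thesis using p by (auto simp: A_def)
    next
      case False
      note * = sublinear_Inf_chain[of C p, OF False _ ch]
      have "sublinear (\<lambda>x. INF q\<in>C. q x)" "\<And>q. q \<in> C \<Longrightarrow> (\<lambda>x. INF q\<in>C. q x) \<le> q"
        using * CA by (auto simp: A_def)
      moreover obtain q where "q \<in> C" using False by blast
      ultimately show ?thesis using CA unfolding A_def
        by (intro bexI[of _ "\<lambda>x. INF q\<in>C. q x"]) (auto intro: order_trans)
    qed
  qed
  then obtain q where q: "sublinear q" "q \<le> p" and min: "\<And>r. sublinear r \<Longrightarrow> r \<le> q \<Longrightarrow> r = q"
    by (auto simp: A_def intro: order_trans)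
  have add: "q (x + y) = q x + q y" for x y
  proof -
    define r where "r = (\<lambda>x. INF t\<in>{0..}. q (x + t *\<^sub>R y) - t * q y)"
    have d: "sublinear r" "r x \<le> q (x + y) - q y" "r x \<le> q x" for x
      unfolding r_def by (rule sublinear_directional[OF q(1)])+
    have "r = q" by (rule min) (use d in \<open>auto simp: le_fun_def\<close>)
    then have "q x \<le> q (x + y) - q y" using d(2)[where x = x] by simp
    then show ?thesis using sublinear_add[OF q(1), of x y] by simp
  qed
  have neg: "q (- x) = - q x" for x using add[of x "-x"] sublinear_zero[OF q(1)] by simp
  have "q (t *\<^sub>R x) = t * q x" for t x
  proof (cases "0 \<le> t")
    case False
    then show ?thesis using sublinear_scale[OF q(1), of "-t" x] neg[of "t *\<^sub>R x"] by simp
  qed (use sublinear_scale[OF q(1)] in auto)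
  then have "linear q" using add by (intro linearI) auto
  then show ?thesis using that q(2) by (auto simp: le_fun_def)
qed

text \<open>\<open>p\<close> is the infimal convolution of the norm with \<open>f\<close> on
  \<open>N\<close>. A linear functional below it is below the norm (take \<open>n = 0\<close>) and
  below \<open>f\<close> on \<open>N\<close>; as \<open>N\<close> is symmetric, the latter forces
  equality.\<close>

lemma real_Hahn_Banach:
  fixes f :: "'a::real_normed_vector \<Rightarrow> real"
  assumes N: "subspace N"
    and add: "\<And>x y. x \<in> N \<Longrightarrow> y \<in> N \<Longrightarrow> f (x + y) = f x + f y"
    and scale: "\<And>t x. x \<in> N \<Longrightarrow> f (t *\<^sub>R x) = t * f x"
    and bound: "\<And>x. x \<in> N \<Longrightarrow> f x \<le> norm x"
  obtains q where "linear q" "\<And>x. q x \<le> norm x" "\<And>x. x \<in> N \<Longrightarrow> q x = f x"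
proof -
  define p where "p = (\<lambda>x. INF n\<in>N. norm (x - n) + f n)"
  have p_eq: "p x = (INF n\<in>N. norm (x - n) + f n)" for x by (simp add: p_def)
  have N0: "0 \<in> N" using N by (rule subspace_0)
  have f0: "f 0 = 0" using scale[OF N0, of 0] by simp
  have neg: "f (- x) = - f x" if "x \<in> N" for x using scale[OF that, of "-1"] by simp
  have "- norm x \<le> norm (x - n) + f n" if "n \<in> N" for x n
    using bound[of "- n"] neg[OF that] subspace_neg[OF N that] norm_triangle_ineq2[of n x]
    by (simp add: norm_minus_commute)
  then have bb: "bdd_below ((\<lambda>n. norm (x - n) + f n) ` N)" for x
    by (auto intro!: bdd_belowI[of _ "- norm x"])
  have ple: "p x \<le> norm (x - n) + f n" if "n \<in> N" for x n
    unfolding p_def by (rule cINF_lower[OF bb that])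
  have "sublinear p"
  proof (rule sublinearI_scale_le)
    fix x y
    have "p (x + y) \<le> (norm (x - n) + f n) + (norm (y - m) + f m)" if "n \<in> N" "m \<in> N" for n m
      using ple[OF subspace_add[OF N that], of "x + y"] add[OF that] norm_triangle_ineq[of "x - n" "y - m"]
      by (simp add: algebra_simps)
    then have "p (x + y) - (norm (x - n) + f n) \<le> norm (y - m) + f m" if "n \<in> N" "m \<in> N" for n m
      using that by (smt (verit))
    then have "p (x + y) - (norm (x - n) + f n) \<le> p y" if "n \<in> N" for n
      unfolding p_eq[of y] using N0 that by (intro cINF_greatest) auto
    then have "p (x + y) - p y \<le> norm (x - n) + f n" if "n \<in> N" for n using that by (smt (verit))
    then have "p (x + y) - p y \<le> p x" unfolding p_eq[of x] using N0 by (intro cINF_greatest) auto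
    then show "p (x + y) \<le> p x + p y" by simp
  next
    fix t :: real and x assume t: "0 < t"
    have "inverse t * p (t *\<^sub>R x) \<le> norm (x - n) + f n" if "n \<in> N" for n
    proof -
      have "p (t *\<^sub>R x) \<le> norm (t *\<^sub>R (x - n)) + t * f n"
        using ple[OF subspace_scale[OF N that, of t], of "t *\<^sub>R x"] scale[OF that, of t]
        by (simp add: algebra_simps)
      then have "p (t *\<^sub>R x) \<le> t * (norm (x - n) + f n)" using t by (simp add: distrib_left)
      then show ?thesis using t by (simp add: field_simps)
    qed
    then have "inverse t * p (t *\<^sub>R x) \<le> p x" unfolding p_eq[of x] using N0 by (intro cINF_greatest) auto
    then show "p (t *\<^sub>R x) \<le> t * p x" using t by (simp add: field_simps)
  next
    have "0 \<le> norm (0 - n) + f n" if "n \<in> N" for n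
      using bound[of "- n"] neg[OF that] subspace_neg[OF N that] by simp
    then have "0 \<le> p 0" unfolding p_def using N0 by (intro cINF_greatest) auto
    then show "p 0 = 0" using ple[OF N0, of 0] f0 by simp
  qed
  then obtain q where q: "linear q" "\<And>x. q x \<le> p x" by (rule linear_below_sublinear) auto
  have "q x \<le> norm x" for x using q(2)[of x] ple[OF N0, of x] f0 by simp
  moreover have "q x = f x" if x: "x \<in> N" for x
  proof -
    have le: "q y \<le> f y" if "y \<in> N" for y using q(2)[of y] ple[OF that, of y] by simp
    show ?thesis using le[OF x] le[OF subspace_neg[OF N x]] neg[OF x] linear_neg[OF q(1), of x] by simp
  qed
  ultimately show ?thesis using that q(1) by blast
qed

section \<open>The complex dual unit ball and norming functionals\<close>

lemma clinear_iff: "clinear f \<longleftrightarrow> (\<forall>x y. f (x + y) = f x + f y) \<and> (\<forall>c x. f (c *\<^sub>C x) = c *\<^sub>C f x)"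
  unfolding Vector_Spaces.linear_iff
  by (auto intro: complex_vector.vector_space_axioms)

lemma mem_dual_unit_ball_iff:
  "\<phi> \<in> dual_unit_ball \<longleftrightarrow> clinear \<phi> \<and> (\<forall>x. cmod (\<phi> x) \<le> norm x)"
proof
  assume "\<phi> \<in> dual_unit_ball"
  then have "clinear \<phi>" "bounded_linear \<phi>" "onorm \<phi> \<le> 1"
    by (auto simp: dual_unit_ball_def dual_space_def)
  then show "clinear \<phi> \<and> (\<forall>x. cmod (\<phi> x) \<le> norm x)"
    by (metis onorm mult_right_mono norm_ge_zero mult_1 order_trans)
next
  assume *: "clinear \<phi> \<and> (\<forall>x. cmod (\<phi> x) \<le> norm x)"
  have "bounded_linear \<phi>"
    by (rule bounded_linear_intro[of _ 1])
      (use * in \<open>auto simp: clinear_iff scaleR_scaleC\<close>)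
  moreover have "onorm \<phi> \<le> 1" using * by (intro onorm_bound) auto
  ultimately show "\<phi> \<in> dual_unit_ball" using * by (simp add: dual_unit_ball_def dual_space_def)
qed

lemma dual_space_bounded:
  assumes "\<phi> \<in> dual_space"
  obtains C where "0 \<le> C" "\<And>x. cmod (\<phi> x) \<le> C * norm x"
proof -
  have "bounded_linear \<phi>" using assms by (simp add: dual_space_def)
  then show ?thesis using that[of "onorm \<phi>"] onorm[of \<phi>] onorm_pos_le[of \<phi>] by auto
qed

text \<open>A complex linear functional is determined by its real part, so the real part of
  \<open>f\<close> is extended to \<open>q\<close> and completed by
  \<open>- q (\<i> *\<^sub>C x)\<close>. Rotating \<open>x\<close> until \<open>\<phi> x\<close> is
  nonnegative reduces the bound on the modulus to the bound on \<open>q\<close>.\<close>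

theorem complex_Hahn_Banach:
  fixes f :: "'a::complex_normed_vector \<Rightarrow> complex"
  assumes N: "complex_vector.subspace N"
    and add: "\<And>x y. x \<in> N \<Longrightarrow> y \<in> N \<Longrightarrow> f (x + y) = f x + f y"
    and scale: "\<And>c x. x \<in> N \<Longrightarrow> f (c *\<^sub>C x) = c * f x"
    and bound: "\<And>x. x \<in> N \<Longrightarrow> cmod (f x) \<le> norm x"
  obtains \<phi> where "\<phi> \<in> dual_unit_ball" "\<And>x. x \<in> N \<Longrightarrow> \<phi> x = f x"
proof -
  have "subspace N"
    unfolding subspace_def scaleR_scaleC
    using complex_vector.subspace_0[OF N] complex_vector.subspace_add[OF N] complex_vector.subspace_scale[OF N]
    by auto
  moreover have "Re (f x) \<le> norm x" if "x \<in> N" for x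
    using bound[OF that] complex_Re_le_cmod[of "f x"] by linarith
  ultimately obtain q where q: "linear q" "\<And>x. q x \<le> norm x" "\<And>x. x \<in> N \<Longrightarrow> q x = Re (f x)"
    using real_Hahn_Banach[of N "\<lambda>x. Re (f x)"] add scale by (auto simp: scaleR_scaleC)
  have qR: "q (of_real t *\<^sub>C x) = t * q x" for t x
    using linear_scale[OF q(1), of t x] by (simp add: scaleR_scaleC)
  have qa: "q (x + y) = q x + q y" for x y using linear_add[OF q(1)] .
  define \<phi> where "\<phi> x = Complex (q x) (- q (\<i> *\<^sub>C x))" for x
  have \<phi>a: "\<phi> (x + y) = \<phi> x + \<phi> y" for x y by (simp add: \<phi>_def qa scaleC_add_right complex_eq_iff)
  have \<phi>s: "\<phi> (c *\<^sub>C x) = c * \<phi> x" for c x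
  proof -
    have *: "q (c *\<^sub>C x) = Re c * q x + Im c * q (\<i> *\<^sub>C x)" for c x
    proof -
      have "c *\<^sub>C x = of_real (Re c) *\<^sub>C x + of_real (Im c) *\<^sub>C (\<i> *\<^sub>C x)"
        by (metis complex_eq mult.commute scaleC_add_left scaleC_scaleC)
      then show ?thesis using qa qR by metis
    qed
    show ?thesis using *[of c x] *[of "\<i> * c" x] by (simp add: \<phi>_def complex_eq_iff scaleC_scaleC)
  qed
  have "cmod (\<phi> x) \<le> norm x" for x
  proof (cases "\<phi> x = 0")
    case False
    define c where "c = cnj (\<phi> x) / cmod (\<phi> x)"
    have "\<phi> (c *\<^sub>C x) = of_real (cmod (\<phi> x))"
      using False by (simp add: \<phi>s c_def complex_norm_square[symmetric] power2_eq_square mult.commute)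
    then have "cmod (\<phi> x) = q (c *\<^sub>C x)" by (simp add: \<phi>_def complex_eq_iff)
    also have "\<dots> \<le> norm (c *\<^sub>C x)" by (rule q(2))
    also have "\<dots> = norm x" using False by (simp add: norm_scaleC c_def norm_divide)
    finally show ?thesis .
  qed simp
  then have "\<phi> \<in> dual_unit_ball"
    using \<phi>a \<phi>s by (simp add: mem_dual_unit_ball_iff clinear_iff scaleC_complex_def)
  moreover have "\<phi> x = f x" if "x \<in> N" for x
    using q(3)[OF that] q(3)[OF complex_vector.subspace_scale[OF N that, of \<i>]] scale[OF that, of \<i>]
    by (simp add: \<phi>_def complex_eq_iff)
  ultimately show ?thesis using that by blast
qed

lemma norming_functional:
  fixes x :: "'a::complex_normed_vector"
  obtains \<phi> where "\<phi> \<in> dual_unit_ball" "\<phi> x = of_real (norm x)"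
proof (cases "x = 0")
  case True
  then show ?thesis
    by (intro that[of "\<lambda>_. 0"]) (auto simp: mem_dual_unit_ball_iff clinear_iff scaleC_complex_def)
next
  case False
  define N where "N = range (\<lambda>c. c *\<^sub>C x)"
  define f where "f y = (THE c. y = c *\<^sub>C x) * norm x" for y
  have f: "f (c *\<^sub>C x) = c * norm x" for c
  proof -
    have "(THE d. c *\<^sub>C x = d *\<^sub>C x) = c"
      using False by (intro the_equality) (auto simp: complex_vector.scale_right_imp_eq)
    then show ?thesis by (simp add: f_def)
  qed
  have Nadd: "c *\<^sub>C x + d *\<^sub>C x = (c + d) *\<^sub>C x" for c d by (rule scaleC_add_left[symmetric])
  have N: "complex_vector.subspace N"
  proof (rule complex_vector.subspaceI)
    show "0 \<in> N" unfolding N_def by (rule range_eqI[of _ _ 0]) simp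
    show "u + v \<in> N" if "u \<in> N" "v \<in> N" for u v using that unfolding N_def by (auto simp: Nadd)
    show "c *\<^sub>C u \<in> N" if "u \<in> N" for c u using that unfolding N_def by (auto simp: scaleC_scaleC)
  qed
  have "f (u + v) = f u + f v" if uv: "u \<in> N" "v \<in> N" for u v
  proof -
    obtain c d where "u = c *\<^sub>C x" "v = d *\<^sub>C x" using uv by (auto simp: N_def)
    then show ?thesis by (simp add: Nadd f distrib_right)
  qed
  moreover have "f (c *\<^sub>C u) = c * f u" if "u \<in> N" for c u
    using that by (auto simp: N_def scaleC_scaleC f)
  moreover have "cmod (f u) \<le> norm u" if "u \<in> N" for u
    using that by (auto simp: N_def f norm_mult norm_scaleC)
  ultimately obtain \<phi> where "\<phi> \<in> dual_unit_ball" "\<And>u. u \<in> N \<Longrightarrow> \<phi> u = f u"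
    using complex_Hahn_Banach[OF N, of f] by metis
  moreover have "x \<in> N" "f x = norm x" using f[of 1] by (auto simp: N_def scaleC_one intro: range_eqI[of _ _ 1])
  ultimately show ?thesis using that by metis
qed

subsection \<open>Ultrafilters and the weak topology\<close>

definition ultra :: "'a filter \<Rightarrow> bool"
  where "ultra U \<longleftrightarrow> U \<noteq> bot \<and> (\<forall>P. eventually P U \<or> eventually (\<lambda>x. \<not> P x) U)"

lemma ultra_not_bot: "ultra U \<Longrightarrow> U \<noteq> bot"
  and ultra_cases: "ultra U \<Longrightarrow> eventually P U \<or> eventually (\<lambda>x. \<not> P x) U"
  by (auto simp: ultra_def)

text \<open>Ultrafilters are the minimal proper filters. If \<open>P\<close> is not eventually
  false, adjoining it leaves the filter proper, so by minimality it was already there.\<close>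

lemma ultra_ex:
  fixes F :: "'a filter"
  assumes "F \<noteq> bot"
  obtains U where "ultra U" "U \<le> F"
proof -
  define A where "A = {G. G \<noteq> bot \<and> G \<le> F}"
  have "\<exists>m\<in>A. \<forall>a\<in>A. a \<le> m \<longrightarrow> a = m"
  proof (rule predicate_Zorn[where P = "\<lambda>a b. b \<le> a"])
    show "partial_order_on A (relation_of (\<lambda>a b. b \<le> a) A)"
      by (rule partial_order_on_relation_ofI) auto
    fix C assume "C \<in> Chains (relation_of (\<lambda>a b. b \<le> a) A)"
    then have CA: "C \<subseteq> A" and ch: "\<And>q r. q \<in> C \<Longrightarrow> r \<in> C \<Longrightarrow> q \<le> r \<or> r \<le> q"
      by (auto simp: Chains_def relation_of_def)
    show "\<exists>u\<in>A. \<forall>a\<in>C. u \<le> a"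
    proof (cases "C = {}")
      case True then show ?thesis using assms by (auto simp: A_def)
    next
      case False
      \<comment> \<open>A chain is directed, so whatever holds eventually for \<open>Inf C\<close>
        holds eventually for some member; hence the infimum is proper.\<close>
      have "eventually P (Inf C) \<longleftrightarrow> (\<exists>b\<in>C. eventually P b)" for P
        using False ch by (intro eventually_Inf_base) (metis inf.absorb1 inf.absorb2 order_refl)+
      then have "Inf C \<noteq> bot" using CA unfolding A_def trivial_limit_def by blast
      moreover have "Inf C \<le> F" using False CA unfolding A_def by (metis Inf_lower2 ex_in_conv mem_Collect_eq subsetD)
      ultimately show ?thesis by (intro bexI[of _ "Inf C"]) (auto simp: A_def Inf_lower)
    qed
  qed
  then obtain m where m: "m \<noteq> bot" "m \<le> F" and max: "\<And>a. a \<noteq> bot \<Longrightarrow> a \<le> m \<Longrightarrow> a = m"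
    by (auto simp: A_def intro: order_trans)
  have "ultra m"
    unfolding ultra_def
  proof (intro conjI allI m(1))
    fix P
    show "eventually P m \<or> eventually (\<lambda>x. \<not> P x) m"
    proof (cases "eventually (\<lambda>x. \<not> P x) m")
      case False
      then have "inf m (principal {x. P x}) \<noteq> bot"
        by (auto simp: trivial_limit_def eventually_inf_principal)
      then have "inf m (principal {x. P x}) = m" by (intro max) auto
      moreover have "eventually P (inf m (principal {x. P x}))" by (simp add: eventually_inf_principal)
      ultimately show ?thesis by simp
    qed simp
  qed
  then show ?thesis using m(2) that by blast
qed

lemma ultra_compact_tendsto:
  assumes U: "ultra U" and S: "compact S" and ev: "eventually (\<lambda>i. f i \<in> S) U"
  obtains l where "l \<in> S" "(f \<longlongrightarrow> l) U"
proof -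
  have "filtermap f U \<noteq> bot" using ultra_not_bot[OF U] by (simp add: filtermap_bot_iff)
  moreover have "eventually (\<lambda>x. x \<in> S) (filtermap f U)" using ev by (simp add: eventually_filtermap)
  ultimately obtain l where l: "l \<in> S" "inf (nhds l) (filtermap f U) \<noteq> bot"
    using S unfolding compact_filter by blast
  have "eventually (\<lambda>i. f i \<in> V) U" if "open V" "l \<in> V" for V
  proof (rule ccontr)
    assume "\<not> ?thesis"
    then have "eventually (\<lambda>i. f i \<notin> V) U" using ultra_cases[OF U] by blast
    moreover have "eventually (\<lambda>x. x \<in> V) (nhds l)" using that by (simp add: eventually_nhds_in_open)
    ultimately have "eventually (\<lambda>x. False) (inf (nhds l) (filtermap f U))"
      unfolding eventually_inf eventually_filtermap
      by (intro exI[of _ "\<lambda>x. x \<in> V"] exI[of _ "\<lambda>x. x \<notin> V"]) auto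
    then show False using l(2) by (simp add: trivial_limit_def)
  qed
  then have "(f \<longlongrightarrow> l) U" by (rule topological_tendstoI)
  then show ?thesis using l(1) that by blast
qed

lemma ultra_Lim:
  fixes f :: "'i \<Rightarrow> complex"
  assumes "ultra U" "eventually (\<lambda>i. cmod (f i) \<le> M) U"
  shows "(f \<longlongrightarrow> Lim U f) U"
proof -
  have "eventually (\<lambda>i. f i \<in> cball 0 M) U" using assms(2) by simp
  then obtain l where "(f \<longlongrightarrow> l) U" using ultra_compact_tendsto[OF assms(1) compact_cball] by blast
  then show ?thesis using tendsto_Lim[OF ultra_not_bot[OF assms(1)]] by metis
qed

section \<open>Weak compactness tested on ultrafilters\<close>

lemma topspace_weak_topology [simp]: "topspace (weak_topology :: 'a::complex_normed_vector topology) = UNIV"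
proof -
  have "(\<lambda>_. 0) \<in> (dual_space :: ('a \<Rightarrow> complex) set)"
    by (auto simp: dual_space_def clinear_iff)
  then have "(\<lambda>_::'a. 0) -` UNIV \<in> {\<phi> -` U |\<phi> U. \<phi> \<in> dual_space \<and> open U}" by blast
  then show ?thesis unfolding weak_topology_def topology_generated_by_topspace by auto
qed

lemma openin_weak_topology_vimage:
  "\<phi> \<in> dual_space \<Longrightarrow> open V \<Longrightarrow> openin weak_topology (\<phi> -` V)"
  unfolding weak_topology_def openin_topology_generated_by_iff
  by (rule generate_topology_on.Basis) blast

lemma closedin_weak_topology_vimage:
  assumes "\<phi> \<in> dual_space" "closed V"
  shows "closedin weak_topology (\<phi> -` V)"
  using openin_weak_topology_vimage[OF assms(1), of "- V"] assms(2)
  by (simp add: closedin_def open_Compl vimage_Compl Compl_eq_Diff_UNIV[symmetric])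

text \<open>Convergence against every functional is weak convergence; induction over the generation
  of \<open>W\<close> reduces this to preimages of open sets.\<close>

lemma eventually_weak_nhd:
  assumes "openin weak_topology W" "y \<in> W"
    and lim: "\<And>\<phi>. \<phi> \<in> dual_space \<Longrightarrow> ((\<lambda>i. \<phi> (v i)) \<longlongrightarrow> \<phi> y) F"
  shows "eventually (\<lambda>i. v i \<in> W) F"
  using assms(1)[unfolded weak_topology_def openin_topology_generated_by_iff] assms(2)
proof induction
  case (Int a b)
  then show ?case by (auto intro: eventually_conj)
next
  case (UN K)
  then obtain k where "k \<in> K" "y \<in> k" by blast
  then have "eventually (\<lambda>i. v i \<in> k) F" using UN by blast
  then show ?case using \<open>k \<in> K\<close> by (auto elim: eventually_mono)
next
  case (Basis s)
  then obtain \<phi> V where "s = \<phi> -` V" "\<phi> \<in> dual_space" "open V" by blast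
  then show ?case using lim[of \<phi>] Basis.prems by (auto dest: topological_tendstoD)
qed simp

text \<open>Otherwise every point of \<open>K\<close> has a neighbourhood that \<open>v\<close>
  eventually avoids along \<open>U\<close>, and finitely many of them cover \<open>K\<close>. The
  family \<open>v\<close> is general because it is later indexed by sets as well as by
  numbers.\<close>

lemma compactin_weak_ultra_tendsto:
  assumes K: "compactin weak_topology K" and U: "ultra U" and ev: "eventually (\<lambda>i. v i \<in> K) U"
  shows "\<exists>y\<in>K. \<forall>\<phi>\<in>dual_space. ((\<lambda>i. \<phi> (v i)) \<longlongrightarrow> \<phi> y) U"
proof (rule ccontr)
  assume "\<not> ?thesis"
  then have no: "\<exists>\<phi>\<in>dual_space. \<not> ((\<lambda>i. \<phi> (v i)) \<longlongrightarrow> \<phi> y) U" if "y \<in> K" for y using that by blast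
  have "\<exists>W. openin weak_topology W \<and> y \<in> W \<and> eventually (\<lambda>i. v i \<notin> W) U" if y: "y \<in> K" for y
  proof -
    obtain \<phi> where \<phi>: "\<phi> \<in> dual_space" "\<not> ((\<lambda>i. \<phi> (v i)) \<longlongrightarrow> \<phi> y) U" using no[OF y] by blast
    then obtain V where V: "open V" "\<phi> y \<in> V" "\<not> eventually (\<lambda>i. \<phi> (v i) \<in> V) U"
      unfolding tendsto_def by blast
    then have "eventually (\<lambda>i. v i \<notin> \<phi> -` V) U" using ultra_cases[OF U] by auto
    then show ?thesis using V openin_weak_topology_vimage[OF \<phi>(1) V(1)] by auto
  qed
  then obtain W where W: "\<And>y. y \<in> K \<Longrightarrow> openin weak_topology (W y)" "\<And>y. y \<in> K \<Longrightarrow> y \<in> W y"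
    "\<And>y. y \<in> K \<Longrightarrow> eventually (\<lambda>i. v i \<notin> W y) U"
    by metis
  have "\<exists>\<F>. finite \<F> \<and> \<F> \<subseteq> W ` K \<and> K \<subseteq> \<Union> \<F>"
    using K W(1,2) unfolding compactin_def by (metis (no_types, lifting) UN_iff imageE subsetI)
  then obtain Y where Y: "finite Y" "Y \<subseteq> K" "K \<subseteq> (\<Union>y\<in>Y. W y)"
    by (metis finite_subset_image)
  have "eventually (\<lambda>i. \<forall>y\<in>Y. v i \<notin> W y) U"
    using Y(1,2) W(3) by (intro eventually_ball_finite) auto
  with ev have "eventually (\<lambda>i. False) U" by eventually_elim (use Y(3) in blast)
  then show False using ultra_not_bot[OF U] by (simp add: trivial_limit_def)
qed

text \<open>An ultrafilter finer than a family with the finite intersection property converges by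
  hypothesis, and closedness puts its limit into \<open>K\<close> and every member of the
  family.\<close>

lemma compactin_weak_if_ultra_tendsto:
  assumes K: "closedin weak_topology K"
    and lim: "\<And>U. ultra U \<Longrightarrow> eventually (\<lambda>z. z \<in> K) U \<Longrightarrow>
      \<exists>y. \<forall>\<phi>\<in>dual_space. (\<phi> \<longlongrightarrow> \<phi> y) U"
  shows "compactin weak_topology K"
  unfolding compactin_fip
proof (intro conjI allI impI; (elim conjE)?)
  fix \<U> assume closed: "\<forall>C\<in>\<U>. closedin weak_topology C"
    and fip: "\<forall>\<F>. finite \<F> \<and> \<F> \<subseteq> \<U> \<longrightarrow> K \<inter> \<Inter> \<F> \<noteq> {}"
  define F where "F = (INF C\<in>insert K \<U>. principal C)"
  have "F \<noteq> bot"
    unfolding F_def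
  proof (rule INF_filter_not_bot)
    fix X assume X: "X \<subseteq> insert K \<U>" "finite X"
    then have "K \<inter> \<Inter> (X - {K}) \<noteq> {}" using fip by blast
    then have "\<Inter> X \<noteq> {}" by auto
    then show "(INF C\<in>X. principal C) \<noteq> bot"
      using INF_principal_finite[OF X(2), of "\<lambda>x. x"] by (simp add: principal_eq_bot_iff)
  qed
  then obtain U where U: "ultra U" "U \<le> F" by (rule ultra_ex)
  have ev: "eventually (\<lambda>z. z \<in> C) U" if "C \<in> insert K \<U>" for C
  proof -
    have "U \<le> principal C" using U(2) that unfolding F_def by (meson INF_lower order_trans)
    then show ?thesis by (simp add: le_principal)
  qed
  obtain y where y: "\<And>\<phi>. \<phi> \<in> dual_space \<Longrightarrow> (\<phi> \<longlongrightarrow> \<phi> y) U" using lim[OF U(1) ev] by blast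
  have "y \<in> C" if C: "C \<in> insert K \<U>" for C
  proof (rule ccontr)
    assume "y \<notin> C"
    moreover have "openin weak_topology (- C)"
      using C closed K openin_diff[OF openin_topspace, of weak_topology C] by (auto simp: Compl_eq_Diff_UNIV)
    ultimately have "eventually (\<lambda>z. z \<in> - C) U" using y by (intro eventually_weak_nhd) auto
    with ev[OF C] have "eventually (\<lambda>z. False) U" by eventually_elim simp
    then show False using ultra_not_bot[OF U(1)] by (simp add: trivial_limit_def)
  qed
  then show "K \<inter> \<Inter> \<U> \<noteq> {}" by blast
qed simp

subsection \<open>Functionals on bounded functions and their variation\<close>

definition bounded_fun :: "('i \<Rightarrow> complex) \<Rightarrow> bool"
  where "bounded_fun f \<longleftrightarrow> (\<exists>M. \<forall>i. cmod (f i) \<le> M)"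

lemma bounded_funI: "(\<And>i. cmod (f i) \<le> M) \<Longrightarrow> bounded_fun f"
  by (auto simp: bounded_fun_def)

lemma bounded_fun_add:
  assumes "bounded_fun f" "bounded_fun g"
  shows "bounded_fun (\<lambda>i. f i + g i)"
proof -
  obtain M M' where "\<And>i. cmod (f i) \<le> M" "\<And>i. cmod (g i) \<le> M'"
    using assms by (auto simp: bounded_fun_def)
  then show ?thesis by (intro bounded_funI[of _ "M + M'"]) (meson add_mono norm_triangle_le)
qed

lemma bounded_fun_mult:
  assumes "bounded_fun f" "bounded_fun g"
  shows "bounded_fun (\<lambda>i. f i * g i)"
proof -
  obtain M M' where "\<And>i. cmod (f i) \<le> M" "\<And>i. cmod (g i) \<le> M'"
    using assms by (auto simp: bounded_fun_def)
  then show ?thesis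
    by (intro bounded_funI[of _ "M * M'"]) (auto simp: norm_mult intro!: mult_mono order_trans[OF norm_ge_zero])
qed

lemma bounded_fun_const [simp]: "bounded_fun (\<lambda>_. a)"
  by (rule bounded_funI[of _ "cmod a"]) simp

text \<open>An element of the dual of the bounded functions, of norm at most \<open>C\<close>.
  Functions are total, so linearity is asked for bounded ones and the sup norm enters through upper
  bounds \<open>M\<close>.\<close>

definition bfunctional :: "real \<Rightarrow> (('i \<Rightarrow> complex) \<Rightarrow> complex) \<Rightarrow> bool"
  where "bfunctional C \<phi> \<longleftrightarrow> 0 \<le> C \<and>
    (\<forall>f g. bounded_fun f \<longrightarrow> bounded_fun g \<longrightarrow> \<phi> (\<lambda>i. f i + g i) = \<phi> f + \<phi> g) \<and>
    (\<forall>a f. bounded_fun f \<longrightarrow> \<phi> (\<lambda>i. a * f i) = a * \<phi> f) \<and>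
    (\<forall>f M. (\<forall>i. cmod (f i) \<le> M) \<longrightarrow> cmod (\<phi> f) \<le> C * M)"

text \<open>The value at \<open>w\<close> of the modulus of \<open>\<phi>\<close>, that is, of the
  total variation of the finitely additive measure it represents. Nonnegative bounded
  \<open>w\<close> are meant.\<close>

definition variation :: "(('i \<Rightarrow> complex) \<Rightarrow> complex) \<Rightarrow> ('i \<Rightarrow> real) \<Rightarrow> real"
  where "variation \<phi> w = (SUP g\<in>{g. \<forall>i. cmod (g i) \<le> w i}. cmod (\<phi> g))"

context
  fixes C :: real and \<phi> :: "('i \<Rightarrow> complex) \<Rightarrow> complex"
  assumes \<phi>: "bfunctional C \<phi>"
begin

lemma bfunctional_add: "bounded_fun f \<Longrightarrow> bounded_fun g \<Longrightarrow> \<phi> (\<lambda>i. f i + g i) = \<phi> f + \<phi> g"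
  and bfunctional_scale: "bounded_fun f \<Longrightarrow> \<phi> (\<lambda>i. a * f i) = a * \<phi> f"
  and bfunctional_bound: "(\<And>i. cmod (f i) \<le> M) \<Longrightarrow> cmod (\<phi> f) \<le> C * M"
  and bfunctional_nonneg: "0 \<le> C"
  using \<phi> by (auto simp: bfunctional_def)

lemma bfunctional_diff: "bounded_fun f \<Longrightarrow> bounded_fun g \<Longrightarrow> \<phi> (\<lambda>i. f i - g i) = \<phi> f - \<phi> g"
  using bfunctional_add[of f "\<lambda>i. -1 * g i"] bfunctional_scale[of g "-1"]
    bounded_fun_mult[OF bounded_fun_const[of "-1"], of g]
  by simp

lemma variation_upper:
  assumes "\<And>i. cmod (g i) \<le> w i" "\<And>i. w i \<le> M"
  shows "cmod (\<phi> g) \<le> variation \<phi> w"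
  unfolding variation_def
proof (rule cSUP_upper)
  show "bdd_above ((\<lambda>g. cmod (\<phi> g)) ` {g. \<forall>i. cmod (g i) \<le> w i})"
    by (rule bdd_aboveI2[of _ _ "C * M"]) (use assms(2) in \<open>auto intro!: bfunctional_bound intro: order_trans\<close>)
qed (use assms in auto)

lemma variation_least:
  assumes "\<And>i. 0 \<le> w i" "\<And>g. (\<And>i. cmod (g i) \<le> w i) \<Longrightarrow> cmod (\<phi> g) \<le> B"
  shows "variation \<phi> w \<le> B"
  unfolding variation_def
  by (rule cSUP_least) (use assms in \<open>auto intro!: exI[of _ "\<lambda>_. 0"]\<close>)

lemma variation_mono:
  assumes "\<And>i. 0 \<le> w i" "\<And>i. w i \<le> w' i" "\<And>i. w' i \<le> M"
  shows "variation \<phi> w \<le> variation \<phi> w'"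
  by (rule variation_least) (use assms in \<open>auto intro!: variation_upper intro: order_trans\<close>)

lemma variation_bound:
  assumes "\<And>i. 0 \<le> w i" "\<And>i. w i \<le> M"
  shows "variation \<phi> w \<le> C * M"
  by (rule variation_least) (use assms in \<open>auto intro!: bfunctional_bound intro: order_trans\<close>)

lemma variation_nonneg:
  assumes "\<And>i. 0 \<le> w i" "\<And>i. w i \<le> M"
  shows "0 \<le> variation \<phi> w"
  using variation_upper[of "\<lambda>_. 0" w M] assms by (smt (verit) norm_ge_zero norm_zero)

lemma variation_scale_le:
  assumes "\<And>i. 0 \<le> w i" "\<And>i. w i \<le> M" "0 < t"
  shows "variation \<phi> (\<lambda>i. t * w i) \<le> t * variation \<phi> w"
proof (rule variation_least)
  fix g assume g: "\<And>i. cmod (g i) \<le> t * w i"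
  define h where "h i = inverse (complex_of_real t) * g i" for i
  have h: "cmod (h i) \<le> w i" for i
  proof -
    have "cmod (h i) = inverse t * cmod (g i)" using assms(3) by (simp add: h_def norm_mult norm_inverse)
    then have "t * cmod (h i) = cmod (g i)" using assms(3) by simp
    then have "t * cmod (h i) \<le> t * w i" using g[of i] by linarith
    then show ?thesis using assms(3) by simp
  qed
  have "bounded_fun h" using h assms(2) by (intro bounded_funI[of _ M]) (auto intro: order_trans)
  moreover have "g = (\<lambda>i. complex_of_real t * h i)" using assms(3) by (auto simp: h_def)
  ultimately have "cmod (\<phi> g) = t * cmod (\<phi> h)"
    using bfunctional_scale[of h "of_real t"] assms(3) by (simp add: norm_mult)
  also have "\<dots> \<le> t * variation \<phi> w"
    using variation_upper[of h w M] h assms by simp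
  finally show "cmod (\<phi> g) \<le> t * variation \<phi> w" .
qed (use assms in simp)

lemma variation_scale:
  assumes "\<And>i. 0 \<le> w i" "\<And>i. w i \<le> M" "0 < t"
  shows "variation \<phi> (\<lambda>i. t * w i) = t * variation \<phi> w"
proof (rule antisym)
  have "variation \<phi> (\<lambda>i. inverse t * (t * w i)) \<le> inverse t * variation \<phi> (\<lambda>i. t * w i)"
    by (rule variation_scale_le[of _ "t * M"]) (use assms in auto)
  moreover have "(\<lambda>i. inverse t * (t * w i)) = w" using assms(3) by auto
  ultimately show "t * variation \<phi> w \<le> variation \<phi> (\<lambda>i. t * w i)" using assms(3) by (simp add: field_simps)
qed (rule variation_scale_le[OF assms])

text \<open>A near-maximiser can be rotated so that \<open>\<phi>\<close> is real and nonnegative on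
  it; two such functions can be added without cancellation.\<close>

lemma variation_approx:
  assumes w: "\<And>i. 0 \<le> w i" "\<And>i. w i \<le> M" and e: "0 < e"
  obtains g where "\<And>i. cmod (g i) \<le> w i" "\<phi> g = of_real (cmod (\<phi> g))" "variation \<phi> w - e < cmod (\<phi> g)"
proof -
  have "\<exists>g. (\<forall>i. cmod (g i) \<le> w i) \<and> variation \<phi> w - e < cmod (\<phi> g)"
  proof (rule ccontr)
    assume "\<not> ?thesis"
    then have "variation \<phi> w \<le> variation \<phi> w - e"
      by (intro variation_least) (use w in \<open>auto simp: not_less\<close>)
    then show False using e by simp
  qed
  then obtain g where g: "\<And>i. cmod (g i) \<le> w i" "variation \<phi> w - e < cmod (\<phi> g)" by blast
  show ?thesis
  proof (cases "\<phi> g = 0")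
    case True then show ?thesis by (intro that[of g]) (use g in auto)
  next
    case False
    define c where "c = cnj (\<phi> g) / cmod (\<phi> g)"
    have nc: "cmod c = 1" using False by (simp add: c_def norm_divide)
    have "bounded_fun g" using g w by (intro bounded_funI[of _ M]) (auto intro: order_trans)
    then have "\<phi> (\<lambda>i. c * g i) = c * \<phi> g" by (rule bfunctional_scale)
    also have "\<dots> = of_real (cmod (\<phi> g))"
      using False by (simp add: c_def complex_norm_square[symmetric] power2_eq_square mult.commute)
    finally have "\<phi> (\<lambda>i. c * g i) = of_real (cmod (\<phi> g))" .
    then show ?thesis using g nc by (intro that[of "\<lambda>i. c * g i"]) (auto simp: norm_mult)
  qed
qed

text \<open>Additivity lets \<open>variation\<close> act like an integral. One inequality is a Riesz
  decomposition of \<open>g\<close>, the other adds rotated near-maximisers.\<close>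

lemma variation_add:
  assumes u: "\<And>i. 0 \<le> u i" "\<And>i. u i \<le> M" and w: "\<And>i. 0 \<le> w i" "\<And>i. w i \<le> M'"
  shows "variation \<phi> (\<lambda>i. u i + w i) = variation \<phi> u + variation \<phi> w"
proof (rule antisym)
  have bd: "u i + w i \<le> M + M'" for i using u w by (simp add: add_mono)
  show "variation \<phi> (\<lambda>i. u i + w i) \<le> variation \<phi> u + variation \<phi> w"
  proof (rule variation_least)
    fix g assume g: "\<And>i. cmod (g i) \<le> u i + w i"
    \<comment> \<open>\<open>g\<close> is divided in the ratio of \<open>u\<close> to
      \<open>w\<close>. Where both vanish the quotient is \<open>0\<close> by convention, and
      \<open>g\<close> vanishes there too.\<close>
    define r where "r i = u i / (u i + w i)" for i
    have le: "r i * cmod (g i) \<le> u i \<and> (1 - r i) * cmod (g i) \<le> w i \<and> 0 \<le> r i \<and> r i \<le> 1" for i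
    proof (cases "u i + w i = 0")
      case True
      then have "u i = 0" "w i = 0" using u(1)[of i] w(1)[of i] by auto
      then show ?thesis using g[of i] by (simp add: r_def)
    next
      case False
      then have p: "0 < u i + w i" using u(1)[of i] w(1)[of i] by auto
      have r: "0 \<le> r i" "r i \<le> 1" using p u(1)[of i] w(1)[of i] by (auto simp: r_def)
      have "r i * cmod (g i) \<le> r i * (u i + w i)" "(1 - r i) * cmod (g i) \<le> (1 - r i) * (u i + w i)"
        using r g[of i] by (auto intro: mult_left_mono)
      moreover have "r i * (u i + w i) = u i" using p by (simp add: r_def)
      moreover have "(1 - r i) * (u i + w i) = w i" using p by (simp add: r_def field_simps)
      ultimately show ?thesis using r by simp
    qed
    have 1: "cmod (of_real (r i) * g i) \<le> u i" and 2: "cmod (of_real (1 - r i) * g i) \<le> w i" for i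
      using le[of i] by (simp_all add: norm_mult del: of_real_diff)
    have "\<phi> g = \<phi> (\<lambda>i. of_real (r i) * g i + of_real (1 - r i) * g i)" by (simp add: algebra_simps)
    also have "\<dots> = \<phi> (\<lambda>i. of_real (r i) * g i) + \<phi> (\<lambda>i. of_real (1 - r i) * g i)"
      using 1 2 u w by (intro bfunctional_add bounded_funI[of _ M] bounded_funI[of _ M']) (meson order_trans)+
    finally show "cmod (\<phi> g) \<le> variation \<phi> u + variation \<phi> w"
      using variation_upper[of _ u M, OF 1 u(2)] variation_upper[of _ w M', OF 2 w(2)]
      by (smt (verit) norm_triangle_ineq)
  qed (use u w in simp)
  show "variation \<phi> u + variation \<phi> w \<le> variation \<phi> (\<lambda>i. u i + w i)"
  proof (rule field_le_epsilon)
    fix e :: real assume "0 < e"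
    then have e2: "0 < e / 2" by simp
    obtain g where g: "\<And>i. cmod (g i) \<le> u i" "\<phi> g = of_real (cmod (\<phi> g))" "variation \<phi> u - e / 2 < cmod (\<phi> g)"
      using variation_approx[of u M, OF u e2] by blast
    obtain h where h: "\<And>i. cmod (h i) \<le> w i" "\<phi> h = of_real (cmod (\<phi> h))" "variation \<phi> w - e / 2 < cmod (\<phi> h)"
      using variation_approx[of w M', OF w e2] by blast
    have "\<phi> (\<lambda>i. g i + h i) = \<phi> g + \<phi> h"
      using g(1) h(1) u w by (intro bfunctional_add bounded_funI[of _ M] bounded_funI[of _ M']) (meson order_trans)+
    also have "\<dots> = of_real (cmod (\<phi> g) + cmod (\<phi> h))" using g(2) h(2) by (metis of_real_add)
    finally have sum_eq: "\<phi> (\<lambda>i. g i + h i) = of_real (cmod (\<phi> g) + cmod (\<phi> h))" .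
    have "cmod (\<phi> g) + cmod (\<phi> h) = cmod (\<phi> (\<lambda>i. g i + h i))" unfolding sum_eq norm_of_real by simp
    also have "\<dots> \<le> variation \<phi> (\<lambda>i. u i + w i)"
      using g(1) h(1) bd by (intro variation_upper[of _ _ "M + M'"]) (auto intro: norm_triangle_mono)
    finally show "variation \<phi> u + variation \<phi> w \<le> variation \<phi> (\<lambda>i. u i + w i) + e" using g(3) h(3) by linarith
  qed
qed

lemma variation_sum:
  assumes "finite A" "\<And>k i. k \<in> A \<Longrightarrow> 0 \<le> w k i" "\<And>k i. k \<in> A \<Longrightarrow> w k i \<le> M"
  shows "variation \<phi> (\<lambda>i. \<Sum>k\<in>A. w k i) = (\<Sum>k\<in>A. variation \<phi> (w k))"
  using assms
proof (induction A)
  case empty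
  have "variation \<phi> (\<lambda>_. 0) \<le> C * 0" by (rule variation_bound) auto
  then show ?case using variation_nonneg[of "\<lambda>_. 0" 0] by simp
next
  case (insert k A)
  have "(\<Sum>k\<in>A. w k i) \<le> of_nat (card A) * M" for i
    by (rule sum_bounded_above) (use insert in auto)
  then have "variation \<phi> (\<lambda>i. w k i + (\<Sum>k\<in>A. w k i)) = variation \<phi> (w k) + variation \<phi> (\<lambda>i. \<Sum>k\<in>A. w k i)"
    using insert.prems by (intro variation_add[of _ M _ "of_nat (card A) * M"]) (auto intro: sum_nonneg)
  then show ?case using insert by simp
qed

end

subsection \<open>Uniform control of a family of functionals\<close>

text \<open>One positive functional dominates the whole family up to \<open>e\<close>. The set
  \<open>P\<close> is taken from \<open>\<F>\<close> itself, so each failure of control by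
  functionals already chosen yields a further one of the same family.\<close>

definition controlled :: "(('i \<Rightarrow> complex) \<Rightarrow> complex) set \<Rightarrow> real \<Rightarrow> bool"
  where "controlled \<F> e \<longleftrightarrow> (\<exists>P N. finite P \<and> P \<subseteq> \<F> \<and> 0 \<le> N \<and>
    (\<forall>f. (\<forall>i. cmod (f i) \<le> 1) \<longrightarrow>
      (\<forall>\<phi>\<in>\<F>. cmod (\<phi> f) \<le> N * (\<Sum>\<theta>\<in>P. variation \<theta> (\<lambda>i. cmod (f i))) + e)))"

text \<open>The failure is used recursively, with \<open>P\<close> the functionals found so far. The
  new value is at most \<open>C\<close>, so a large factor \<open>N\<close> forces the old
  variations to be small on the new function.\<close>

lemma not_controlled_sequence:
  fixes \<F> :: "(('i \<Rightarrow> complex) \<Rightarrow> complex) set"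
  assumes \<F>: "\<And>\<phi>. \<phi> \<in> \<F> \<Longrightarrow> bfunctional C \<phi>" and nc: "\<not> controlled \<F> e"
    and \<eta>: "\<And>n::nat. 0 < \<eta> n" and e: "0 < e"
  shows "\<exists>x \<phi>. (\<forall>n i. cmod (x n i) \<le> 1) \<and> (\<forall>n. \<phi> n \<in> \<F>) \<and> (\<forall>n. e < cmod (\<phi> n (x n))) \<and>
    (\<forall>j n. j < n \<longrightarrow> variation (\<phi> j) (\<lambda>i. cmod (x n i)) \<le> \<eta> n)"
proof -
  define Q where "Q s n r \<longleftrightarrow> (\<forall>i. cmod (fst r i) \<le> 1) \<and> snd r \<in> \<F> \<and> e < cmod (snd r (fst r)) \<and>
    (\<forall>j<n. variation (snd (s j)) (\<lambda>i. cmod (fst r i)) \<le> \<eta> n)"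
    for s :: "nat \<Rightarrow> ('i \<Rightarrow> complex) \<times> (('i \<Rightarrow> complex) \<Rightarrow> complex)" and n r
  have "\<exists>s. \<forall>n. Q s n (s n)"
  proof (rule dependent_wellorder_choice)
    fix n s assume IH: "\<And>j. j < n \<Longrightarrow> Q s j (s j)"
    define P where "P = (\<lambda>j. snd (s j)) ` {..<n}"
    have P: "finite P" "P \<subseteq> \<F>" using IH by (auto simp: P_def Q_def)
    \<comment> \<open>\<open>N\<close> times a variation stays below \<open>C\<close>, hence the
      variation below \<open>\<eta> n\<close>. The absolute value makes \<open>N\<close> nonnegative
      before a member of \<open>\<F>\<close> is at hand to give \<open>0 \<le> C\<close>.\<close>
    define N where "N = \<bar>C\<bar> / \<eta> n"
    have "0 \<le> N" using \<eta>[of n] by (simp add: N_def)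
    then obtain f \<phi> where f: "\<And>i. cmod (f i) \<le> 1" "\<phi> \<in> \<F>"
      "N * (\<Sum>\<theta>\<in>P. variation \<theta> (\<lambda>i. cmod (f i))) + e < cmod (\<phi> f)"
      using nc P unfolding controlled_def by (meson not_less)
    have vn: "0 \<le> variation \<theta> (\<lambda>i. cmod (f i))" if "\<theta> \<in> P" for \<theta>
      using variation_nonneg[OF \<F>, of \<theta> "\<lambda>i. cmod (f i)" 1] that P f(1) by auto
    have C: "0 \<le> C" "cmod (\<phi> f) \<le> C * 1"
      using bfunctional_bound[OF \<F>[OF f(2)], of f 1] bfunctional_nonneg[OF \<F>[OF f(2)]] f(1) by auto
    have "variation \<theta> (\<lambda>i. cmod (f i)) \<le> \<eta> n" if \<theta>: "\<theta> \<in> P" for \<theta>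
    proof -
      have "N * variation \<theta> (\<lambda>i. cmod (f i)) \<le> N * (\<Sum>\<theta>\<in>P. variation \<theta> (\<lambda>i. cmod (f i)))"
        using P(1) vn \<theta> \<open>0 \<le> N\<close> by (intro mult_left_mono member_le_sum) auto
      then have lt: "N * variation \<theta> (\<lambda>i. cmod (f i)) < C" using f(3) C e by linarith
      then have "0 < C" using \<open>0 \<le> N\<close> vn[OF \<theta>] by (smt (verit) mult_nonneg_nonneg)
      then show ?thesis using lt \<eta>[of n] by (simp add: N_def field_simps)
    qed
    moreover have "e < cmod (\<phi> f)"
      using f(3) \<open>0 \<le> N\<close> vn by (smt (verit) mult_nonneg_nonneg sum_nonneg)
    ultimately show "\<exists>r. Q s n r" using f by (intro exI[of _ "(f, \<phi>)"]) (auto simp: Q_def P_def)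
  qed (auto simp: Q_def)
  then obtain s where "\<And>n. Q s n (s n)" by blast
  then show ?thesis by (intro exI[of _ "\<lambda>n. fst (s n)"] exI[of _ "\<lambda>n. snd (s n)"]) (auto simp: Q_def)
qed

subsection \<open>Local structure of \<open>\<LL>\<^sup>\<infinity>\<close>-spaces\<close>

lemma lr_norm_infinity_le:
  assumes "0 \<le> M" "\<And>k. k < n \<Longrightarrow> cmod (v k) \<le> M"
  shows "lr_norm \<infinity> n v \<le> M"
  using assms by (auto simp: lr_norm_def)

lemma le_lr_norm_infinity: "k < n \<Longrightarrow> cmod (v k) \<le> lr_norm \<infinity> n v"
  by (auto simp: lr_norm_def intro!: Max_ge)

lemma op_norm_on_upper:
  assumes "op_norm_on S \<nu> \<nu>' f < top" "x \<in> S" "\<nu> x \<le> 1"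
  shows "\<nu>' (f x) \<le> enn2real (op_norm_on S \<nu> \<nu>' f)"
proof -
  have "ennreal (\<nu>' (f x)) \<le> op_norm_on S \<nu> \<nu>' f"
    unfolding op_norm_on_def using assms(2,3) by (intro SUP_upper) auto
  also have "\<dots> = ennreal (enn2real (op_norm_on S \<nu> \<nu>' f))" using assms(1) by simp
  finally show ?thesis by simp
qed

text \<open>In \<open>ennreal\<close> zero times infinity is zero, so a bound on the product of two
  operator norms makes both finite only once both are known to be positive.\<close>

lemma op_norm_on_pos:
  assumes "x \<in> S" "\<nu> x \<le> 1" "0 < \<nu>' (f x)"
  shows "0 < op_norm_on S \<nu> \<nu>' f"
proof -
  have "ennreal (\<nu>' (f x)) \<le> op_norm_on S \<nu> \<nu>' f"
    unfolding op_norm_on_def using assms by (intro SUP_upper) auto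
  moreover have "0 < ennreal (\<nu>' (f x))" using assms by simp
  ultimately show ?thesis by (rule less_le_trans[rotated])
qed

text \<open>Approximate coordinates on a finite set: the functionals \<open>A k\<close> map into the unit ball
  of \<open>\<ell>\<^sup>\<infinity>\<close>, and \<open>B\<close> recovers the points of \<open>X\<close> with norm at most \<open>c\<close>.\<close>

definition coordinates ::
    "real \<Rightarrow> 'a::complex_normed_vector set \<Rightarrow> (nat \<Rightarrow> 'a \<Rightarrow> complex) \<Rightarrow> ((nat \<Rightarrow> complex) \<Rightarrow> 'a) \<Rightarrow> bool"
  where "coordinates c X A B \<longleftrightarrow> (\<forall>k. A k \<in> dual_unit_ball) \<and>
    (\<forall>v w. B (\<lambda>k. v k + w k) = B v + B w) \<and> (\<forall>a v. B (\<lambda>k. a * v k) = a *\<^sub>C B v) \<and>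
    (\<forall>v M. (\<forall>k. cmod (v k) \<le> M) \<longrightarrow> norm (B v) \<le> c * M) \<and> (\<forall>x\<in>X. B (\<lambda>k. A k x) = x)"

lemma zero_in_dual_unit_ball: "(\<lambda>_. 0) \<in> dual_unit_ball"
  by (auto simp: mem_dual_unit_ball_iff clinear_iff)

text \<open>The zero subspace is treated apart, since both operator norms vanish there.\<close>

lemma coordinates_zero: "0 \<le> c \<Longrightarrow> X \<subseteq> {0} \<Longrightarrow> coordinates c X (\<lambda>_ _. 0) (\<lambda>_. 0)"
  using zero_in_dual_unit_ball
  by (auto simp: coordinates_def intro!: mult_nonneg_nonneg intro: order_trans[OF norm_ge_zero])

text \<open>Dividing the coordinates of \<open>T\<close> by its norm and extending them by
  Hahn-Banach gives \<open>A\<close>. The norm returns as the factor \<open>a'\<close> in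
  \<open>B\<close>, so the whole distortion falls on \<open>B\<close>.\<close>

lemma coordinates_if_isomorphism:
  fixes N :: "'a::complex_normed_vector set"
  assumes N: "complex_vector.subspace N" and iso: "lr_isomorphism N n T"
    and X: "X \<subseteq> N" and c: "0 \<le> c" and x0: "x0 \<in> N" "x0 \<noteq> 0"
    and bound: "op_norm_on N norm (lr_norm \<infinity> n) T *
      op_norm_on (lr_carrier n) (lr_norm \<infinity> n) norm (inv_into N T) \<le> ennreal c"
  shows "\<exists>A B. coordinates c X A B"
proof -
  define S where "S = inv_into N T"
  define a where "a = op_norm_on N norm (lr_norm \<infinity> n) T"
  define b where "b = op_norm_on (lr_carrier n) (lr_norm \<infinity> n) norm S"
  have bij: "bij_betw T N (lr_carrier n)"
    and Tadd: "\<And>x y. x \<in> N \<Longrightarrow> y \<in> N \<Longrightarrow> T (x + y) = (\<lambda>k. T x k + T y k)"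
    and Tscale: "\<And>t x. x \<in> N \<Longrightarrow> T (t *\<^sub>C x) = (\<lambda>k. t * T x k)"
    using iso by (auto simp: lr_isomorphism_def)
  have TN: "T x \<in> lr_carrier n" if "x \<in> N" for x using bij that by (auto dest: bij_betwE)
  have ST: "S (T x) = x" if "x \<in> N" for x
    using bij that by (auto simp: S_def bij_betw_def inv_into_f_f)
  have TS: "T (S v) = v" and SN: "S v \<in> N" if "v \<in> lr_carrier n" for v
    using bij that by (auto simp: S_def bij_betw_def f_inv_into_f inv_into_into)
  have Tz: "T x k = 0" if "x \<in> N" "n \<le> k" for x k using TN[OF that(1)] that(2) by (auto simp: lr_carrier_def)
  have Sadd: "S (\<lambda>k. v k + w k) = S v + S w" if "v \<in> lr_carrier n" "w \<in> lr_carrier n" for v w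
    using Tadd[of "S v" "S w"] TS SN that ST[of "S v + S w"] complex_vector.subspace_add[OF N] by metis
  have Sscale: "S (\<lambda>k. t * v k) = t *\<^sub>C S v" if "v \<in> lr_carrier n" for t v
    using Tscale[of "S v" t] TS SN that ST[of "t *\<^sub>C S v"] complex_vector.subspace_scale[OF N] by metis
  have T0: "T 0 = (\<lambda>_. 0)" using Tscale[OF x0(1), of 0] by simp
  have S0: "S (\<lambda>_. 0) = 0" using ST[of 0] T0 complex_vector.subspace_0[OF N] by simp
  define r where "r = lr_norm \<infinity> n (T x0)"
  have r: "0 < r"
  proof -
    have "T x0 \<noteq> (\<lambda>_. 0)" using ST[OF x0(1)] S0 x0(2) by auto
    then obtain k where "T x0 k \<noteq> 0" by auto
    then show ?thesis using le_lr_norm_infinity[of k n "T x0"] Tz[OF x0(1), of k]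
      by (cases "k < n") (auto simp: r_def intro: less_le_trans[rotated])
  qed
  have "0 < a"
    unfolding a_def
  proof (rule op_norm_on_pos)
    define t where "t = complex_of_real (inverse (norm x0))"
    show "t *\<^sub>C x0 \<in> N" using x0 complex_vector.subspace_scale[OF N] by auto
    show "norm (t *\<^sub>C x0) \<le> 1" using x0 by (simp add: t_def norm_scaleC norm_inverse)
    have "r \<le> norm x0 * lr_norm \<infinity> n (T (t *\<^sub>C x0))"
      unfolding r_def
    proof (rule lr_norm_infinity_le)
      fix k assume k: "k < n"
      have "cmod (T x0 k) = norm x0 * cmod (T (t *\<^sub>C x0) k)"
        using x0 by (simp add: Tscale t_def norm_mult norm_inverse)
      also have "\<dots> \<le> norm x0 * lr_norm \<infinity> n (T (t *\<^sub>C x0))"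
        by (intro mult_left_mono le_lr_norm_infinity k) simp
      finally show "cmod (T x0 k) \<le> \<dots>" .
    qed (auto simp: lr_norm_def)
    then show "0 < lr_norm \<infinity> n (T (t *\<^sub>C x0))" using r
      by (metis less_le_trans norm_ge_zero zero_less_mult_iff not_less)
  qed
  have "0 < b"
    unfolding b_def
  proof (rule op_norm_on_pos)
    define v where "v = (\<lambda>k. complex_of_real (inverse r) * T x0 k)"
    show "v \<in> lr_carrier n" using TN[OF x0(1)] by (auto simp: v_def lr_carrier_def)
    show "lr_norm \<infinity> n v \<le> 1"
    proof (rule lr_norm_infinity_le)
      fix k assume "k < n"
      then show "cmod (v k) \<le> 1"
        using le_lr_norm_infinity[of k n "T x0", folded r_def] r by (simp add: v_def norm_divide field_simps)
    qed simp
    show "0 < norm (S v)"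
      unfolding v_def Sscale[OF TN[OF x0(1)]] ST[OF x0(1)] using x0 r by (simp add: norm_scaleC norm_inverse)
  qed
  have ab: "a * b \<le> ennreal c" using bound by (simp add: a_def b_def S_def)
  then have "a < top" "b < top"
    using \<open>0 < a\<close> \<open>0 < b\<close>
    by (auto simp: less_top[symmetric] ennreal_mult_top ennreal_top_mult top_unique split: if_splits)
  define a' b' where "a' = enn2real a" and "b' = enn2real b"
  have a': "0 < a'" using \<open>0 < a\<close> \<open>a < top\<close> by (simp add: a'_def enn2real_positive_iff)
  have b': "0 \<le> b'" by (simp add: b'_def)
  have ab': "a' * b' \<le> c"
    using enn2real_mono[OF ab] c by (simp add: a'_def b'_def enn2real_mult)
  have Tb: "cmod (T x k) \<le> a' * norm x" if x: "x \<in> N" for x k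
  proof (cases "x = 0 \<or> n \<le> k")
    case True then show ?thesis using Tz[OF x] T0 a' by auto
  next
    case False
    define t where "t = complex_of_real (inverse (norm x))"
    have "cmod (T (t *\<^sub>C x) k) \<le> lr_norm \<infinity> n (T (t *\<^sub>C x))"
      by (rule le_lr_norm_infinity) (use False in simp)
    also have "\<dots> \<le> a'"
      unfolding a'_def a_def
      by (rule op_norm_on_upper)
        (use x False \<open>a < top\<close> complex_vector.subspace_scale[OF N] in \<open>auto simp: a_def t_def norm_scaleC norm_inverse\<close>)
    finally have "inverse (norm x) * cmod (T x k) \<le> a'" by (simp add: Tscale[OF x] t_def norm_mult norm_inverse)
    then show ?thesis using False by (simp add: field_simps)
  qed
  have Sb: "norm (S v) \<le> b' * M" if v: "v \<in> lr_carrier n" and M: "\<And>k. cmod (v k) \<le> M" for v M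
  proof (cases "M = 0")
    case True
    then have "v = (\<lambda>_. 0)" using M by auto
    then show ?thesis using S0 True by simp
  next
    case False
    then have M0: "0 < M" using order_trans[OF norm_ge_zero M[of 0]] by simp
    define t where "t = complex_of_real (inverse M)"
    have tv: "(\<lambda>k. t * v k) \<in> lr_carrier n" using v by (auto simp: lr_carrier_def)
    have "norm (S (\<lambda>k. t * v k)) \<le> b'"
      unfolding b'_def b_def
    proof (rule op_norm_on_upper)
      show "lr_norm \<infinity> n (\<lambda>k. t * v k) \<le> 1"
        by (rule lr_norm_infinity_le) (use M M0 in \<open>auto simp: t_def norm_divide field_simps\<close>)
    qed (use tv \<open>b < top\<close> in \<open>auto simp: b_def\<close>)
    then have "inverse M * norm (S v) \<le> b'" using M0 by (simp add: Sscale[OF v] norm_scaleC t_def norm_inverse)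
    then show ?thesis using M0 by (simp add: field_simps)
  qed
  have "\<exists>\<phi>\<in>dual_unit_ball. \<forall>x\<in>N. \<phi> x = inverse (of_real a') * T x k" for k
  proof -
    obtain \<phi> where "\<phi> \<in> dual_unit_ball" "\<And>x. x \<in> N \<Longrightarrow> \<phi> x = inverse (of_real a') * T x k"
    proof (rule complex_Hahn_Banach[OF N, of "\<lambda>x. inverse (of_real a') * T x k"])
      show "cmod (inverse (of_real a') * T x k) \<le> norm x" if "x \<in> N" for x
        using Tb[OF that, of k] a' by (simp add: norm_divide field_simps)
    qed (auto simp: Tadd Tscale algebra_simps)
    then show ?thesis by blast
  qed
  then obtain A where A: "\<And>k. A k \<in> dual_unit_ball" "\<And>k x. x \<in> N \<Longrightarrow> A k x = inverse (of_real a') * T x k"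
    by metis
  \<comment> \<open>\<open>B\<close> must accept arbitrary sequences, while \<open>S\<close> inverts
    \<open>T\<close> on \<open>lr_carrier n\<close> only. From index \<open>n\<close> on the
    functionals \<open>A k\<close> vanish on \<open>N\<close>, so cutting off loses nothing
    there.\<close>
  define cut where "cut v = (\<lambda>k. if k < n then v k else 0)" for v :: "nat \<Rightarrow> complex"
  have cut: "cut v \<in> lr_carrier n" for v by (auto simp: cut_def lr_carrier_def)
  have "coordinates c X A (\<lambda>v. of_real a' *\<^sub>C S (cut v))"
    unfolding coordinates_def
  proof (intro conjI allI impI ballI A(1))
    fix v w :: "nat \<Rightarrow> complex"
    have "cut (\<lambda>k. v k + w k) = (\<lambda>k. cut v k + cut w k)" by (auto simp: cut_def)
    then show "of_real a' *\<^sub>C S (cut (\<lambda>k. v k + w k)) = of_real a' *\<^sub>C S (cut v) + of_real a' *\<^sub>C S (cut w)"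
      using Sadd[OF cut cut] by (simp add: scaleC_add_right)
  next
    fix t and v :: "nat \<Rightarrow> complex"
    have "cut (\<lambda>k. t * v k) = (\<lambda>k. t * cut v k)" by (auto simp: cut_def)
    then show "of_real a' *\<^sub>C S (cut (\<lambda>k. t * v k)) = t *\<^sub>C of_real a' *\<^sub>C S (cut v)"
      using Sscale[OF cut] by (simp add: scaleC_scaleC mult.commute)
  next
    fix v :: "nat \<Rightarrow> complex" and M assume M: "\<forall>k. cmod (v k) \<le> M"
    then have M0: "0 \<le> M" by (meson norm_ge_zero order_trans)
    have "norm (S (cut v)) \<le> b' * M" by (rule Sb[OF cut]) (use M M0 in \<open>auto simp: cut_def\<close>)
    then have "norm (of_real a' *\<^sub>C S (cut v)) \<le> a' * (b' * M)" using a' by (simp add: norm_scaleC)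
    also have "\<dots> \<le> c * M" using ab' M0 by (simp add: mult.assoc[symmetric] mult_right_mono)
    finally show "norm (of_real a' *\<^sub>C S (cut v)) \<le> c * M" .
  next
    fix x assume "x \<in> X"
    then have x: "x \<in> N" using X by blast
    have "cut (\<lambda>k. A k x) = (\<lambda>k. inverse (of_real a') * T x k)"
      using A(2)[OF x] Tz[OF x] by (auto simp: cut_def)
    then show "of_real a' *\<^sub>C S (cut (\<lambda>k. A k x)) = x"
      using Sscale[OF TN[OF x]] ST[OF x] a' by (simp add: scaleC_scaleC scaleC_one)
  qed
  then show ?thesis by blast
qed

text \<open>The previous lemma is applied to a space containing the span of \<open>X\<close>; the
  point is that \<open>c\<close> does not depend on \<open>X\<close>.\<close>

lemma Linf_space_coordinates:
  assumes "Lr_space \<infinity> TYPE('a::complex_banach)"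
  obtains c where "1 < c" "\<And>X::'a set. finite X \<Longrightarrow> \<exists>A B. coordinates c X A B"
proof -
  obtain c :: real where c: "1 < c" and *: "\<And>M::'a set. fin_dim_subspace M \<Longrightarrow>
      (\<exists>N T. fin_dim_subspace N \<and> M \<subseteq> N \<and> lr_isomorphism N (complex_vector.dim N) T \<and>
        op_norm_on N norm (lr_norm \<infinity> (complex_vector.dim N)) T *
        op_norm_on (lr_carrier (complex_vector.dim N)) (lr_norm \<infinity> (complex_vector.dim N)) norm
          (inv_into N T) \<le> ennreal c)"
    using assms unfolding Lr_space_def by blast
  have "\<exists>A B. coordinates c X A B" if "finite X" for X :: "'a set"
  proof -
    have "fin_dim_subspace (complex_vector.span X)"
      using that by (auto simp: fin_dim_subspace_def complex_vector.subspace_span)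
    then obtain N T where N: "fin_dim_subspace N" "complex_vector.span X \<subseteq> N"
        "lr_isomorphism N (complex_vector.dim N) T"
        "op_norm_on N norm (lr_norm \<infinity> (complex_vector.dim N)) T *
          op_norm_on (lr_carrier (complex_vector.dim N)) (lr_norm \<infinity> (complex_vector.dim N)) norm
          (inv_into N T) \<le> ennreal c"
      using * by blast
    have X: "X \<subseteq> N" using N(2) complex_vector.span_superset by blast
    show ?thesis
    proof (cases "N \<subseteq> {0}")
      case True
      then have "X \<subseteq> {0}" using X by blast
      then show ?thesis using coordinates_zero[of c X] c by auto
    next
      case False
      then obtain x0 where "x0 \<in> N" "x0 \<noteq> 0" by blast
      then show ?thesis
        using coordinates_if_isomorphism[OF _ N(3) X _ _ _ N(4)] N(1) c by (auto simp: fin_dim_subspace_def)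
    qed
  qed
  then show ?thesis using c that by blast
qed

subsection \<open>Operators on \<open>\<LL>\<^sup>\<infinity>\<close>-spaces as limits of operators on bounded functions\<close>

lemma dual_unit_ball_simps:
  assumes "\<psi> \<in> dual_unit_ball"
  shows "\<psi> (x + y) = \<psi> x + \<psi> y" "\<psi> (x - y) = \<psi> x - \<psi> y" "\<psi> (a *\<^sub>C x) = a * \<psi> x"
    "\<psi> (r *\<^sub>R x) = of_real r * \<psi> x" "cmod (\<psi> x) \<le> norm x"
proof -
  have *: "\<psi> (x + y) = \<psi> x + \<psi> y" "\<psi> (a *\<^sub>C x) = a * \<psi> x" for x y a
    using assms by (auto simp: mem_dual_unit_ball_iff clinear_iff scaleC_complex_def)
  then show "\<psi> (x + y) = \<psi> x + \<psi> y" "\<psi> (a *\<^sub>C x) = a * \<psi> x" "\<psi> (r *\<^sub>R x) = of_real r * \<psi> x"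
    by (auto simp: scaleR_scaleC)
  show "\<psi> (x - y) = \<psi> x - \<psi> y" using *(1)[of "x - y" y] by simp
  show "cmod (\<psi> x) \<le> norm x" using assms by (simp add: mem_dual_unit_ball_iff)
qed

lemma dual_unit_ball_subset: "\<psi> \<in> dual_unit_ball \<Longrightarrow> \<psi> \<in> dual_space"
  by (simp add: dual_unit_ball_def)

lemma le_add_power2_divide:
  fixes t r :: real
  assumes "0 < t"
  shows "r \<le> t + r\<^sup>2 / t"
proof -
  have "2 * (r * t) \<le> r\<^sup>2 + t\<^sup>2" using sum_squares_bound[of r t] by (simp add: mult.assoc)
  then have "r * t \<le> t\<^sup>2 + r\<^sup>2" using zero_le_power2[of r] zero_le_power2[of t] by linarith
  then show ?thesis using assms by (simp add: field_simps power2_eq_square)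
qed

lemma le_add_powr:
  fixes \<eta> p r :: real
  assumes "0 < \<eta>" "1 \<le> p" "0 \<le> r"
  shows "r \<le> \<eta> + \<eta> powr (1 - p) * r powr p"
proof (cases "r \<le> \<eta>")
  case False
  have "r = r powr (1 - p) * r powr p" using False assms by (simp flip: powr_add)
  also have "\<dots> \<le> \<eta> powr (1 - p) * r powr p"
    using False assms by (intro mult_right_mono powr_mono2') auto
  finally show ?thesis using assms by linarith
qed (use assms in \<open>auto intro: add_increasing2\<close>)

text \<open>Infinite sets are replaced by the empty set so that \<open>A\<close> and
  \<open>B\<close> are total. They are negligible along \<open>U\<close>, and each point of the
  space lies in \<open>X\<close> for \<open>U\<close>-almost all \<open>X\<close>.\<close>

locale linf_operator =
  fixes T :: "'a::complex_banach \<Rightarrow> 'b::complex_banach"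
    and c K :: real
    and A :: "'a set \<Rightarrow> nat \<Rightarrow> 'a \<Rightarrow> complex"
    and B :: "'a set \<Rightarrow> (nat \<Rightarrow> complex) \<Rightarrow> 'a"
    and U :: "'a set filter"
  assumes T: "clinear T" and c: "1 < c" and K: "0 < K" "\<And>x. norm (T x) \<le> K * norm x"
    and coords: "\<And>X. coordinates c (if finite X then X else {}) (A X) (B X)"
    and U: "ultra U" "U \<le> finite_subsets_at_top UNIV"
begin

text \<open>An index is a set with a coordinate number; every entry is a functional in the dual ball
  applied to \<open>x\<close>, whatever the set.\<close>

definition J :: "'a \<Rightarrow> 'a set \<times> nat \<Rightarrow> complex"
  where "J x i = A (fst i) (snd i) x"

text \<open>Only the block of \<open>X\<close> is read. This undoes \<open>J\<close> at
  \<open>x\<close> as soon as the finite set \<open>X\<close> contains \<open>x\<close>.\<close>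

definition R :: "'a set \<Rightarrow> ('a set \<times> nat \<Rightarrow> complex) \<Rightarrow> 'a"
  where "R X f = B X (\<lambda>k. f (X, k))"

text \<open>For a constant family this pairs \<open>\<psi>\<close> with an extension of
  \<open>T\<close> to the bounded functions, whose values lie in the bidual.\<close>

definition lim_functional :: "('a set \<Rightarrow> 'b \<Rightarrow> complex) \<Rightarrow> ('a set \<times> nat \<Rightarrow> complex) \<Rightarrow> complex"
  where "lim_functional \<psi> f = Lim U (\<lambda>X. \<psi> X (T (R X f)))"

lemma T_add: "T (x + y) = T x + T y" and T_scale: "T (a *\<^sub>C x) = a *\<^sub>C T x"
  using T by (auto simp: clinear_iff)

lemma T_scaleR: "T (r *\<^sub>R x) = r *\<^sub>R T x"
  by (simp add: scaleR_scaleC T_scale)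

lemma A_dual: "A X k \<in> dual_unit_ball"
  using coords[of X] by (simp add: coordinates_def)

lemma J_add: "J (x + y) i = J x i + J y i"
  and J_diff: "J (x - y) i = J x i - J y i"
  and J_bound: "cmod (J x i) \<le> norm x"
  by (simp_all add: J_def dual_unit_ball_simps[OF A_dual])

lemma R_add: "R X (\<lambda>i. f i + g i) = R X f + R X g"
  and R_scale: "R X (\<lambda>i. a * f i) = a *\<^sub>C R X f"
  using coords[of X] by (auto simp: R_def coordinates_def)

lemma R_bound: "(\<And>i. cmod (f i) \<le> M) \<Longrightarrow> norm (R X f) \<le> c * M"
  using coords[of X] by (auto simp: R_def coordinates_def)

lemma R_J: "eventually (\<lambda>X. R X (J x) = x) U"
proof -
  have "eventually (\<lambda>X. finite X \<and> x \<in> X) (finite_subsets_at_top UNIV)"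
    unfolding eventually_finite_subsets_at_top by (intro exI[of _ "{x}"]) auto
  then have "eventually (\<lambda>X. finite X \<and> x \<in> X) U"
    using U(2) by (simp add: le_filter_def)
  then show ?thesis
  proof eventually_elim
    case (elim X)
    then show ?case using coords[of X] by (simp add: coordinates_def R_def J_def)
  qed
qed

lemma TR_bound:
  assumes "\<And>i. cmod (f i) \<le> M"
  shows "norm (T (R X f)) \<le> K * c * M"
proof -
  have "K * norm (R X f) \<le> K * (c * M)" using K(1) by (intro mult_left_mono R_bound assms) auto
  then show ?thesis using K(2)[of "R X f"] unfolding mult.assoc by linarith
qed

lemma lim_functional_tendsto:
  assumes f: "bounded_fun f" and \<psi>: "\<And>X. \<psi> X \<in> dual_unit_ball"
  shows "((\<lambda>X. \<psi> X (T (R X f))) \<longlongrightarrow> lim_functional \<psi> f) U"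
proof -
  obtain M where M: "\<And>i. cmod (f i) \<le> M" using f by (auto simp: bounded_fun_def)
  show ?thesis
    unfolding lim_functional_def
    by (rule ultra_Lim[OF U(1), of _ "K * c * M"])
      (auto intro!: always_eventually order_trans[OF dual_unit_ball_simps(5)[OF \<psi>] TR_bound[OF M]])
qed

lemma lim_functional_eqI:
  assumes "((\<lambda>X. \<psi> X (T (R X f))) \<longlongrightarrow> l) U"
  shows "lim_functional \<psi> f = l"
  unfolding lim_functional_def using tendsto_Lim[OF ultra_not_bot[OF U(1)] assms] .

lemma bfunctional_lim_functional:
  assumes \<psi>: "\<And>X. \<psi> X \<in> dual_unit_ball"
  shows "bfunctional (K * c) (lim_functional \<psi>)"
  unfolding bfunctional_def
proof (intro conjI allI impI)
  show "0 \<le> K * c" using K c by simp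
  fix f g :: "'a set \<times> nat \<Rightarrow> complex" and a M
  show "lim_functional \<psi> (\<lambda>i. f i + g i) = lim_functional \<psi> f + lim_functional \<psi> g"
    if "bounded_fun f" "bounded_fun g"
    using tendsto_add[OF lim_functional_tendsto[OF that(1) \<psi>] lim_functional_tendsto[OF that(2) \<psi>]]
    by (intro lim_functional_eqI) (simp add: R_add T_add dual_unit_ball_simps[OF \<psi>])
  show "lim_functional \<psi> (\<lambda>i. a * f i) = a * lim_functional \<psi> f" if "bounded_fun f"
    using tendsto_mult_left[OF lim_functional_tendsto[OF that \<psi>], of a]
    by (intro lim_functional_eqI) (simp add: R_scale T_scale dual_unit_ball_simps[OF \<psi>])
  show "cmod (lim_functional \<psi> f) \<le> K * c * M" if M: "\<forall>i. cmod (f i) \<le> M"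
  proof (rule tendsto_upperbound)
    show "((\<lambda>X. cmod (\<psi> X (T (R X f)))) \<longlongrightarrow> cmod (lim_functional \<psi> f)) U"
      using M by (intro tendsto_norm lim_functional_tendsto bounded_funI[of f M] \<psi>) auto
    show "eventually (\<lambda>X. cmod (\<psi> X (T (R X f))) \<le> K * c * M) U"
      using M by (intro always_eventually allI order_trans[OF dual_unit_ball_simps(5)[OF \<psi>] TR_bound]) auto
  qed (rule ultra_not_bot[OF U(1)])
qed

lemma lim_functional_J: "\<psi> \<in> dual_unit_ball \<Longrightarrow> lim_functional (\<lambda>_. \<psi>) (J x) = \<psi> (T x)"
  by (rule lim_functional_eqI, rule tendsto_eventually) (use R_J[of x] in \<open>auto elim: eventually_mono\<close>)

lemma controlled_norm_le:
  assumes ctl: "controlled \<F> e" and \<F>: "\<And>\<psi>. \<psi> \<in> dual_unit_ball \<Longrightarrow> lim_functional (\<lambda>_. \<psi>) \<in> \<F>"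
  obtains P N where "finite P" "P \<subseteq> \<F>" "0 \<le> N"
    "\<And>x. norm x \<le> 1 \<Longrightarrow> norm (T x) \<le> N * (\<Sum>\<theta>\<in>P. variation \<theta> (\<lambda>i. cmod (J x i))) + e"
proof -
  obtain P N where PN: "finite P" "P \<subseteq> \<F>" "0 \<le> N"
    "\<And>f \<phi>. (\<And>i. cmod (f i) \<le> 1) \<Longrightarrow> \<phi> \<in> \<F> \<Longrightarrow>
      cmod (\<phi> f) \<le> N * (\<Sum>\<theta>\<in>P. variation \<theta> (\<lambda>i. cmod (f i))) + e"
    using ctl unfolding controlled_def by blast
  have "norm (T x) \<le> N * (\<Sum>\<theta>\<in>P. variation \<theta> (\<lambda>i. cmod (J x i))) + e" if "norm x \<le> 1" for x
  proof -
    obtain \<psi> where \<psi>: "\<psi> \<in> dual_unit_ball" "\<psi> (T x) = of_real (norm (T x))" by (rule norming_functional)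
    have "norm (T x) = cmod (lim_functional (\<lambda>_. \<psi>) (J x))" using \<psi> by (simp add: lim_functional_J)
    also have "\<dots> \<le> N * (\<Sum>\<theta>\<in>P. variation \<theta> (\<lambda>i. cmod (J x i))) + e"
      using PN(4)[OF _ \<F>[OF \<psi>(1)]] J_bound[of x] that by (meson order_trans)
    finally show ?thesis .
  qed
  then show ?thesis using PN(1-3) that by blast
qed

text \<open>The parallelogram law holds pointwise for squared moduli and passes to \<open>g\<close>
  because variations are additive. The error \<open>2 * e\<close> is paid once for control and once
  for the constant \<open>t\<close>.\<close>

lemma quadratic_majorant:
  assumes ctl: "controlled \<F> e" and e: "0 < e"
    and \<F>: "\<And>\<psi>. \<psi> \<in> dual_unit_ball \<Longrightarrow> lim_functional (\<lambda>_. \<psi>) \<in> \<F>"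
    and bf: "\<And>\<phi>. \<phi> \<in> \<F> \<Longrightarrow> bfunctional (K * c) \<phi>"
  shows "\<exists>g M. (\<forall>x. 0 \<le> g x) \<and> (\<forall>x y. g (x + y) + g (x - y) = 2 * g x + 2 * (g y :: real)) \<and>
    (\<forall>x. norm x \<le> 1 \<longrightarrow> g x \<le> M \<and> norm (T x) \<le> g x + 2 * e)"
proof -
  obtain P N where P: "finite P" "P \<subseteq> \<F>" "0 \<le> N"
    "\<And>x. norm x \<le> 1 \<Longrightarrow> norm (T x) \<le> N * (\<Sum>\<theta>\<in>P. variation \<theta> (\<lambda>i. cmod (J x i))) + e"
    using controlled_norm_le[OF ctl \<F>] by blast
  \<comment> \<open>The constant function \<open>t\<close> contributes at most
    \<open>N * card P * (K * c) * t\<close>, which this choice keeps below \<open>e\<close>; the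
    added \<open>1\<close> keeps the denominator positive.\<close>
  define t where "t = e / (N * card P * (K * c) + 1)"
  have pos: "0 < N * card P * (K * c) + 1" using P(3) K c by (simp add: add_nonneg_pos)
  have t: "0 < t" using e pos by (simp add: t_def)
  have tN: "N * card P * (K * c) * t \<le> e"
    using e pos by (simp add: t_def field_simps)
  define s where "s x = (\<lambda>i. (cmod (J x i))\<^sup>2)" for x
  have s: "0 \<le> s x i" "s x i \<le> (norm x)\<^sup>2" for x i
    using J_bound[of x i] by (auto simp: s_def power_mono)
  have bfP: "bfunctional (K * c) \<theta>" if "\<theta> \<in> P" for \<theta> using that P(2) bf by blast
  define g where "g x = N * (\<Sum>\<theta>\<in>P. variation \<theta> (s x)) / t" for x
  have "0 \<le> g x" for x
    unfolding g_def using P(3) t s by (auto intro!: mult_nonneg_nonneg divide_nonneg_pos sum_nonneg variation_nonneg[OF bfP])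
  moreover have "g (x + y) + g (x - y) = 2 * g x + 2 * g y" for x y
  proof -
    have "variation \<theta> (s (x + y)) + variation \<theta> (s (x - y)) = 2 * variation \<theta> (s x) + 2 * variation \<theta> (s y)"
      if "\<theta> \<in> P" for \<theta>
    proof -
      note b = bfP[OF that]
      have "variation \<theta> (s (x + y)) + variation \<theta> (s (x - y)) = variation \<theta> (\<lambda>i. s (x + y) i + s (x - y) i)"
        by (rule variation_add[OF b s s, symmetric])
      also have "(\<lambda>i. s (x + y) i + s (x - y) i) = (\<lambda>i. 2 * s x i + 2 * s y i)"
        by (rule ext) (simp only: s_def J_add J_diff cmod_power2, simp add: power2_eq_square algebra_simps)
      also have "variation \<theta> \<dots> = variation \<theta> (\<lambda>i. 2 * s x i) + variation \<theta> (\<lambda>i. 2 * s y i)"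
        by (rule variation_add[OF b, of _ "2 * (norm x)\<^sup>2" _ "2 * (norm y)\<^sup>2"]) (use s in auto)
      also have "\<dots> = 2 * variation \<theta> (s x) + 2 * variation \<theta> (s y)"
        using variation_scale[OF b s, of 2] by simp
      finally show ?thesis .
    qed
    then have "(\<Sum>\<theta>\<in>P. variation \<theta> (s (x + y))) + (\<Sum>\<theta>\<in>P. variation \<theta> (s (x - y))) =
        2 * (\<Sum>\<theta>\<in>P. variation \<theta> (s x)) + 2 * (\<Sum>\<theta>\<in>P. variation \<theta> (s y))"
      unfolding sum_distrib_left sum.distrib[symmetric] by (intro sum.cong) auto
    then show ?thesis
      unfolding g_def add_divide_distrib[symmetric] distrib_left[symmetric] by (simp add: algebra_simps add_divide_distrib)
  qed
  moreover have "g x \<le> N * (card P * (K * c * 1)) / t" if x: "norm x \<le> 1" for x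
  proof -
    have "s x i \<le> 1" for i using s(2)[of x i] x power_le_one[of "norm x" 2] by simp
    then have "(\<Sum>\<theta>\<in>P. variation \<theta> (s x)) \<le> card P * (K * c * 1)"
      by (intro sum_bounded_above variation_bound[OF bfP] s)
    then show ?thesis unfolding g_def using P(3) t by (intro divide_right_mono mult_left_mono) auto
  qed
  moreover have "norm (T x) \<le> g x + 2 * e" if x: "norm x \<le> 1" for x
  proof -
    have "variation \<theta> (\<lambda>i. cmod (J x i)) \<le> K * c * t + variation \<theta> (s x) / t" if "\<theta> \<in> P" for \<theta>
    proof -
      note b = bfP[OF that]
      have "variation \<theta> (\<lambda>i. cmod (J x i)) \<le> variation \<theta> (\<lambda>i. t + inverse t * s x i)"
      proof (rule variation_mono[OF b])
        show "cmod (J x i) \<le> t + inverse t * s x i" for i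
          using le_add_power2_divide[OF t, of "cmod (J x i)"] by (simp add: s_def field_simps)
        show "t + inverse t * s x i \<le> t + inverse t * (norm x)\<^sup>2" for i using s(2) t by simp
      qed simp
      also have "\<dots> = variation \<theta> (\<lambda>i. t) + variation \<theta> (\<lambda>i. inverse t * s x i)"
        by (rule variation_add[OF b, of _ t _ "inverse t * (norm x)\<^sup>2"]) (use s t in auto)
      also have "\<dots> \<le> K * c * t + inverse t * variation \<theta> (s x)"
        using t by (intro add_mono variation_bound[OF b] variation_scale_le[OF b s]) auto
      finally show ?thesis by (simp add: field_simps)
    qed
    then have "(\<Sum>\<theta>\<in>P. variation \<theta> (\<lambda>i. cmod (J x i))) \<le> (\<Sum>\<theta>\<in>P. K * c * t + variation \<theta> (s x) / t)"
      by (rule sum_mono)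
    also have "\<dots> = card P * (K * c * t) + (\<Sum>\<theta>\<in>P. variation \<theta> (s x)) / t"
      by (simp add: sum.distrib sum_divide_distrib)
    finally have "N * (\<Sum>\<theta>\<in>P. variation \<theta> (\<lambda>i. cmod (J x i))) \<le>
        N * (card P * (K * c * t) + (\<Sum>\<theta>\<in>P. variation \<theta> (s x)) / t)"
      using P(3) by (rule mult_left_mono)
    also have "\<dots> \<le> e + g x" using tN by (simp add: g_def algebra_simps)
    finally show ?thesis using P(4)[OF x] by linarith
  qed
  ultimately show ?thesis by (intro exI[of _ g] exI[of _ "N * (card P * (K * c * 1)) / t"]) blast
qed

end

subsection \<open>Quadratic majorants imply weak compactness\<close>

text \<open>A weak cluster point of \<open>T(ball)\<close> is approximated, uniformly on the dual ball, by the image of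
  a near-minimiser of the quadratic form over a small convex set: by the parallelogram law
  near-minimisers over smaller convex sets stay close to it.\<close>

lemma near_minimiser:
  fixes T :: "'a::complex_normed_vector \<Rightarrow> 'b::complex_normed_vector"
    and g :: "'a \<Rightarrow> real" and \<Phi> :: "('b \<Rightarrow> complex) \<Rightarrow> complex"
  assumes T: "clinear T"
    and g: "\<And>x. 0 \<le> g x" "\<And>x y. g (x + y) + g (x - y) = 2 * g x + 2 * g y"
      "\<And>x. norm x \<le> 1 \<Longrightarrow> g x \<le> M" "\<And>x. norm x \<le> 1 \<Longrightarrow> norm (T x) \<le> g x + e"
    and e: "0 < e"
    and ne: "\<And>\<Psi> \<eta>. finite \<Psi> \<Longrightarrow> \<Psi> \<subseteq> dual_unit_ball \<Longrightarrow> 0 < \<eta> \<Longrightarrow>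
      \<exists>x. norm x \<le> 1 \<and> (\<forall>\<psi>\<in>\<Psi>. cmod (\<psi> (T x) - \<Phi> \<psi>) \<le> \<eta>)"
  shows "\<exists>z. \<forall>\<psi>\<in>dual_unit_ball. cmod (\<psi> z - \<Phi> \<psi>) \<le> 4 * e"
proof -
  have Tadd: "T (x + y) = T x + T y" and Tscale: "T (a *\<^sub>C x) = a *\<^sub>C T x" for x y a
    using T by (auto simp: clinear_iff)
  have TscaleR: "T (r *\<^sub>R x) = r *\<^sub>R T x" for r x by (simp add: scaleR_scaleC Tscale)
  have Tdiff: "T (x - y) = T x - T y" for x y using Tadd[of "x - y" y] by simp
  define C where "C \<Psi> \<eta> = {x. norm x \<le> 1 \<and> (\<forall>\<psi>\<in>\<Psi>. cmod (\<psi> (T x) - \<Phi> \<psi>) \<le> \<eta>)}" for \<Psi> \<eta>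
  define I :: "(('b \<Rightarrow> complex) set \<times> real) set"
    where "I = {(\<Psi>, \<eta>). finite \<Psi> \<and> \<Psi> \<subseteq> dual_unit_ball \<and> 0 < \<eta>}"
  \<comment> \<open>Shrinking the convex sets raises the infimum of \<open>g\<close>, and all infima
    stay below \<open>M\<close>. Their supremum \<open>d\<close> is finite and nearly attained at
    some index, which is fixed first.\<close>
  define m where "m i = (INF x\<in>C (fst i) (snd i). g x)" for i
  define d where "d = (SUP i\<in>I. m i)"
  have C: "C \<Psi> \<eta> \<noteq> {}" if "(\<Psi>, \<eta>) \<in> I" for \<Psi> \<eta>
    using ne[of \<Psi> \<eta>] that by (auto simp: C_def I_def)
  have bb: "bdd_below (g ` X)" for X using g(1) by (auto intro: bdd_belowI[of _ 0])
  have m_le: "m (\<Psi>, \<eta>) \<le> g x" if "x \<in> C \<Psi> \<eta>" for \<Psi> \<eta> x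
    unfolding m_def using that by (auto intro!: cINF_lower bb)
  have "m i \<le> M" if i: "i \<in> I" for i
  proof -
    obtain x where x: "x \<in> C (fst i) (snd i)" using C[of "fst i" "snd i"] i by auto
    then have "g x \<le> M" using g(3) by (auto simp: C_def)
    then show ?thesis using m_le[OF x] by simp
  qed
  then have ba: "bdd_above (m ` I)" by (auto intro: bdd_aboveI[of _ M])
  have I0: "({}, 1) \<in> I" by (simp add: I_def)
  have m_le_d: "m i \<le> d" if "i \<in> I" for i unfolding d_def by (rule cSUP_upper[OF that ba])
  have near: "\<exists>x\<in>C \<Psi> \<eta>. g x \<le> d + e / 2" if i: "(\<Psi>, \<eta>) \<in> I" for \<Psi> \<eta>
  proof (rule ccontr)
    assume "\<not> ?thesis"
    then have "d + e / 2 \<le> m (\<Psi>, \<eta>)" unfolding m_def using C[OF i] by (intro cINF_greatest) auto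
    then show False using m_le_d[OF i] e by simp
  qed
  have "\<exists>i\<in>I. d - e / 2 < m i"
  proof (rule ccontr)
    assume "\<not> ?thesis"
    then have "d \<le> d - e / 2" unfolding d_def using I0 by (intro cSUP_least) (auto simp: not_less d_def)
    then show False using e by simp
  qed
  then obtain \<Psi> \<eta> where i: "(\<Psi>, \<eta>) \<in> I" "d - e / 2 < m (\<Psi>, \<eta>)" by auto
  obtain x where x: "x \<in> C \<Psi> \<eta>" "g x \<le> d + e / 2" using near[OF i(1)] by blast
  \<comment> \<open>\<open>x\<close> is chosen before \<open>\<psi>\<close>; only the comparison
    point \<open>y\<close> depends on \<open>\<psi>\<close> and \<open>\<delta>\<close>, which makes
    the estimate uniform.\<close>
  have "cmod (\<psi> (T x) - \<Phi> \<psi>) \<le> 4 * e" if \<psi>: "\<psi> \<in> dual_unit_ball" for \<psi>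
  proof (rule field_le_epsilon)
    fix \<delta> :: real assume \<delta>: "0 < \<delta>"
    have i': "(insert \<psi> \<Psi>, min \<eta> \<delta>) \<in> I" using i(1) \<psi> \<delta> by (auto simp: I_def)
    then obtain y where y: "y \<in> C (insert \<psi> \<Psi>) (min \<eta> \<delta>)" "g y \<le> d + e / 2" using near by blast
    have yC: "y \<in> C \<Psi> \<eta>" "cmod (\<psi> (T y) - \<Phi> \<psi>) \<le> \<delta>" using y(1) by (auto simp: C_def)
    \<comment> \<open>Halving makes \<open>u + v\<close> the midpoint of \<open>x\<close> and
      \<open>y\<close>, which lies in the convex set, and brings \<open>u - v\<close> into the unit
      ball.\<close>
    define u v where "u = (1 / 2) *\<^sub>R x" and "v = (1 / 2) *\<^sub>R y"
    have g0: "g 0 = 0" using g(2)[of 0 0] by simp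
    have dbl: "g (w + w) = 4 * g w" for w using g(2)[of w w] g0 by simp
    have uu: "u + u = x" "v + v = y" by (simp_all add: u_def v_def flip: scaleR_2)
    have gu: "4 * g u = g x" and gv: "4 * g v = g y" using dbl[of u] dbl[of v] uu by simp_all
    have "u + v \<in> C \<Psi> \<eta>"
      unfolding C_def
    proof (intro CollectI conjI ballI)
      have "norm u \<le> 1 / 2" "norm v \<le> 1 / 2" using x(1) yC(1) by (auto simp: C_def u_def v_def)
      then show "norm (u + v) \<le> 1" using norm_triangle_ineq[of u v] by simp
    next
      fix \<theta> assume \<theta>: "\<theta> \<in> \<Psi>"
      then have "\<theta> \<in> dual_unit_ball" using i(1) by (auto simp: I_def)
      note \<theta>s = dual_unit_ball_simps[OF this]
      have "\<theta> (T (u + v)) - \<Phi> \<theta> = (1 / 2) *\<^sub>R (\<theta> (T x) - \<Phi> \<theta>) + (1 / 2) *\<^sub>R (\<theta> (T y) - \<Phi> \<theta>)"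
        by (simp add: u_def v_def Tadd TscaleR \<theta>s scaleR_conv_of_real algebra_simps flip: distrib_left)
      moreover have "cmod (\<theta> (T x) - \<Phi> \<theta>) \<le> \<eta>" "cmod (\<theta> (T y) - \<Phi> \<theta>) \<le> \<eta>"
        using x(1) yC(1) \<theta> by (auto simp: C_def)
      ultimately show "cmod (\<theta> (T (u + v)) - \<Phi> \<theta>) \<le> \<eta>"
        using norm_triangle_ineq[of "(1 / 2) *\<^sub>R (\<theta> (T x) - \<Phi> \<theta>)" "(1 / 2) *\<^sub>R (\<theta> (T y) - \<Phi> \<theta>)"] by simp
    qed
    then have "d - e / 2 < g (u + v)" using i(2) m_le by fastforce
    \<comment> \<open>Here \<open>g (u - v) = (g x + g y) / 2 - g (u + v)\<close>, below
      \<open>(d + e / 2) - (d - e / 2)\<close>. The majorant then gives \<open>2 * e\<close>, and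
      undoing the halving \<open>4 * e\<close>.\<close>
    then have "g (u - v) \<le> e" using g(2)[of u v] gu gv x(2) y(2) by linarith
    moreover have "norm (u - v) \<le> 1"
      using x(1) yC(1) norm_triangle_ineq4[of u v] by (auto simp: C_def u_def v_def)
    ultimately have "norm (T (u - v)) \<le> 2 * e" using g(4)[of "u - v"] by linarith
    moreover have "T (u - v) = (1 / 2) *\<^sub>R (T x - T y)"
      by (simp add: u_def v_def Tdiff TscaleR scaleR_diff_right)
    ultimately have "norm (T x - T y) \<le> 4 * e" by simp
    then have "cmod (\<psi> (T x) - \<psi> (T y)) \<le> 4 * e"
      using dual_unit_ball_simps(2,5)[OF \<psi>] by (metis order_trans)
    then show "cmod (\<psi> (T x) - \<Phi> \<psi>) \<le> 4 * e + \<delta>"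
      using yC(2) norm_triangle_ineq[of "\<psi> (T x) - \<psi> (T y)" "\<psi> (T y) - \<Phi> \<psi>"] by simp
  qed
  then show ?thesis by blast
qed

lemma norm_le_if_dual_unit_ball:
  assumes "\<And>\<psi>. \<psi> \<in> dual_unit_ball \<Longrightarrow> cmod (\<psi> z) \<le> M"
  shows "norm z \<le> M"
proof -
  obtain \<psi> where "\<psi> \<in> dual_unit_ball" "\<psi> z = of_real (norm z)" by (rule norming_functional)
  then show ?thesis using assms[of \<psi>] by simp
qed

text \<open>A Banach space is norm closed in its bidual: approximants uniform on the dual ball form
  a Cauchy sequence.\<close>

lemma approximable_functional_representable:
  fixes \<Phi> :: "('b::complex_banach \<Rightarrow> complex) \<Rightarrow> complex"
  assumes "\<And>e. 0 < e \<Longrightarrow> \<exists>z. \<forall>\<psi>\<in>dual_unit_ball. cmod (\<psi> z - \<Phi> \<psi>) \<le> e"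
  obtains y where "\<And>\<psi>. \<psi> \<in> dual_unit_ball \<Longrightarrow> \<psi> y = \<Phi> \<psi>"
proof -
  obtain z where z: "\<And>n \<psi>. \<psi> \<in> dual_unit_ball \<Longrightarrow> cmod (\<psi> (z n) - \<Phi> \<psi>) \<le> inverse (real (Suc n))"
    using assms[of "inverse (real (Suc n))" for n] by (metis inverse_positive_iff_positive of_nat_0_less_iff zero_less_Suc)
  have zz: "norm (z n - z k) \<le> inverse (real (Suc n)) + inverse (real (Suc k))" for n k
  proof (rule norm_le_if_dual_unit_ball)
    fix \<psi> :: "'b \<Rightarrow> complex" assume \<psi>: "\<psi> \<in> dual_unit_ball"
    show "cmod (\<psi> (z n - z k)) \<le> inverse (real (Suc n)) + inverse (real (Suc k))"
      using norm_triangle_ineq4[of "\<psi> (z n) - \<Phi> \<psi>" "\<psi> (z k) - \<Phi> \<psi>"] z[OF \<psi>, of n] z[OF \<psi>, of k]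
      by (simp add: dual_unit_ball_simps[OF \<psi>])
  qed
  have "Cauchy z"
  proof (rule CauchyI)
    fix e :: real assume "0 < e"
    then obtain N where N: "inverse (real (Suc N)) < e / 2" using reals_Archimedean[of "e / 2"] by auto
    have "norm (z n - z k) < e" if "N \<le> n" "N \<le> k" for n k
    proof -
      have "inverse (real (Suc n)) \<le> inverse (real (Suc N))" "inverse (real (Suc k)) \<le> inverse (real (Suc N))"
        using that by (auto intro: le_imp_inverse_le)
      then show ?thesis using zz[of n k] N by linarith
    qed
    then show "\<exists>N. \<forall>n\<ge>N. \<forall>k\<ge>N. norm (z n - z k) < e" by blast
  qed
  then obtain y where y: "z \<longlonglongrightarrow> y" by (auto simp: Cauchy_convergent_iff convergent_def)
  have "\<psi> y = \<Phi> \<psi>" if \<psi>: "\<psi> \<in> dual_unit_ball" for \<psi>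
  proof (rule LIMSEQ_unique)
    have "bounded_linear \<psi>" using \<psi> by (simp add: dual_unit_ball_def dual_space_def)
    then show "(\<lambda>n. \<psi> (z n)) \<longlonglongrightarrow> \<psi> y" using y by (rule bounded_linear.tendsto)
    have "(\<lambda>n. \<psi> (z n) - \<Phi> \<psi>) \<longlonglongrightarrow> 0"
      by (rule tendsto_norm_zero_cancel, rule tendsto_sandwich[OF _ _ tendsto_const LIMSEQ_inverse_real_of_nat])
        (use z[OF \<psi>] in auto)
    then show "(\<lambda>n. \<psi> (z n)) \<longlonglongrightarrow> \<Phi> \<psi>" by (simp add: LIM_zero_cancel)
  qed
  then show ?thesis using that by blast
qed

lemma dual_space_scale_to_ball:
  assumes "\<phi> \<in> dual_space"
  obtains t \<psi> where "\<psi> \<in> dual_unit_ball" "\<And>x. \<phi> x = t * \<psi> x"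
proof -
  obtain C where C: "0 \<le> C" "\<And>x. cmod (\<phi> x) \<le> C * norm x" using dual_space_bounded[OF assms] by blast
  have lin: "\<And>x y. \<phi> (x + y) = \<phi> x + \<phi> y" "\<And>a x. \<phi> (a *\<^sub>C x) = a * \<phi> x"
    using assms by (auto simp: dual_space_def clinear_iff scaleC_complex_def)
  define t where "t = complex_of_real (C + 1)"
  have t: "t \<noteq> 0" "cmod t = C + 1" using C(1) by (auto simp: t_def simp del: of_real_add)
  have "cmod (\<phi> x / t) \<le> norm x" for x
  proof -
    have "cmod (\<phi> x) \<le> (C + 1) * norm x" using C(2)[of x] norm_ge_zero[of x] unfolding distrib_right by linarith
    then show ?thesis using C(1) t by (simp add: norm_divide field_simps)
  qed
  then have "(\<lambda>x. \<phi> x / t) \<in> dual_unit_ball"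
    by (auto simp: mem_dual_unit_ball_iff clinear_iff scaleC_complex_def lin add_divide_distrib)
  then show ?thesis using that[of "\<lambda>x. \<phi> x / t" t] t by simp
qed

text \<open>An ultrafilter on the weak closure first has a limit \<open>\<Phi>\<close> on the dual
  ball only, a point of the bidual; the majorants for all \<open>e\<close> show that it comes from a
  vector.\<close>

theorem weakly_compact_if_quadratic_majorants:
  fixes T :: "'a::complex_normed_vector \<Rightarrow> 'b::complex_banach"
  assumes T: "clinear T" and K: "\<And>x. norm (T x) \<le> K * norm x"
    and maj: "\<And>e. 0 < e \<Longrightarrow> \<exists>g M. (\<forall>x. 0 \<le> g x) \<and> (\<forall>x y. g (x + y) + g (x - y) = 2 * g x + 2 * (g y :: real)) \<and>
      (\<forall>x. norm x \<le> 1 \<longrightarrow> g x \<le> M \<and> norm (T x) \<le> g x + e)"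
  shows "weakly_compact_operator T"
proof -
  define Q where "Q = weak_topology closure_of (T ` cball 0 1)"
  have TK: "norm (T x) \<le> \<bar>K\<bar>" if "norm x \<le> 1" for x
    using K[of x] that mult_mono[of K "\<bar>K\<bar>" "norm x" 1] by (simp add: abs_ge_self)
  have QK: "cmod (\<psi> z) \<le> \<bar>K\<bar>" if z: "z \<in> Q" and \<psi>: "\<psi> \<in> dual_unit_ball" for z \<psi>
  proof -
    have "T ` cball 0 1 \<subseteq> \<psi> -` cball 0 \<bar>K\<bar>"
      using order_trans[OF dual_unit_ball_simps(5)[OF \<psi>] TK] by auto
    then have "Q \<subseteq> \<psi> -` cball 0 \<bar>K\<bar>"
      unfolding Q_def by (rule closure_of_minimal) (simp add: closedin_weak_topology_vimage dual_unit_ball_subset[OF \<psi>])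
    then show ?thesis using z by auto
  qed
  have "\<exists>y. \<forall>\<phi>\<in>dual_space. (\<phi> \<longlongrightarrow> \<phi> y) U" if U: "ultra U" and ev: "eventually (\<lambda>z. z \<in> Q) U" for U
  proof -
    define \<Phi> where "\<Phi> \<psi> = Lim U \<psi>" for \<psi> :: "'b \<Rightarrow> complex"
    have \<Phi>: "(\<psi> \<longlongrightarrow> \<Phi> \<psi>) U" if "\<psi> \<in> dual_unit_ball" for \<psi>
      unfolding \<Phi>_def by (rule ultra_Lim[OF U, of _ "\<bar>K\<bar>"]) (use ev QK that in \<open>auto elim: eventually_mono\<close>)
    \<comment> \<open>Weak neighbourhoods of points of the closure meet the image of the ball, so
      finitely many values of \<open>\<Phi>\<close> are approximated there simultaneously.\<close>
    have ne: "\<exists>x. norm x \<le> 1 \<and> (\<forall>\<psi>\<in>\<Psi>. cmod (\<psi> (T x) - \<Phi> \<psi>) \<le> \<eta>)"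
      if \<Psi>: "finite \<Psi>" "\<Psi> \<subseteq> dual_unit_ball" and \<eta>: "0 < \<eta>" for \<Psi> \<eta>
    proof -
      have "eventually (\<lambda>z. \<psi> z \<in> ball (\<Phi> \<psi>) \<eta>) U" if "\<psi> \<in> \<Psi>" for \<psi>
        using \<Phi>[of \<psi>] that \<Psi> \<eta> by (intro topological_tendstoD) auto
      then have "eventually (\<lambda>z. \<forall>\<psi>\<in>\<Psi>. \<psi> z \<in> ball (\<Phi> \<psi>) \<eta>) U" using \<Psi>(1) by (simp add: eventually_ball_finite)
      with ev have "eventually (\<lambda>z. z \<in> Q \<and> (\<forall>\<psi>\<in>\<Psi>. \<psi> z \<in> ball (\<Phi> \<psi>) \<eta>)) U" by (rule eventually_conj)
      then obtain z where z: "z \<in> Q" "\<And>\<psi>. \<psi> \<in> \<Psi> \<Longrightarrow> \<psi> z \<in> ball (\<Phi> \<psi>) \<eta>"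
        using eventually_happens ultra_not_bot[OF U] by blast
      define W where "W = (\<Inter>\<psi>\<in>\<Psi>. \<psi> -` ball (\<Phi> \<psi>) \<eta>)"
      have "openin weak_topology (W \<inter> topspace weak_topology)"
        unfolding W_def
      proof (rule openin_INT[OF \<Psi>(1)])
        show "openin weak_topology (\<psi> -` ball (\<Phi> \<psi>) \<eta>)" if "\<psi> \<in> \<Psi>" for \<psi>
          using that \<Psi>(2) by (intro openin_weak_topology_vimage dual_unit_ball_subset) auto
      qed
      then have "openin weak_topology W" by simp
      moreover have "z \<in> W" using z(2) by (simp add: W_def)
      ultimately obtain y where y: "y \<in> T ` cball 0 1" "y \<in> W"
        using z(1) unfolding Q_def in_closure_of by meson
      then obtain x where x: "norm x \<le> 1" "y = T x" by auto
      have "cmod (\<psi> (T x) - \<Phi> \<psi>) \<le> \<eta>" if "\<psi> \<in> \<Psi>" for \<psi>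
      proof -
        have "dist (\<Phi> \<psi>) (\<psi> y) < \<eta>" using y(2) that by (simp add: W_def)
        then show ?thesis by (simp add: x(2) dist_norm norm_minus_commute)
      qed
      then show ?thesis using x(1) by blast
    qed
    have "\<exists>z. \<forall>\<psi>\<in>dual_unit_ball. cmod (\<psi> z - \<Phi> \<psi>) \<le> e" if "0 < e" for e
    proof -
      \<comment> \<open>\<open>near_minimiser\<close> multiplies the error by four.\<close>
      have "0 < e / 4" using that by simp
      then obtain g M where "\<And>x. 0 \<le> g x" "\<And>x y. g (x + y) + g (x - y) = 2 * g x + 2 * (g y :: real)"
        "\<And>x. norm x \<le> 1 \<Longrightarrow> g x \<le> M" "\<And>x. norm x \<le> 1 \<Longrightarrow> norm (T x) \<le> g x + e / 4"
        using maj[of "e / 4"] by blast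
      from near_minimiser[OF T this \<open>0 < e / 4\<close> ne] show ?thesis by simp
    qed
    then obtain y where y: "\<And>\<psi>. \<psi> \<in> dual_unit_ball \<Longrightarrow> \<psi> y = \<Phi> \<psi>"
      using approximable_functional_representable by blast
    have "(\<phi> \<longlongrightarrow> \<phi> y) U" if \<phi>: "\<phi> \<in> dual_space" for \<phi>
    proof -
      obtain t \<psi> where "\<psi> \<in> dual_unit_ball" "\<And>x. \<phi> x = t * \<psi> x" by (rule dual_space_scale_to_ball[OF \<phi>]) blast
      then have "\<phi> = (\<lambda>x. t * \<psi> x)" "(\<psi> \<longlongrightarrow> \<psi> y) U" using \<Phi>[of \<psi>] y[of \<psi>] by auto
      then show ?thesis by (simp add: tendsto_mult_left)
    qed
    then show ?thesis by blast
  qed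
  then have "compactin weak_topology Q"
    by (intro compactin_weak_if_ultra_tendsto) (auto simp: Q_def)
  then show ?thesis by (simp add: weakly_compact_operator_def Q_def)
qed

subsection \<open>Almost disjoint functions\<close>

context linf_operator
begin

lemma dual_unit_ball_R_sum:
  fixes n :: nat
  assumes "\<psi> \<in> dual_unit_ball"
  shows "\<psi> (R X (\<lambda>i. \<Sum>k<n. a k * f k i)) = (\<Sum>k<n. a k * \<psi> (R X (f k)))"
proof (induction n)
  case 0
  have "R X (\<lambda>_. 0) = 0" using R_scale[of X 0 "\<lambda>_. 0"] by simp
  then show ?case using dual_unit_ball_simps(3)[OF assms, of 0 0] by simp
next
  case (Suc n)
  then show ?case by (simp add: R_add R_scale dual_unit_ball_simps[OF assms])
qed

text \<open>Where several \<open>x k\<close> are large, only the last is kept: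
  \<open>\<phi> k\<close> is small on later functions, so it hardly notices what \<open>x k\<close>
  loses to them. Disjointness then gives the weak bound through \<open>R_bound\<close>.\<close>

lemma almost_disjoint_vectors:
  fixes n :: nat
  assumes e: "0 < e" and nc: "\<not> controlled {lim_functional \<psi> |\<psi>. \<forall>X. \<psi> X \<in> dual_unit_ball} e"
  shows "\<exists>x. (\<forall>\<psi>\<in>dual_unit_ball. (\<Sum>k<n. cmod (\<psi> (x k))) \<le> c) \<and> (\<forall>k<n. e / 4 \<le> norm (T (x k)))"
proof -
  let ?C = "K * c"
  have C: "0 < ?C" using K c by simp
  \<comment> \<open>The part of \<open>x k\<close> below the level \<open>h\<close> costs
    \<open>?C * h = e / 4\<close>; what is removed in favour of later functions costs at most
    \<open>n\<close> times \<open>\<eta> / h\<close>, again at most \<open>e / 4\<close>.\<close>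
  define h where "h = e / (4 * ?C)"
  have h: "0 < h" using e C by (simp add: h_def)
  define \<eta> where "\<eta> = e * h / (4 * (real n + 1))"
  have \<eta>: "0 < \<eta>" using e h by (simp add: \<eta>_def)
  define \<F> where "\<F> = {lim_functional \<psi> |\<psi>. \<forall>X. \<psi> X \<in> dual_unit_ball}"
  have bf: "bfunctional ?C \<phi>" if "\<phi> \<in> \<F>" for \<phi>
    using that bfunctional_lim_functional unfolding \<F>_def by blast
  have "\<exists>x \<phi>. (\<forall>(k::nat) i. cmod (x k i) \<le> 1) \<and> (\<forall>k. \<phi> k \<in> \<F>) \<and> (\<forall>k. e < cmod (\<phi> k (x k))) \<and>
      (\<forall>j k. j < k \<longrightarrow> variation (\<phi> j) (\<lambda>i. cmod (x k i)) \<le> \<eta>)"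
    by (rule not_controlled_sequence[OF bf nc[folded \<F>_def] \<eta> e])
  then obtain x \<phi> where x: "\<And>(k::nat) i. cmod (x k i) \<le> 1" and \<phi>\<F>: "\<And>k. \<phi> k \<in> \<F>"
    and \<phi>x: "\<And>k. e < cmod (\<phi> k (x k))"
    and small: "\<And>j k. j < k \<Longrightarrow> variation (\<phi> j) (\<lambda>i. cmod (x k i)) \<le> \<eta>"
    by blast
  have "\<exists>\<psi>. \<phi> k = lim_functional \<psi> \<and> (\<forall>X. \<psi> X \<in> dual_unit_ball)" for k
    using \<phi>\<F>[of k] unfolding \<F>_def by blast
  then obtain \<psi> where \<phi>: "\<And>k. \<phi> k = lim_functional (\<psi> k)" and \<psi>: "\<And>k X. \<psi> k X \<in> dual_unit_ball"
    by metis
  have b: "bfunctional ?C (\<phi> k)" for k unfolding \<phi> using \<psi> by (rule bfunctional_lim_functional)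
  define f where "f k i = (if h \<le> cmod (x k i) \<and> (\<forall>j. k < j \<and> j < n \<longrightarrow> cmod (x j i) < h) then x k i else 0)" for k i
  have f1: "cmod (f k i) \<le> 1" for k i using x by (simp add: f_def)
  have sum_f: "(\<Sum>k<n. cmod (f k i)) \<le> 1" for i
  proof (cases "\<exists>k<n. f k i \<noteq> 0")
    case True
    then obtain k where k: "k < n" "f k i \<noteq> 0" by blast
    have "f j i = 0" if "j < n" "j \<noteq> k" for j
    proof (cases "j < k")
      case True
      then show ?thesis using k by (auto simp: f_def split: if_splits)
    next
      case False
      then have "cmod (x j i) < h" using k that by (simp add: f_def split: if_splits)
      then show ?thesis by (simp add: f_def)
    qed
    then have "(\<Sum>k<n. cmod (f k i)) = (\<Sum>j\<in>{k}. cmod (f j i))"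
      using k by (intro sum.mono_neutral_right) auto
    then show ?thesis using f1 by simp
  qed simp
  have \<phi>f: "e / 4 < cmod (\<phi> k (f k))" for k
  proof -
    have bx: "bounded_fun (x k)" "bounded_fun (f k)" using x f1 by (auto intro: bounded_funI[of _ 1])
    \<comment> \<open>As in Markov's inequality, the indicator of the set where \<open>x j\<close>
      reaches the level \<open>h\<close> is at most \<open>|x j| / h\<close>, whose variation is
      small.\<close>
    let ?w = "\<lambda>i. \<Sum>j\<in>{k<..<n}. inverse h * cmod (x j i)"
    have term_le: "inverse h * cmod (x j i) \<le> inverse h * 1" for j i
      using x h by (intro mult_left_mono) auto
    have w: "0 \<le> ?w i" "?w i \<le> real (card {k<..<n}) * (inverse h * 1)" for i
    proof -
      show "0 \<le> ?w i" using h by (intro sum_nonneg) auto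
      show "?w i \<le> real (card {k<..<n}) * (inverse h * 1)" by (rule sum_bounded_above) (rule term_le)
    qed
    have le: "cmod (x k i - f k i) \<le> h + ?w i" for i
    proof (cases "\<exists>j. k < j \<and> j < n \<and> h \<le> cmod (x j i)")
      case True
      then obtain j where j: "j \<in> {k<..<n}" "h \<le> cmod (x j i)" by auto
      have "1 \<le> inverse h * cmod (x j i)" using j(2) h by (simp add: field_simps)
      also have "\<dots> \<le> ?w i" using j(1) h by (intro member_le_sum) auto
      finally have "1 \<le> ?w i" .
      moreover have "cmod (x k i - f k i) \<le> 1" using x by (simp add: f_def)
      ultimately show ?thesis using h by linarith
    next
      case False
      then have "cmod (x k i - f k i) \<le> h" using h by (auto simp: f_def not_le)
      then show ?thesis using w(1)[of i] by linarith
    qed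
    have "cmod (\<phi> k (x k) - \<phi> k (f k)) = cmod (\<phi> k (\<lambda>i. x k i - f k i))"
      using bfunctional_diff[OF b bx] by simp
    also have "\<dots> \<le> variation (\<phi> k) (\<lambda>i. h + ?w i)"
      using le w(2) by (intro variation_upper[OF b, of _ _ "h + real (card {k<..<n}) * (inverse h * 1)"]) auto
    also have "\<dots> = variation (\<phi> k) (\<lambda>i. h) + variation (\<phi> k) ?w"
      using h w by (intro variation_add[OF b, of _ h]) auto
    also have "variation (\<phi> k) ?w = (\<Sum>j\<in>{k<..<n}. variation (\<phi> k) (\<lambda>i. inverse h * cmod (x j i)))"
      using h term_le by (intro variation_sum[OF b, of _ _ "inverse h * 1"]) auto
    also have "\<dots> \<le> (\<Sum>j\<in>{k<..<n}. inverse h * \<eta>)"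
    proof (rule sum_mono)
      fix j assume j: "j \<in> {k<..<n}"
      have "variation (\<phi> k) (\<lambda>i. inverse h * cmod (x j i)) \<le> inverse h * variation (\<phi> k) (\<lambda>i. cmod (x j i))"
        using x h by (intro variation_scale_le[OF b, of _ 1]) auto
      also have "\<dots> \<le> inverse h * \<eta>" using small j h by (intro mult_left_mono) auto
      finally show "variation (\<phi> k) (\<lambda>i. inverse h * cmod (x j i)) \<le> inverse h * \<eta>" .
    qed
    also have "\<dots> \<le> real n * (inverse h * \<eta>)"
      using h \<eta> by (simp add: mult_right_mono)
    also have "\<dots> \<le> e / 4" using e h by (simp add: \<eta>_def field_simps)
    also have "variation (\<phi> k) (\<lambda>i. h) \<le> ?C * h" using h by (intro variation_bound[OF b]) auto
    also have "?C * h = e / 4" using K c by (simp add: h_def)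
    finally have "cmod (\<phi> k (x k) - \<phi> k (f k)) \<le> e / 4 + e / 4" by simp
    then show ?thesis using \<phi>x[of k] norm_triangle_ineq2[of "\<phi> k (x k)" "\<phi> k (f k)"] e by linarith
  qed
  \<comment> \<open>Finitely many strict bounds on limits hold at one common \<open>X\<close>, which
    replaces the limits by actual vectors.\<close>
  have "eventually (\<lambda>X. e / 4 < cmod (\<psi> k X (T (R X (f k))))) U" for k
  proof (rule order_tendstoD(1)[OF tendsto_norm])
    show "((\<lambda>X. \<psi> k X (T (R X (f k)))) \<longlongrightarrow> \<phi> k (f k)) U"
      unfolding \<phi> using f1 \<psi> by (intro lim_functional_tendsto bounded_funI[of _ 1])
  qed (rule \<phi>f)
  then have "eventually (\<lambda>X. \<forall>k\<in>{..<n}. e / 4 < cmod (\<psi> k X (T (R X (f k))))) U"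
    by (intro eventually_ball_finite) auto
  then obtain X where X: "\<And>k. k < n \<Longrightarrow> e / 4 < cmod (\<psi> k X (T (R X (f k))))"
    using eventually_happens ultra_not_bot[OF U(1)] by fastforce
  have "(\<Sum>k<n. cmod (\<theta> (R X (f k)))) \<le> c" if \<theta>: "\<theta> \<in> dual_unit_ball" for \<theta>
  proof -
    \<comment> \<open>Phases turn the sum of moduli into the value at a single combination, which is
      bounded by one because the supports are disjoint.\<close>
    define a where "a k = (if \<theta> (R X (f k)) = 0 then 0 else cnj (\<theta> (R X (f k))) / cmod (\<theta> (R X (f k))))" for k
    have a1: "cmod (a k) \<le> 1" for k by (simp add: a_def norm_divide)
    have a: "a k * \<theta> (R X (f k)) = of_real (cmod (\<theta> (R X (f k))))" for k
      by (simp add: a_def complex_norm_square[symmetric] power2_eq_square mult.commute)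
    have "(\<Sum>k<n. cmod (\<theta> (R X (f k)))) = cmod (of_real (\<Sum>k<n. cmod (\<theta> (R X (f k)))))"
      by (simp only: norm_of_real abs_of_nonneg[OF sum_nonneg] norm_ge_zero)
    also have "\<dots> = cmod (\<theta> (R X (\<lambda>i. \<Sum>k<n. a k * f k i)))"
      unfolding dual_unit_ball_R_sum[OF \<theta>] a by simp
    also have "\<dots> \<le> norm (R X (\<lambda>i. \<Sum>k<n. a k * f k i))" by (rule dual_unit_ball_simps(5)[OF \<theta>])
    also have "\<dots> \<le> c * 1"
    proof (rule R_bound)
      fix i
      have "cmod (\<Sum>k<n. a k * f k i) \<le> (\<Sum>k<n. cmod (f k i))"
        by (rule sum_norm_le) (simp add: norm_mult mult_left_le_one_le a1)
      then show "cmod (\<Sum>k<n. a k * f k i) \<le> 1" using sum_f[of i] by linarith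
    qed
    finally show ?thesis by simp
  qed
  moreover have "e / 4 \<le> norm (T (R X (f k)))" if "k < n" for k
    using X[OF that] dual_unit_ball_simps(5)[OF \<psi>, of k X "T (R X (f k))"] by linarith
  ultimately show ?thesis by (intro exI[of _ "\<lambda>k. R X (f k)"]) blast
qed

end

subsection \<open>Weakly compact operators are controlled\<close>

text \<open>Functionals are bounded on the weakly compact closure, hence continuous after
  composition with \<open>T\<close>. So the sets where \<open>norm (T x)\<close> is at most
  \<open>n\<close> are closed, and Baire's theorem finds a ball in one of them.\<close>

lemma weakly_compact_operator_bounded:
  fixes T :: "'a::complex_banach \<Rightarrow> 'b::complex_banach"
  assumes T: "clinear T" and wc: "weakly_compact_operator T"
  obtains K where "0 < K" "\<And>x. norm (T x) \<le> K * norm x"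
proof -
  have Tadd: "T (x + y) = T x + T y" and Tscale: "T (a *\<^sub>C x) = a *\<^sub>C T x" for x y a
    using T by (auto simp: clinear_iff)
  have TscaleR: "T (r *\<^sub>R x) = r *\<^sub>R T x" for r x by (simp add: scaleR_scaleC Tscale)
  have Tdiff: "T (x - y) = T x - T y" for x y using Tadd[of "x - y" y] by simp
  have cont: "continuous_on UNIV (\<lambda>x. \<psi> (T x))" if \<psi>: "\<psi> \<in> dual_unit_ball" for \<psi>
  proof -
    note s = dual_unit_ball_simps[OF \<psi>]
    have "continuous_map weak_topology euclidean \<psi>"
      unfolding continuous_map_def
      using openin_weak_topology_vimage[OF dual_unit_ball_subset[OF \<psi>]] by (auto simp: vimage_def)
    with wc have "compactin euclidean (\<psi> ` (weak_topology closure_of (T ` cball 0 1)))"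
      unfolding weakly_compact_operator_def by (rule image_compactin)
    then have "bounded (\<psi> ` (weak_topology closure_of (T ` cball 0 1)))" by (simp add: compact_imp_bounded)
    moreover have "T ` cball 0 1 \<subseteq> weak_topology closure_of (T ` cball 0 1)" by (simp add: closure_of_subset)
    ultimately have "bounded (\<psi> ` T ` cball 0 1)" by (meson bounded_subset image_mono)
    then obtain M where "\<forall>x\<in>cball 0 1. cmod (\<psi> (T x)) \<le> M" by (auto simp: bounded_iff)
    then have M: "cmod (\<psi> (T x)) \<le> M" if "norm x \<le> 1" for x using that by simp
    have "bounded_linear (\<lambda>x. \<psi> (T x))"
    proof (rule bounded_linear_intro[of _ M])
      show "norm (\<psi> (T x)) \<le> norm x * M" for x
      proof (cases "x = 0")
        case True
        then show ?thesis using TscaleR[of 0 0] s(4)[of 0 0] by simp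
      next
        case False
        have "cmod (\<psi> (T (inverse (norm x) *\<^sub>R x))) \<le> M" using False by (intro M) simp
        then have "inverse (norm x) * cmod (\<psi> (T x)) \<le> M"
          by (simp only: TscaleR s norm_mult norm_of_real abs_of_nonneg inverse_nonnegative_iff_nonnegative norm_ge_zero)
        then show ?thesis using False by (simp add: field_simps)
      qed
    qed (simp_all add: Tadd TscaleR s scaleR_conv_of_real)
    then show ?thesis by (intro linear_continuous_on)
  qed
  define S where "S n = {x. norm (T x) \<le> real n}" for n
  have "closed (S n)" for n
  proof -
    have "S n = (\<Inter>\<psi>\<in>dual_unit_ball. {x. cmod (\<psi> (T x)) \<le> real n})"
      unfolding S_def by (auto intro: norm_le_if_dual_unit_ball order_trans[OF dual_unit_ball_simps(5)])
    moreover have "closed {x. cmod (\<psi> (T x)) \<le> real n}" if "\<psi> \<in> dual_unit_ball" for \<psi>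
      by (intro closed_Collect_le continuous_on_norm cont that continuous_on_const)
    ultimately show ?thesis by (simp add: closed_INT)
  qed
  moreover have "\<Union> (range S) = UNIV" unfolding S_def by (auto intro: real_arch_simple)
  ultimately have "\<exists>n. interior (S n) \<noteq> {}"
    using Baire_category_alt[of "euclidean :: 'a topology" "range S"] completely_metrizable_space_euclidean
    by auto
  then obtain n x0 r where r: "0 < r" "ball x0 r \<subseteq> S n" by (auto simp: mem_interior)
  have small: "norm (T x) \<le> 2 * real n" if "norm x < r" for x
  proof -
    have "x0 \<in> S n" "x0 + x \<in> S n" using r that by (auto simp: dist_norm)
    then show ?thesis using norm_triangle_ineq4[of "T (x0 + x)" "T x0"] by (simp add: S_def Tadd)
  qed
  define K where "K = 4 * real n / r + 1"
  have "norm (T x) \<le> K * norm x" for x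
  proof (cases "x = 0")
    case True
    then show ?thesis using TscaleR[of 0 0] by simp
  next
    case False
    define t where "t = r / (2 * norm x)"
    have t: "0 < t" using r False by (simp add: t_def)
    have "norm (T (t *\<^sub>R x)) \<le> 2 * real n" using r False by (intro small) (simp add: t_def)
    then have "t * norm (T x) \<le> 2 * real n" using t by (simp add: TscaleR)
    then have "norm (T x) \<le> 4 * real n / r * norm x" using r False by (simp add: t_def field_simps)
    then show ?thesis unfolding K_def distrib_right using norm_ge_zero[of x] by linarith
  qed
  moreover have "0 < K" using r by (simp add: K_def add_nonneg_pos)
  ultimately show ?thesis using that by blast
qed

text \<open>Weak-star compactness of the dual ball (Banach-Alaoglu), with limits taken pointwise
  along \<open>D\<close>.\<close>

lemma ultra_Lim_dual_unit_ball:
  assumes D: "ultra D" and \<psi>: "\<And>n. \<psi> n \<in> dual_unit_ball"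
  shows "(\<lambda>z. Lim D (\<lambda>n. \<psi> n z)) \<in> dual_unit_ball"
    and "((\<lambda>n. \<psi> n z) \<longlongrightarrow> Lim D (\<lambda>n. \<psi> n z)) D"
proof -
  show lim: "((\<lambda>n. \<psi> n z) \<longlongrightarrow> Lim D (\<lambda>n. \<psi> n z)) D" for z
    by (rule ultra_Lim[OF D, of _ "norm z"]) (simp add: dual_unit_ball_simps(5)[OF \<psi>])
  note nb = ultra_not_bot[OF D]
  have "Lim D (\<lambda>n. \<psi> n (y + z)) = Lim D (\<lambda>n. \<psi> n y) + Lim D (\<lambda>n. \<psi> n z)" for y z
    using tendsto_add[OF lim lim, of y z] by (intro tendsto_Lim nb) (simp add: dual_unit_ball_simps[OF \<psi>])
  moreover have "Lim D (\<lambda>n. \<psi> n (a *\<^sub>C z)) = a * Lim D (\<lambda>n. \<psi> n z)" for a z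
    using tendsto_mult_left[OF lim, of a z] by (intro tendsto_Lim nb) (simp add: dual_unit_ball_simps[OF \<psi>])
  moreover have "cmod (Lim D (\<lambda>n. \<psi> n z)) \<le> norm z" for z
    by (rule tendsto_upperbound[OF tendsto_norm[OF lim] _ nb]) (simp add: dual_unit_ball_simps(5)[OF \<psi>])
  ultimately show "(\<lambda>z. Lim D (\<lambda>n. \<psi> n z)) \<in> dual_unit_ball"
    by (simp add: mem_dual_unit_ball_iff clinear_iff scaleC_complex_def)
qed

text \<open>The limit \<open>\<Psi>\<close> of the \<open>\<psi> k\<close> stays within \<open>d\<close> of \<open>\<Lambda>\<close> on every \<open>v m\<close> (up to the factor \<open>c\<close>), hence at
  the weak limit \<open>y\<close>. But \<open>\<psi> k y\<close> is close to \<open>\<psi> k (v k)\<close>, which is far from \<open>\<Lambda> (v (k - 1))\<close>, and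
  letting \<open>k\<close> tend to infinity separates \<open>\<Psi> y\<close> from \<open>\<Lambda> y\<close>.\<close>

lemma double_limit_contradiction:
  fixes v :: "nat \<Rightarrow> 'b::complex_normed_vector" and \<Lambda> :: "'b \<Rightarrow> complex"
  assumes D: "ultra D" "D \<le> sequentially" and c: "0 < c" and d: "0 < d"
    and \<psi>: "\<And>k::nat. \<psi> k \<in> dual_unit_ball" and \<Lambda>: "\<Lambda> \<in> dual_unit_ball"
    and y: "\<And>\<phi>. \<phi> \<in> dual_unit_ball \<Longrightarrow> ((\<lambda>m. \<phi> (v (m - 1))) \<longlongrightarrow> \<phi> y) D"
    and jump: "\<And>k. 8 * d < c * cmod (\<psi> (Suc k) (v (Suc k)) - \<psi> (Suc k) (v k))"
    and below: "\<And>k m. m < k \<Longrightarrow> c * cmod (\<psi> k (v m) - \<Lambda> (v m)) \<le> d"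
    and above: "\<And>k m. k \<le> m \<Longrightarrow> c * cmod (\<psi> k (v m) - \<psi> k (v k)) \<le> d"
  shows False
proof -
  note nb = ultra_not_bot[OF D(1)]
  define \<Psi> where "\<Psi> z = Lim D (\<lambda>k. \<psi> k z)" for z
  have \<Psi>: "\<Psi> \<in> dual_unit_ball" "\<And>z. ((\<lambda>k. \<psi> k z) \<longlongrightarrow> \<Psi> z) D"
    using ultra_Lim_dual_unit_ball[OF D(1), of \<psi>] \<psi> unfolding \<Psi>_def[abs_def] by auto
  have ev_ge: "eventually (\<lambda>m. n \<le> m) D" for n
    using D(2) eventually_ge_at_top[of n] by (auto simp: le_filter_def)
  have yk: "c * cmod (\<psi> k y - \<psi> k (v k)) \<le> d" for k
  proof (rule tendsto_upperbound[OF _ _ nb])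
    show "((\<lambda>m. c * cmod (\<psi> k (v (m - 1)) - \<psi> k (v k))) \<longlongrightarrow> c * cmod (\<psi> k y - \<psi> k (v k))) D"
      by (intro tendsto_intros y \<psi>)
    show "eventually (\<lambda>m. c * cmod (\<psi> k (v (m - 1)) - \<psi> k (v k)) \<le> d) D"
      using ev_ge[of "Suc k"] by eventually_elim (rule above, simp)
  qed
  \<comment> \<open>The shift compares \<open>\<psi> k\<close> with the predecessor of its own
    vector, so that one limit in \<open>k\<close> reaches both \<open>\<Psi> y\<close> and
    \<open>\<Lambda> y\<close>. Of the jump \<open>8 * d\<close>, one \<open>d\<close> goes to
    \<open>yk\<close> and one to \<open>below\<close>.\<close>
  have far: "6 * d \<le> c * cmod (\<psi> k y - \<Lambda> (v (k - 1)))" if "1 \<le> k" for k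
  proof -
    obtain j where k: "k = Suc j" using \<open>1 \<le> k\<close> by (cases k) auto
    have "cmod (\<psi> k (v k) - \<psi> k (v j)) \<le>
        cmod (\<psi> k y - \<psi> k (v k)) + cmod (\<psi> k y - \<Lambda> (v j)) + cmod (\<psi> k (v j) - \<Lambda> (v j))"
      by (rule order_trans[OF _ add_right_mono[OF norm_triangle_ineq4]],
          rule order_trans[OF _ norm_triangle_ineq]) (simp add: norm_minus_commute)
    then have "c * cmod (\<psi> k (v k) - \<psi> k (v j)) \<le>
        c * cmod (\<psi> k y - \<psi> k (v k)) + c * cmod (\<psi> k y - \<Lambda> (v j)) + c * cmod (\<psi> k (v j) - \<Lambda> (v j))"
      using c by (simp flip: distrib_left)
    then show ?thesis using jump[of j] yk[of k] below[of j k] by (simp add: k)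
  qed
  have "6 * d \<le> c * cmod (\<Psi> y - \<Lambda> y)"
  proof (rule tendsto_lowerbound[OF _ _ nb])
    show "((\<lambda>k. c * cmod (\<psi> k y - \<Lambda> (v (k - 1)))) \<longlongrightarrow> c * cmod (\<Psi> y - \<Lambda> y)) D"
      by (intro tendsto_intros y \<Psi> \<Lambda>)
    show "eventually (\<lambda>k. 6 * d \<le> c * cmod (\<psi> k y - \<Lambda> (v (k - 1)))) D"
      using ev_ge[of 1] by eventually_elim (rule far)
  qed
  moreover have "c * cmod (\<Psi> y - \<Lambda> y) \<le> d"
  proof (rule tendsto_upperbound[OF _ _ nb])
    show "((\<lambda>m. c * cmod (\<Psi> (v (m - 1)) - \<Lambda> (v (m - 1)))) \<longlongrightarrow> c * cmod (\<Psi> y - \<Lambda> y)) D"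
      by (intro tendsto_intros y \<Psi> \<Lambda>)
    have "c * cmod (\<Psi> (v m) - \<Lambda> (v m)) \<le> d" for m
    proof (rule tendsto_upperbound[OF _ _ nb])
      show "((\<lambda>k. c * cmod (\<psi> k (v m) - \<Lambda> (v m))) \<longlongrightarrow> c * cmod (\<Psi> (v m) - \<Lambda> (v m))) D"
        by (intro tendsto_intros \<Psi>)
      show "eventually (\<lambda>k. c * cmod (\<psi> k (v m) - \<Lambda> (v m)) \<le> d) D"
        using ev_ge[of "Suc m"] by eventually_elim (rule below, simp)
    qed
    then show "eventually (\<lambda>m. c * cmod (\<Psi> (v (m - 1)) - \<Lambda> (v (m - 1))) \<le> d) D" by simp
  qed
  ultimately show False using d by linarith
qed

context linf_operator
begin

text \<open>Weak compactness provides the limit of the \<open>T (R X f)\<close> as a vector. As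
  \<open>R X f\<close> has norm up to \<open>c\<close>, it is first divided by \<open>c\<close>; the
  factor returns in the formula.\<close>

lemma weak_limit_on_unit_ball:
  assumes "weakly_compact_operator T"
  shows "\<exists>S. \<forall>f. (\<forall>i. cmod (f i) \<le> 1) \<longrightarrow> S f \<in> weak_topology closure_of (T ` cball 0 1) \<and>
    (\<forall>\<psi>\<in>dual_unit_ball. lim_functional (\<lambda>_. \<psi>) f = of_real c * \<psi> (S f))"
proof -
  let ?Q = "weak_topology closure_of (T ` cball 0 1)"
  have "\<exists>y. (\<forall>i. cmod (f i) \<le> 1) \<longrightarrow> y \<in> ?Q \<and>
      (\<forall>\<psi>\<in>dual_unit_ball. lim_functional (\<lambda>_. \<psi>) f = of_real c * \<psi> y)" for f
  proof (cases "\<forall>i. cmod (f i) \<le> 1")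
    case True
    have inQ: "T (inverse c *\<^sub>R R X f) \<in> ?Q" for X
    proof -
      have "norm (R X f) \<le> c * 1" using True by (intro R_bound) auto
      then have "norm (inverse c *\<^sub>R R X f) \<le> 1" using c by (simp add: field_simps)
      then show ?thesis
        using closure_of_subset[of "T ` cball 0 1" weak_topology] by auto
    qed
    have "\<exists>y\<in>?Q. \<forall>\<phi>\<in>dual_space. ((\<lambda>X. \<phi> (T (inverse c *\<^sub>R R X f))) \<longlongrightarrow> \<phi> y) U"
      using assms unfolding weakly_compact_operator_def
      by (rule compactin_weak_ultra_tendsto[OF _ U(1)]) (simp add: inQ)
    then obtain y where y: "y \<in> ?Q"
        "\<And>\<phi>. \<phi> \<in> dual_space \<Longrightarrow> ((\<lambda>X. \<phi> (T (inverse c *\<^sub>R R X f))) \<longlongrightarrow> \<phi> y) U"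
      by blast
    have "lim_functional (\<lambda>_. \<psi>) f = of_real c * \<psi> y" if \<psi>: "\<psi> \<in> dual_unit_ball" for \<psi>
    proof (rule lim_functional_eqI)
      have "((\<lambda>X. of_real c * \<psi> (T (inverse c *\<^sub>R R X f))) \<longlongrightarrow> of_real c * \<psi> y) U"
        by (intro tendsto_mult_left y dual_unit_ball_subset \<psi>)
      moreover have "of_real c * \<psi> (T (inverse c *\<^sub>R R X f)) = \<psi> (T (R X f))" for X
        using c by (simp add: T_scaleR dual_unit_ball_simps[OF \<psi>])
      ultimately show "((\<lambda>X. \<psi> (T (R X f))) \<longlongrightarrow> of_real c * \<psi> y) U" by (simp only:)
    qed
    then show ?thesis using y by blast
  qed blast
  then show ?thesis by (intro choice) blast
qed

text \<open>The bounded sequence is built in damped steps: \<open>u (Suc k)\<close> differs from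
  \<open>u k\<close> by at most twice the modulus of some \<open>x n\<close>. Later steps hardly
  affect earlier functionals, while the functional of the step itself moves by more than
  \<open>e\<close>; this is the configuration excluded by
  \<open>double_limit_contradiction\<close>.\<close>

lemma weakly_compact_controlled:
  assumes wc: "weakly_compact_operator T" and e: "0 < e"
  shows "controlled {lim_functional (\<lambda>_. \<psi>) |\<psi>. \<psi> \<in> dual_unit_ball} e"
proof (rule ccontr)
  note split_paired_All [simp del] split_paired_Ex [simp del]
  assume nc: "\<not> ?thesis"
  let ?Q = "weak_topology closure_of (T ` cball 0 1)"
  obtain S where SQ: "\<And>f. (\<And>i. cmod (f i) \<le> 1) \<Longrightarrow> S f \<in> ?Q"
    and S: "\<And>f \<psi>. (\<And>i. cmod (f i) \<le> 1) \<Longrightarrow> \<psi> \<in> dual_unit_ball \<Longrightarrow>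
      lim_functional (\<lambda>_. \<psi>) f = of_real c * \<psi> (S f)"
    using weak_limit_on_unit_ball[OF wc] by blast
  \<comment> \<open>All later steps together change an earlier functional by at most twice a tail of
    these numbers, which is at most \<open>e / 8\<close>.\<close>
  define \<eta> where "\<eta> n = e / 16 * (1 / 2) ^ n" for n :: nat
  have \<eta>: "0 < \<eta> n" for n using e by (simp add: \<eta>_def)
  define \<F> where "\<F> = {lim_functional (\<lambda>_. \<psi>) |\<psi>. \<psi> \<in> dual_unit_ball}"
  have bf: "bfunctional (K * c) \<phi>" if "\<phi> \<in> \<F>" for \<phi>
    using that by (auto simp: \<F>_def intro: bfunctional_lim_functional)
  have "\<exists>x \<phi>. (\<forall>n i. cmod (x n i) \<le> 1) \<and> (\<forall>n. \<phi> n \<in> \<F>) \<and> (\<forall>n. e < cmod (\<phi> n (x n))) \<and>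
      (\<forall>j n. j < n \<longrightarrow> variation (\<phi> j) (\<lambda>i. cmod (x n i)) \<le> \<eta> n)"
    by (rule not_controlled_sequence[OF bf nc[folded \<F>_def] \<eta> e])
  then obtain x \<phi> where x: "\<And>n i. cmod (x n i) \<le> 1" and \<phi>\<F>: "\<And>n. \<phi> n \<in> \<F>"
    and \<phi>x: "\<And>n. e < cmod (\<phi> n (x n))"
    and small: "\<And>j n. j < n \<Longrightarrow> variation (\<phi> j) (\<lambda>i. cmod (x n i)) \<le> \<eta> n"
    by blast
  have "\<exists>\<psi>. \<phi> n = lim_functional (\<lambda>_. \<psi>) \<and> \<psi> \<in> dual_unit_ball" for n
    using \<phi>\<F>[of n] unfolding \<F>_def by blast
  then obtain \<psi> where \<phi>: "\<And>n. \<phi> n = lim_functional (\<lambda>_. \<psi> n)" and \<psi>: "\<And>n. \<psi> n \<in> dual_unit_ball"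
    by metis
  have b: "bfunctional (K * c) (\<phi> n)" for n unfolding \<phi> using \<psi> by (intro bfunctional_lim_functional)
  have \<phi>S: "\<phi> n f = of_real c * \<psi> n (S f)" if "\<And>i. cmod (f i) \<le> 1" for n f
    unfolding \<phi> using that \<psi> by (rule S)
  obtain D :: "nat filter" where D: "ultra D" "D \<le> sequentially"
    using ultra_ex[of sequentially] by (metis sequentially_bot)
  \<comment> \<open>Fixed before the recursion, so that each new index can be taken where
    \<open>\<psi> n\<close> is close to \<open>\<Lambda>\<close> on the vectors already
    built.\<close>
  define \<Lambda> where "\<Lambda> z = Lim D (\<lambda>n. \<psi> n z)" for z
  have \<Lambda>: "\<Lambda> \<in> dual_unit_ball" "\<And>z. ((\<lambda>n. \<psi> n z) \<longlongrightarrow> \<Lambda> z) D"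
    using ultra_Lim_dual_unit_ball[OF D(1), of \<psi>] \<psi> unfolding \<Lambda>_def[abs_def] by auto
  \<comment> \<open>A state is an index into the sequence \<open>x\<close> with the function built
    there; the function preceding the first is \<open>0\<close>.\<close>
  define prev where "prev s k = (if k = 0 then (\<lambda>_. 0) else snd (s (k - 1)))"
    for s :: "nat \<Rightarrow> nat \<times> ('a set \<times> nat \<Rightarrow> complex)" and k
  define Q where "Q s k r \<longleftrightarrow> (\<forall>i. cmod (snd r i) \<le> 1) \<and> (\<forall>j<k. fst (s j) < fst r) \<and>
      (\<forall>i. cmod (snd r i - prev s k i) \<le> 2 * cmod (x (fst r) i)) \<and>
      e < cmod (\<phi> (fst r) (snd r) - \<phi> (fst r) (prev s k)) \<and>
      (\<forall>j<k. c * cmod (\<psi> (fst r) (S (snd (s j))) - \<Lambda> (S (snd (s j)))) \<le> e / 8)" for s k r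
  have "\<exists>s. \<forall>k. Q s k (s k)"
  proof (rule dependent_wellorder_choice)
    fix k s assume IH: "\<And>j. j < k \<Longrightarrow> Q s j (s j)"
    define w where "w = prev s k"
    have w: "cmod (w i) \<le> 1" for i
    proof (cases "k = 0")
      case False
      then have "Q s (k - 1) (s (k - 1))" by (intro IH) simp
      then have "\<forall>i. cmod (snd (s (k - 1)) i) \<le> 1" unfolding Q_def by (rule conjunct1)
      then have "cmod (snd (s (k - 1)) i) \<le> 1" by (rule spec)
      moreover have "w = snd (s (k - 1))" using False by (simp add: w_def prev_def)
      ultimately show ?thesis by simp
    qed (simp add: w_def prev_def)
    have "eventually (\<lambda>n. c * cmod (\<psi> n (S (snd (s j))) - \<Lambda> (S (snd (s j)))) \<le> e / 8) D" for j
    proof -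
      have "((\<lambda>n. c * cmod (\<psi> n (S (snd (s j))) - \<Lambda> (S (snd (s j))))) \<longlongrightarrow>
          c * cmod (\<Lambda> (S (snd (s j))) - \<Lambda> (S (snd (s j))))) D"
        by (intro tendsto_intros \<Lambda>)
      then have "eventually (\<lambda>n. c * cmod (\<psi> n (S (snd (s j))) - \<Lambda> (S (snd (s j)))) < e / 8) D"
        using e by (intro order_tendstoD(2)) auto
      then show ?thesis by eventually_elim simp
    qed
    moreover have "eventually (\<lambda>n. fst (s j) < n) D" for j
      using D(2) eventually_gt_at_top[of "fst (s j)"] by (auto simp: le_filter_def)
    ultimately have "eventually (\<lambda>n. \<forall>j\<in>{..<k}. fst (s j) < n \<and>
        c * cmod (\<psi> n (S (snd (s j))) - \<Lambda> (S (snd (s j)))) \<le> e / 8) D"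
      by (intro eventually_ball_finite ballI eventually_conj) auto
    then have "\<exists>n. \<forall>j\<in>{..<k}. fst (s j) < n \<and>
        c * cmod (\<psi> n (S (snd (s j))) - \<Lambda> (S (snd (s j)))) \<le> e / 8"
      by (rule eventually_happens'[OF ultra_not_bot[OF D(1)]])
    then obtain n where n: "\<And>j. j < k \<Longrightarrow> fst (s j) < n \<and>
        c * cmod (\<psi> n (S (snd (s j))) - \<Lambda> (S (snd (s j)))) \<le> e / 8"
      by blast
    text \<open>Multiplying by \<open>1 - |x|\<close> keeps both candidates in the unit ball; as their difference is
      \<open>2 x\<close>, at least one of them moves \<open>\<phi> n\<close> by more than \<open>e\<close>.\<close>
    define u where "u t i = of_real (1 - cmod (x n i)) * w i + of_real t * x n i" for t i
    have u: "cmod (u t i) \<le> 1" "cmod (u t i - w i) \<le> 2 * cmod (x n i)" if "\<bar>t\<bar> = 1" for t i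
    proof -
      have xt: "cmod (of_real t * x n i) = cmod (x n i)" using that by (simp add: norm_mult)
      have "cmod (of_real (1 - cmod (x n i)) * w i) \<le> (1 - cmod (x n i)) * 1"
        unfolding norm_mult norm_of_real using x[of n i] w[of i] by (intro mult_mono) auto
      from norm_triangle_mono[OF this eq_refl[OF xt]]
      show "cmod (u t i) \<le> 1" unfolding u_def by simp
      have "cmod (of_real (cmod (x n i)) * w i) \<le> cmod (x n i) * 1"
        unfolding norm_mult norm_of_real using w[of i] by (intro mult_mono) auto
      moreover have "u t i - w i = of_real t * x n i - of_real (cmod (x n i)) * w i"
        by (simp add: u_def algebra_simps)
      ultimately show "cmod (u t i - w i) \<le> 2 * cmod (x n i)"
        using norm_triangle_ineq4[of "of_real t * x n i" "of_real (cmod (x n i)) * w i"] xt by simp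
    qed
    have bu: "bounded_fun (u t)" if "\<bar>t\<bar> = 1" for t using u(1)[OF that] by (rule bounded_funI)
    have bx: "bounded_fun (x n)" using x by (rule bounded_funI)
    have "u 1 = (\<lambda>i. u (- 1) i + 2 * x n i)" by (auto simp: u_def)
    then have "\<phi> n (u 1) = \<phi> n (u (- 1)) + 2 * \<phi> n (x n)"
      using bfunctional_add[OF b bu[of "-1"] bounded_fun_mult[OF bounded_fun_const[of 2] bx], of n]
        bfunctional_scale[OF b bx, of n 2] by simp
    then have "2 * \<phi> n (x n) = (\<phi> n (u 1) - \<phi> n w) - (\<phi> n (u (- 1)) - \<phi> n w)" by simp
    then have "2 * cmod (\<phi> n (x n)) \<le> cmod (\<phi> n (u 1) - \<phi> n w) + cmod (\<phi> n (u (- 1)) - \<phi> n w)"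
      using norm_triangle_ineq4[of "\<phi> n (u 1) - \<phi> n w" "\<phi> n (u (- 1)) - \<phi> n w"]
      by (metis norm_mult norm_numeral)
    then have "e < cmod (\<phi> n (u 1) - \<phi> n w) \<or> e < cmod (\<phi> n (u (- 1)) - \<phi> n w)" using \<phi>x[of n] by linarith
    then obtain t where t: "\<bar>t\<bar> = 1" "e < cmod (\<phi> n (u t) - \<phi> n w)"
      using that[of 1] that[of "-1"] by auto
    show "\<exists>r. Q s k r"
      by (rule exI[of _ "(n, u t)"]) (use u[OF t(1)] t(2) n in \<open>auto simp: Q_def simp flip: w_def\<close>)
  next
    show "Q f k r = Q g k r" if fg: "\<And>y. y < k \<Longrightarrow> f y = g y" for r f g k
    proof -
      have "prev f k = prev g k" using fg by (simp add: prev_def)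
      then show ?thesis using fg by (simp add: Q_def)
    qed
  qed
  then obtain s where s: "\<And>k. Q s k (s k)" by blast
  define m u where "m k = fst (s k)" and "u k = snd (s k)" for k
  have u1: "cmod (u k i) \<le> 1" for k i using s[of k] by (auto simp: Q_def u_def)
  have mono: "m j < m k" if "j < k" for j k using s[of k] that by (auto simp: Q_def m_def)
  have step: "cmod (u (Suc k) i - u k i) \<le> 2 * cmod (x (m (Suc k)) i)" for k i
    using s[of "Suc k"] by (auto simp: Q_def m_def u_def prev_def)
  have jump: "e < cmod (\<phi> (m (Suc k)) (u (Suc k)) - \<phi> (m (Suc k)) (u k))" for k
    using s[of "Suc k"] by (auto simp: Q_def m_def u_def prev_def)
  have near: "c * cmod (\<psi> (m k) (S (u j)) - \<Lambda> (S (u j))) \<le> e / 8" if "j < k" for j k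
    using s[of k] that by (auto simp: Q_def m_def u_def)
  have m_ge: "k \<le> m k" for k
  proof (induction k)
    case (Suc k)
    then show ?case using mono[of k "Suc k"] by simp
  qed simp
  have bu: "bounded_fun (u k)" for k using u1 by (rule bounded_funI)
  \<comment> \<open>Writing the geometric bound as a difference lets the induction
    telescope.\<close>
  have tail: "cmod (\<phi> (m k) (u (k + l)) - \<phi> (m k) (u k)) \<le> e / 8 * ((1 / 2) ^ k - (1 / 2) ^ (k + l))" for k l
  proof (induction l)
    case (Suc l)
    let ?n = "m (Suc (k + l))"
    have "cmod (\<phi> (m k) (u (Suc (k + l))) - \<phi> (m k) (u (k + l))) =
        cmod (\<phi> (m k) (\<lambda>i. u (Suc (k + l)) i - u (k + l) i))"
      by (simp add: bfunctional_diff[OF b bu bu])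
    also have "\<dots> \<le> variation (\<phi> (m k)) (\<lambda>i. 2 * cmod (x ?n i))"
      by (rule variation_upper[OF b, of _ _ 2]) (use step x in auto)
    also have "\<dots> \<le> 2 * variation (\<phi> (m k)) (\<lambda>i. cmod (x ?n i))"
      by (rule variation_scale_le[OF b, of _ 1]) (use x in auto)
    also have "\<dots> \<le> 2 * \<eta> ?n" using small[OF mono[of k "Suc (k + l)"]] by simp
    also have "\<dots> \<le> 2 * \<eta> (Suc (k + l))"
      unfolding \<eta>_def using e m_ge[of "Suc (k + l)"] by (intro mult_left_mono power_decreasing) auto
    also have "\<dots> = e / 8 * ((1 / 2) ^ (k + l) - (1 / 2) ^ (k + Suc l))" by (simp add: \<eta>_def field_simps)
    finally have "cmod (\<phi> (m k) (u (k + Suc l)) - \<phi> (m k) (u (k + l))) \<le> \<dots>" by simp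
    moreover have "cmod (\<phi> (m k) (u (k + Suc l)) - \<phi> (m k) (u k)) \<le>
        cmod (\<phi> (m k) (u (k + Suc l)) - \<phi> (m k) (u (k + l))) + cmod (\<phi> (m k) (u (k + l)) - \<phi> (m k) (u k))"
      using norm_triangle_ineq[of "\<phi> (m k) (u (k + Suc l)) - \<phi> (m k) (u (k + l))" "\<phi> (m k) (u (k + l)) - \<phi> (m k) (u k)"]
      by simp
    ultimately show ?case using Suc.IH by (simp only: right_diff_distrib)
  qed simp
  have above: "cmod (\<phi> (m k) (u j) - \<phi> (m k) (u k)) \<le> e / 8" if "k \<le> j" for k j
  proof -
    have "e / 8 * ((1 / 2) ^ k - (1 / 2) ^ (k + (j - k))) \<le> e / 8 * 1"
    proof (rule mult_left_mono)
      have "0 \<le> (1 / 2 :: real) ^ (k + (j - k))" "(1 / 2 :: real) ^ k \<le> 1"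
        by (simp_all add: power_le_one)
      then show "(1 / 2 :: real) ^ k - (1 / 2) ^ (k + (j - k)) \<le> 1" by linarith
    qed (use e in simp)
    then show ?thesis using tail[of k "j - k"] that by simp
  qed
  have \<phi>u: "cmod (\<phi> k (u i) - \<phi> k (u j)) = c * cmod (\<psi> k (S (u i)) - \<psi> k (S (u j)))" for k i j
  proof -
    have "\<phi> k (u i) - \<phi> k (u j) = of_real c * (\<psi> k (S (u i)) - \<psi> k (S (u j)))"
      by (simp add: \<phi>S[OF u1] right_diff_distrib)
    then show ?thesis using c by (simp add: norm_mult)
  qed
  have "\<exists>y\<in>?Q. \<forall>\<phi>\<in>dual_space. ((\<lambda>k. \<phi> (S (u (k - 1)))) \<longlongrightarrow> \<phi> y) D"
    using wc SQ[OF u1] unfolding weakly_compact_operator_def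
    by (intro compactin_weak_ultra_tendsto[OF _ D(1)]) auto
  then obtain y where y: "\<And>\<phi>. \<phi> \<in> dual_unit_ball \<Longrightarrow> ((\<lambda>k. \<phi> (S (u (k - 1)))) \<longlongrightarrow> \<phi> y) D"
    using dual_unit_ball_subset by blast
  show False
  proof (rule double_limit_contradiction[OF D, of c "e / 8" "\<lambda>k. \<psi> (m k)" \<Lambda> "\<lambda>k. S (u k)" y])
    show "8 * (e / 8) < c * cmod (\<psi> (m (Suc k)) (S (u (Suc k))) - \<psi> (m (Suc k)) (S (u k)))" for k
      using jump[of k] unfolding \<phi>u by simp
    show "c * cmod (\<psi> (m k) (S (u j)) - \<psi> (m k) (S (u k))) \<le> e / 8" if "k \<le> j" for k j
      using above[OF that] unfolding \<phi>u .
  qed (use c e \<psi> \<Lambda> y near in auto)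
qed

end

subsection \<open>Summing constants\<close>

lemma weak_summing_norm_le_1D:
  assumes "weak_summing_norm p n x \<le> 1" "\<phi> \<in> dual_unit_ball" "1 \<le> p"
  shows "(\<Sum>i<n. cmod (\<phi> (x i)) powr p) \<le> 1"
proof -
  let ?s = "\<Sum>i<n. cmod (\<phi> (x i)) powr p"
  have s: "0 \<le> ?s" by (simp add: sum_nonneg)
  have "ennreal (?s powr (1 / p)) \<le> weak_summing_norm p n x"
    unfolding weak_summing_norm_def using assms(2) by (rule SUP_upper)
  then have "ennreal (?s powr (1 / p)) \<le> ennreal 1" using assms(1) by (metis ennreal_1 order_trans)
  then have le: "?s powr (1 / p) \<le> 1" by (subst (asm) ennreal_le_iff) auto
  show ?thesis
  proof (rule ccontr)
    assume "\<not> ?thesis"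
    then have "1 < ?s powr (1 / p)" using assms(3) by (intro gr_one_powr) auto
    then show False using le by simp
  qed
qed

text \<open>Each modulus is at most one, so the power \<open>p\<close> only decreases it; almost
  disjoint vectors thus serve every \<open>p\<close>.\<close>

lemma weak_summing_norm_le_1I:
  assumes "\<And>\<phi>. \<phi> \<in> dual_unit_ball \<Longrightarrow> (\<Sum>i<n. cmod (\<phi> (x i))) \<le> 1" "1 \<le> p"
  shows "weak_summing_norm p n x \<le> 1"
  unfolding weak_summing_norm_def
proof (rule SUP_least)
  fix \<phi> :: "'a \<Rightarrow> complex" assume "\<phi> \<in> dual_unit_ball"
  then have le: "(\<Sum>i<n. cmod (\<phi> (x i))) \<le> 1" by (rule assms(1))
  have "(\<Sum>i<n. cmod (\<phi> (x i)) powr p) \<le> (\<Sum>i<n. cmod (\<phi> (x i)))"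
  proof (rule sum_mono)
    fix i assume i: "i \<in> {..<n}"
    have "cmod (\<phi> (x i)) \<le> (\<Sum>i<n. cmod (\<phi> (x i)))" using i by (intro member_le_sum) auto
    then have "cmod (\<phi> (x i)) \<le> 1" using le by simp
    then show "cmod (\<phi> (x i)) powr p \<le> cmod (\<phi> (x i))"
      using powr_mono'[of 1 p "cmod (\<phi> (x i))"] assms(2) by simp
  qed
  then have "(\<Sum>i<n. cmod (\<phi> (x i)) powr p) \<le> 1" using le by simp
  then have "(\<Sum>i<n. cmod (\<phi> (x i)) powr p) powr (1 / p) \<le> 1"
    using assms(2) by (intro powr_le1) (auto simp: abs_of_nonneg sum_nonneg)
  then show "ennreal ((\<Sum>i<n. cmod (\<phi> (x i)) powr p) powr (1 / p)) \<le> 1"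
    by (metis ennreal_1 ennreal_leI)
qed

lemma summing_const_upper:
  "weak_summing_norm p n x \<le> 1 \<Longrightarrow>
    ennreal ((\<Sum>i<n. norm (T (x i)) powr q) powr (1 / q)) \<le> summing_const q p n T"
  unfolding summing_const_def by (rule SUP_upper) simp

lemma norm_le_1_if_weak_summing_norm:
  assumes "weak_summing_norm p n x \<le> 1" "1 \<le> p" "i < n"
  shows "norm (x i) \<le> 1"
proof (rule norm_le_if_dual_unit_ball)
  fix \<phi> :: "'a \<Rightarrow> complex" assume \<phi>: "\<phi> \<in> dual_unit_ball"
  have "cmod (\<phi> (x i)) powr p \<le> (\<Sum>i<n. cmod (\<phi> (x i)) powr p)"
    using assms(3) by (intro member_le_sum) auto
  then have le: "cmod (\<phi> (x i)) powr p \<le> 1" using weak_summing_norm_le_1D[OF assms(1) \<phi> assms(2)] by simp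
  show "cmod (\<phi> (x i)) \<le> 1"
  proof (rule ccontr)
    assume "\<not> ?thesis"
    then have "1 < cmod (\<phi> (x i)) powr p" using assms(2) by (intro gr_one_powr) auto
    then show False using le by simp
  qed
qed

lemma summing_const_ratio_ge:
  fixes \<delta> q :: real
  assumes "weak_summing_norm p n x \<le> 1" "\<And>i. i < n \<Longrightarrow> \<delta> \<le> norm (T (x i))" "1 \<le> n" "0 < \<delta>" "1 \<le> q"
  shows "ennreal \<delta> \<le> summing_const q p n T / ennreal (real n powr (1 / q))"
proof -
  have "real n * \<delta> powr q = (\<Sum>i<n. \<delta> powr q)" by simp
  also have "\<dots> \<le> (\<Sum>i<n. norm (T (x i)) powr q)"
    using assms by (intro sum_mono powr_mono2) auto
  finally have "(real n * \<delta> powr q) powr (1 / q) \<le> (\<Sum>i<n. norm (T (x i)) powr q) powr (1 / q)"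
    using assms by (intro powr_mono2) auto
  moreover have "(real n * \<delta> powr q) powr (1 / q) = \<delta> * real n powr (1 / q)"
    using assms by (simp add: powr_mult powr_powr)
  ultimately have "ennreal (\<delta> * real n powr (1 / q)) \<le> ennreal ((\<Sum>i<n. norm (T (x i)) powr q) powr (1 / q))"
    by (simp add: ennreal_leI)
  then have "ennreal (\<delta> * real n powr (1 / q)) \<le> summing_const q p n T"
    using summing_const_upper[OF assms(1), where T = T and q = q] by (rule order_trans)
  then have "ennreal (\<delta> * real n powr (1 / q)) / ennreal (real n powr (1 / q)) \<le>
      summing_const q p n T / ennreal (real n powr (1 / q))"
    by (rule divide_right_mono_ennreal)
  moreover have "ennreal (\<delta> * real n powr (1 / q)) / ennreal (real n powr (1 / q)) = ennreal \<delta>"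
    using assms by (subst divide_ennreal) auto
  ultimately show ?thesis by simp
qed

text \<open>Tuples with a single nonzero entry recover the operator norm.\<close>

lemma bounded_if_summing_const_finite:
  assumes T: "clinear T" and fin: "summing_const q p n T < top" and n: "1 \<le> n" and p: "1 \<le> p" and q: "1 \<le> q"
  obtains K where "0 < K" "\<And>x. norm (T x) \<le> K * norm x"
proof -
  have Tadd: "T (x + y) = T x + T y" and Tscale: "T (a *\<^sub>C x) = a *\<^sub>C T x" for x y a
    using T by (auto simp: clinear_iff)
  have TscaleR: "T (r *\<^sub>R x) = r *\<^sub>R T x" for r x by (simp add: scaleR_scaleC Tscale)
  define K where "K = enn2real (summing_const q p n T) + 1"
  have small: "norm (T x) \<le> K" if x: "norm x \<le> 1" for x
  proof -
    define v where "v i = (if i = 0 then x else 0)" for i :: nat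
    have T0: "T 0 = 0" using TscaleR[of 0 0] by simp
    have sum0: "(\<Sum>i<n. h (v i)) = h x" if "h 0 = 0" for h :: "_ \<Rightarrow> real"
    proof -
      have "(\<Sum>i<n. h (v i)) = (\<Sum>i\<in>{0}. h (v i))"
        using n that by (intro sum.mono_neutral_right) (auto simp: v_def)
      then show ?thesis by (simp add: v_def)
    qed
    have "weak_summing_norm p n v \<le> 1"
    proof (rule weak_summing_norm_le_1I[OF _ p])
      fix \<phi> :: "'a \<Rightarrow> complex" assume \<phi>: "\<phi> \<in> dual_unit_ball"
      have "\<phi> 0 = 0" using dual_unit_ball_simps(3)[OF \<phi>, of 0 0] by simp
      then show "(\<Sum>i<n. cmod (\<phi> (v i))) \<le> 1"
        using sum0[of "\<lambda>z. cmod (\<phi> z)"] dual_unit_ball_simps(5)[OF \<phi>, of x] x by simp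
    qed
    then have "ennreal ((\<Sum>i<n. norm (T (v i)) powr q) powr (1 / q)) \<le> summing_const q p n T"
      by (rule summing_const_upper)
    moreover have "(\<Sum>i<n. norm (T (v i)) powr q) powr (1 / q) = norm (T x)"
      using sum0[of "\<lambda>z. norm (T z) powr q"] q T0 by (simp add: powr_powr)
    ultimately have "ennreal (norm (T x)) \<le> ennreal (enn2real (summing_const q p n T))" using fin by simp
    then show ?thesis by (simp add: K_def)
  qed
  have "norm (T x) \<le> K * norm x" for x
  proof (cases "x = 0")
    case True
    then show ?thesis using TscaleR[of 0 0] by simp
  next
    case False
    have "norm (T (inverse (norm x) *\<^sub>R x)) \<le> K" using False by (intro small) simp
    then show ?thesis using False by (simp add: TscaleR field_simps)
  qed
  moreover have "0 < K" by (simp add: K_def add_nonneg_pos)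
  ultimately show ?thesis using that by blast
qed

context linf_operator
begin

lemma sum_norm_powr_le:
  assumes ctl: "\<And>e. 0 < e \<Longrightarrow> controlled {lim_functional (\<lambda>_. \<psi>) |\<psi>. \<psi> \<in> dual_unit_ball} e"
    and p: "1 \<le> p" and q: "1 \<le> q" and e: "0 < e"
  obtains M where "0 \<le> M"
    "\<And>n x. weak_summing_norm p n x \<le> 1 \<Longrightarrow> (\<Sum>i<n. norm (T (x i)) powr q) \<le> real n * e + M"
proof -
  \<comment> \<open>Half of \<open>e\<close> pays for the control error and half for
    \<open>L * \<eta>\<close>; the factor \<open>K powr (q - 1)\<close> is lost in reducing the
    exponent \<open>q\<close> to one.\<close>
  define e1 where "e1 = e / (2 * K powr (q - 1))"
  have e1: "0 < e1" using e K by (simp add: e1_def)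
  define \<F> where "\<F> = {lim_functional (\<lambda>_. \<psi>) |\<psi>. \<psi> \<in> dual_unit_ball}"
  have \<F>: "lim_functional (\<lambda>_. \<psi>) \<in> \<F>" if "\<psi> \<in> dual_unit_ball" for \<psi> using that by (auto simp: \<F>_def)
  obtain P N where P: "finite P" "P \<subseteq> \<F>" "0 \<le> N"
    "\<And>x. norm x \<le> 1 \<Longrightarrow> norm (T x) \<le> N * (\<Sum>\<theta>\<in>P. variation \<theta> (\<lambda>i. cmod (J x i))) + e1"
    using controlled_norm_le[OF ctl[OF e1, folded \<F>_def] \<F>] by blast
  have bf: "bfunctional (K * c) \<theta>" if "\<theta> \<in> P" for \<theta>
    using that P(2) by (auto simp: \<F>_def intro: bfunctional_lim_functional)
  define L where "L = N * card P * (K * c)"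
  have L: "0 \<le> L" using P(3) K c by (simp add: L_def)
  define \<eta> where "\<eta> = e1 / (L + 1)"
  have \<eta>: "0 < \<eta>" using e1 L by (simp add: \<eta>_def)
  have L\<eta>: "L * \<eta> \<le> e1" using e1 L by (simp add: \<eta>_def field_simps)
  define M where "M = K powr (q - 1) * (L * \<eta> powr (1 - p))"
  have "(\<Sum>i<n. norm (T (x i)) powr q) \<le> real n * e + M" if w: "weak_summing_norm p n x \<le> 1" for n x
  proof -
    have x1: "norm (x i) \<le> 1" if "i < n" for i using norm_le_1_if_weak_summing_norm[OF w p that] .
    have var: "(\<Sum>i<n. variation \<theta> (\<lambda>\<gamma>. cmod (J (x i) \<gamma>))) \<le> K * c * (real n * \<eta> + \<eta> powr (1 - p))"
      if "\<theta> \<in> P" for \<theta>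
    proof -
      have "(\<Sum>i<n. variation \<theta> (\<lambda>\<gamma>. cmod (J (x i) \<gamma>))) = variation \<theta> (\<lambda>\<gamma>. \<Sum>i<n. cmod (J (x i) \<gamma>))"
        using x1 by (intro variation_sum[OF bf[OF that], symmetric, of _ _ 1]) (auto intro: order_trans[OF J_bound])
      also have "\<dots> \<le> K * c * (real n * \<eta> + \<eta> powr (1 - p))"
      proof (rule variation_bound[OF bf[OF that]])
        fix \<gamma>
        have "(\<Sum>i<n. cmod (J (x i) \<gamma>)) \<le> (\<Sum>i<n. \<eta> + \<eta> powr (1 - p) * cmod (J (x i) \<gamma>) powr p)"
          using \<eta> p by (intro sum_mono le_add_powr) auto
        also have "\<dots> = real n * \<eta> + \<eta> powr (1 - p) * (\<Sum>i<n. cmod (J (x i) \<gamma>) powr p)"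
          by (simp add: sum.distrib sum_distrib_left)
        also have "\<dots> \<le> real n * \<eta> + \<eta> powr (1 - p) * 1"
          unfolding J_def using weak_summing_norm_le_1D[OF w A_dual p] by (intro add_left_mono mult_left_mono) auto
        finally show "(\<Sum>i<n. cmod (J (x i) \<gamma>)) \<le> real n * \<eta> + \<eta> powr (1 - p)" by simp
      qed (simp add: sum_nonneg)
      finally show ?thesis .
    qed
    have "(\<Sum>i<n. norm (T (x i))) \<le> (\<Sum>i<n. N * (\<Sum>\<theta>\<in>P. variation \<theta> (\<lambda>\<gamma>. cmod (J (x i) \<gamma>))) + e1)"
      using x1 P(4) by (intro sum_mono) auto
    also have "\<dots> = N * (\<Sum>\<theta>\<in>P. \<Sum>i<n. variation \<theta> (\<lambda>\<gamma>. cmod (J (x i) \<gamma>))) + real n * e1"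
      by (simp add: sum.distrib sum_distrib_left[symmetric] sum.swap[of _ P])
    also have "\<dots> \<le> N * (real (card P) * (K * c * (real n * \<eta> + \<eta> powr (1 - p)))) + real n * e1"
      using var P(3) by (intro add_right_mono mult_left_mono sum_bounded_above) auto
    also have "\<dots> = real n * (L * \<eta>) + L * \<eta> powr (1 - p) + real n * e1" by (simp add: L_def algebra_simps)
    also have "\<dots> \<le> real n * e1 + L * \<eta> powr (1 - p) + real n * e1"
      using L\<eta> by (intro add_right_mono mult_left_mono) auto
    finally have sum_le: "(\<Sum>i<n. norm (T (x i))) \<le> 2 * real n * e1 + L * \<eta> powr (1 - p)"
      by (simp add: algebra_simps)
    have "(\<Sum>i<n. norm (T (x i)) powr q) \<le> (\<Sum>i<n. K powr (q - 1) * norm (T (x i)))"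
    proof (rule sum_mono)
      fix i assume "i \<in> {..<n}"
      then have "K * norm (x i) \<le> K * 1" using x1 K(1) by (intro mult_left_mono) auto
      then have TK: "norm (T (x i)) \<le> K" using K(2)[of "x i"] by simp
      have "norm (T (x i)) powr q = norm (T (x i)) powr (q - 1) * norm (T (x i))"
        using powr_add[of "norm (T (x i))" "q - 1" 1] by simp
      also have "\<dots> \<le> K powr (q - 1) * norm (T (x i))"
        using TK q by (intro mult_right_mono powr_mono2) auto
      finally show "norm (T (x i)) powr q \<le> K powr (q - 1) * norm (T (x i))" .
    qed
    also have "\<dots> = K powr (q - 1) * (\<Sum>i<n. norm (T (x i)))" by (simp add: sum_distrib_left)
    also have "\<dots> \<le> K powr (q - 1) * (2 * real n * e1 + L * \<eta> powr (1 - p))"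
      using sum_le by (rule mult_left_mono) simp
    also have "\<dots> = real n * e + M" using K(1) by (simp add: e1_def M_def field_simps)
    finally show ?thesis .
  qed
  moreover have "0 \<le> M" using L by (simp add: M_def)
  ultimately show ?thesis using that by blast
qed

end

lemma summing_ratio_tendsto_zero:
  fixes T :: "'a::complex_normed_vector \<Rightarrow> 'b::complex_normed_vector" and p q :: real
  assumes q: "1 \<le> q"
    and le: "\<And>e. 0 < e \<Longrightarrow> \<exists>M\<ge>0. \<forall>n x. weak_summing_norm p n x \<le> 1 \<longrightarrow>
      (\<Sum>i<n. norm (T (x i)) powr q) \<le> real n * e + M"
  shows "(\<lambda>n. summing_const q p n T / ennreal (real n powr (1 / q))) \<longlonglongrightarrow> 0"
proof (rule order_tendstoI)
  fix a :: ennreal assume "0 < a"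
  then obtain b where b: "0 < b" "b < a" using dense by blast
  define d where "d = enn2real b"
  have "b < top" using b(2) top_greatest[of a] by (rule less_le_trans)
  then have d: "0 < d" "ennreal d < a" using b by (auto simp: d_def enn2real_positive_iff)
  \<comment> \<open>Once \<open>n\<close> exceeds \<open>M / e\<close>, the constant
    \<open>M\<close> is absorbed and the total is at most \<open>2 * e = d powr q\<close> per
    vector.\<close>
  define e where "e = d powr q / 2"
  have e: "0 < e" using d by (simp add: e_def)
  obtain M where M: "0 \<le> M"
    "\<And>n x. weak_summing_norm p n x \<le> 1 \<Longrightarrow> (\<Sum>i<n. norm (T (x i)) powr q) \<le> real n * e + M"
    using le[OF e] by blast
  obtain n0 :: nat where n0: "M / e \<le> real n0" using real_arch_simple by blast
  have "summing_const q p n T / ennreal (real n powr (1 / q)) < a" if n: "max 1 n0 \<le> n" for n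
  proof -
    have "M \<le> real n * e"
    proof -
      have "M / e \<le> real n" using n0 n by simp
      then show ?thesis using e by (simp add: field_simps)
    qed
    then have *: "real n * e + M \<le> real n * d powr q" by (simp add: e_def)
    have "summing_const q p n T \<le> ennreal (d * real n powr (1 / q))"
      unfolding summing_const_def
    proof (rule SUP_least)
      fix x :: "nat \<Rightarrow> 'a" assume "x \<in> {x. weak_summing_norm p n x \<le> 1}"
      then have "(\<Sum>i<n. norm (T (x i)) powr q) \<le> real n * d powr q" using M(2)[of n x] * by simp
      then have "(\<Sum>i<n. norm (T (x i)) powr q) powr (1 / q) \<le> (real n * d powr q) powr (1 / q)"
        using q by (intro powr_mono2) (auto intro: sum_nonneg)
      also have "\<dots> = d * real n powr (1 / q)" using d q by (simp add: powr_mult powr_powr)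
      finally show "ennreal ((\<Sum>i<n. norm (T (x i)) powr q) powr (1 / q)) \<le> ennreal (d * real n powr (1 / q))"
        by (rule ennreal_leI)
    qed
    then have "summing_const q p n T / ennreal (real n powr (1 / q)) \<le>
        ennreal (d * real n powr (1 / q)) / ennreal (real n powr (1 / q))"
      by (rule divide_right_mono_ennreal)
    also have "\<dots> = ennreal d" using d n by (subst divide_ennreal) auto
    finally show ?thesis using d(2) by simp
  qed
  then show "eventually (\<lambda>n. summing_const q p n T / ennreal (real n powr (1 / q)) < a) sequentially"
    by (rule eventually_sequentiallyI)
qed simp

section \<open>Assembly of the two implications\<close>

lemma linf_operator_exists:
  fixes T :: "'a::complex_banach \<Rightarrow> 'b::complex_banach"
  assumes E: "Lr_space \<infinity> TYPE('a)" and T: "clinear T" and K: "0 < K" "\<And>x. norm (T x) \<le> K * norm x"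
  obtains c A B U where "linf_operator T c K A B U"
proof -
  obtain c where c: "1 < c" "\<And>X::'a set. finite X \<Longrightarrow> \<exists>A B. coordinates c X A B"
    using Linf_space_coordinates[OF E] by blast
  have "\<exists>A B. coordinates c (if finite X then X else {}) A B" for X :: "'a set"
    using c(2)[of "if finite X then X else {}"] by simp
  then obtain A B where "\<And>X::'a set. coordinates c (if finite X then X else {}) (A X) (B X)" by metis
  moreover obtain U :: "'a set filter" where "ultra U" "U \<le> finite_subsets_at_top UNIV"
    using ultra_ex[of "finite_subsets_at_top (UNIV :: 'a set)"] finite_subsets_at_top_neq_bot by metis
  ultimately have "linf_operator T c K A B U" using T K c(1) by (intro linf_operator.intro) auto
  then show ?thesis by (rule that)
qed

theorem theorem4p8:
  fixes T :: "'a::complex_banach \<Rightarrow> 'b::complex_banach"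
    and p q :: real
  assumes "Lr_space \<infinity> TYPE('a)"
    and "1 \<le> p" and "1 \<le> q"
    and "clinear T"
  shows "weakly_compact_operator T \<longleftrightarrow>
    (\<lambda>n. summing_const q p n T / ennreal (real n powr (1 / q))) \<longlonglongrightarrow> 0"
proof
  assume wc: "weakly_compact_operator T"
  obtain K where K: "0 < K" "\<And>x. norm (T x) \<le> K * norm x"
    using weakly_compact_operator_bounded[OF assms(4) wc] by blast
  obtain c A B U where "linf_operator T c K A B U"
    using linf_operator_exists[OF assms(1,4) K] by blast
  then interpret linf_operator T c K A B U .
  show "(\<lambda>n. summing_const q p n T / ennreal (real n powr (1 / q))) \<longlonglongrightarrow> 0"
    using sum_norm_powr_le[OF weakly_compact_controlled[OF wc] assms(2,3)]
    by (intro summing_ratio_tendsto_zero assms) metis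
next
  assume lim: "(\<lambda>n. summing_const q p n T / ennreal (real n powr (1 / q))) \<longlonglongrightarrow> 0"
  have small: "\<exists>n\<ge>1. summing_const q p n T / ennreal (real n powr (1 / q)) < a" if "0 < a" for a
    using order_tendstoD(2)[OF lim that] unfolding eventually_sequentially by (meson nat_le_linear)
  obtain n where n: "1 \<le> n" "summing_const q p n T / ennreal (real n powr (1 / q)) < 1"
    using small[of 1] by auto
  \<comment> \<open>An infinite summing constant would make the ratio infinite, so one index with a
    finite ratio already bounds \<open>T\<close>.\<close>
  have "summing_const q p n T < top"
  proof (rule ccontr)
    assume "\<not> ?thesis"
    then show False using n by (simp add: less_top[symmetric] ennreal_top_divide)
  qed
  then obtain K where K: "0 < K" "\<And>x. norm (T x) \<le> K * norm x"
    using bounded_if_summing_const_finite[OF assms(4) _ n(1) assms(2,3)] by blast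
  obtain c A B U where "linf_operator T c K A B U"
    using linf_operator_exists[OF assms(1,4) K] by blast
  then interpret linf_operator T c K A B U .
  define \<F> where "\<F> = {lim_functional \<psi> |\<psi>. \<forall>X. \<psi> X \<in> dual_unit_ball}"
  have ctl: "controlled \<F> e" if e: "0 < e" for e
  proof (rule ccontr)
    assume nc: "\<not> ?thesis"
    \<comment> \<open>The images have norm at least \<open>e / 4\<close> and the weak sums are at
      most \<open>c\<close>; \<open>\<delta>\<close> is the lower bound left after dividing by
      \<open>c\<close>. A single \<open>n\<close> with a smaller ratio contradicts it.\<close>
    define \<delta> where "\<delta> = e / (4 * c)"
    have \<delta>: "0 < \<delta>" using e c by (simp add: \<delta>_def)
    then obtain n where n: "1 \<le> n" "summing_const q p n T / ennreal (real n powr (1 / q)) < ennreal \<delta>"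
      using small[of "ennreal \<delta>"] by auto
    obtain x where x: "\<And>\<psi>. \<psi> \<in> dual_unit_ball \<Longrightarrow> (\<Sum>k<n. cmod (\<psi> (x k))) \<le> c"
      "\<And>k. k < n \<Longrightarrow> e / 4 \<le> norm (T (x k))"
      using almost_disjoint_vectors[OF e nc[unfolded \<F>_def], of n] by blast
    define y where "y k = inverse c *\<^sub>R x k" for k
    have "weak_summing_norm p n y \<le> 1"
    proof (rule weak_summing_norm_le_1I[OF _ assms(2)])
      fix \<psi> :: "'a \<Rightarrow> complex" assume \<psi>: "\<psi> \<in> dual_unit_ball"
      have "(\<Sum>k<n. cmod (\<psi> (y k))) = inverse c * (\<Sum>k<n. cmod (\<psi> (x k)))"
        unfolding y_def dual_unit_ball_simps(4)[OF \<psi>] norm_mult norm_of_real using c by (simp add: sum_distrib_left)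
      also have "\<dots> \<le> 1" using x(1)[OF \<psi>] c by (simp add: field_simps)
      finally show "(\<Sum>k<n. cmod (\<psi> (y k))) \<le> 1" .
    qed
    moreover have "\<delta> \<le> norm (T (y k))" if "k < n" for k
      using x(2)[OF that] c by (simp add: y_def \<delta>_def T_scaleR field_simps)
    ultimately show False
      using summing_const_ratio_ge[of p n y \<delta> T q] n \<delta> assms(3) by (simp add: not_less[symmetric])
  qed
  show "weakly_compact_operator T"
  proof (rule weakly_compact_if_quadratic_majorants[OF assms(4) K(2)])
    fix e :: real assume "0 < e"
    \<comment> \<open>\<open>quadratic_majorant\<close> doubles the error.\<close>
    then have e: "0 < e / 2" by simp
    have "lim_functional (\<lambda>_. \<psi>) \<in> \<F>" if "\<psi> \<in> dual_unit_ball" for \<psi> using that by (auto simp: \<F>_def)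
    moreover have "bfunctional (K * c) \<phi>" if "\<phi> \<in> \<F>" for \<phi>
      using that by (auto simp: \<F>_def intro: bfunctional_lim_functional)
    ultimately show "\<exists>g M. (\<forall>x. 0 \<le> g x) \<and> (\<forall>x y. g (x + y) + g (x - y) = 2 * g x + 2 * (g y :: real)) \<and>
        (\<forall>x. norm x \<le> 1 \<longrightarrow> g x \<le> M \<and> norm (T x) \<le> g x + e)"
      using quadratic_majorant[OF ctl[OF e] e] by simp
  qed
qed

end
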